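(* Let $\mu,\nu$ be two Fourier quasicrystals on $\mathbb{R}^d$ with discrete spectra $\tilde\Lambda=\operatorname{supp}\hat\mu$, $\tilde\Gamma=\operatorname{supp}\hat\nu$ satisfying $$\sup_{y\in\mathbb{R}^d}\#\{\tilde\Lambda\cap B(y,1)\}<\infty,\qquad \sup_{y\in\mathbb{R}^d}\#\{\tilde\Gamma\cap B(y,1)\}<\infty .$$ Suppose that there are numberings (enumerations without repetition) $\tilde\Lambda=\{\lambda_n\}_{n=1}^\infty$, $\tilde\Gamma=\{\gamma_n\}_{n=1}^\infty$ such that $$\lambda_n-\gamma_n\to0\quad\text{and}\quad\hat\mu(\lambda_n)-\hat\nu(\gamma_n)\to0\quad\text{as } n\to\infty .$$ Then the measures $\mu$ and $\nu$ coincide.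
   Context: Here $B(x,r)=\{y\in\mathbb{R}^d:|y-x|<r\}$. $S(\mathbb{R}^d)$ is the Schwartz space and $S^*(\mathbb{R}^d)$ its dual, the space of temperate (tempered) distributions. The Fourier transform is $\hat f(\varphi)=f(\hat\varphi)$ for $\varphi\in S(\mathbb{R}^d)$, where $\hat\varphi(y)=\int_{\mathbb{R}^d}\varphi(x)e^{-2\pi i\langle x,y\rangle}dx$. A complex measure means a complex Radon (locally finite, not necessarily finite) measure on $\mathbb{R}^d$; $|\mu|$ is its total variation measure; a measure is said to belong to $S^*(\mathbb{R}^d)$ if the distribution it defines is (extends to) a temperate distribution. A measure $\mu$ is discrete if for each $\lambda\in\operatorname{supp}\mu$ there is $\varepsilon>0$ with $B(\lambda,\varepsilon)\cap\operatorname{supp}\mu=\{\lambda\}$; then $\mu(\lambda)$ denotes its mass at $\lambda$. A complex measure $\mu\in S^*(\mathbb{R}^d)$ is a Fourier quasicrystal if $\mu$ and its Fourier transform $\hat\mu$ are discrete measures and the measures $|\mu|$ and $|\hat\mu|$ belong to $S^*(\mathbb{R}^d)$. The spectrum of $\mu$ is the support of $\hat\mu$. *)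

theory Defs
  imports "HOL-Analysis.Analysis"
begin

section \<open>Schwartz functions and temperate distributions\<close>

text \<open>Iterated partial derivatives along a list of coordinate directions; the lists over
  \<^term>\<open>Basis\<close> play the role of multi-indices (in all orders of differentiation).\<close>

fun iter_deriv :: "'a list \<Rightarrow> ('a::euclidean_space \<Rightarrow> complex) \<Rightarrow> 'a \<Rightarrow> complex" where
  "iter_deriv [] f = f"
| "iter_deriv (b # bs) f = (\<lambda>x. frechet_derivative (iter_deriv bs f) (at x) b)"

definition smooth_fun :: "('a::euclidean_space \<Rightarrow> complex) \<Rightarrow> bool" where
  "smooth_fun f \<longleftrightarrow> (\<forall>bs\<in>lists Basis. \<forall>x. iter_deriv bs f differentiable (at x))"

definition test_functions :: "('a::euclidean_space \<Rightarrow> complex) set" where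
  "test_functions = {f. smooth_fun f \<and> compact (closure {x. f x \<noteq> 0})}"

definition schwartz :: "('a::euclidean_space \<Rightarrow> complex) set" where
  "schwartz = {f. smooth_fun f \<and>
     (\<forall>n. \<forall>bs\<in>lists Basis. bounded (range (\<lambda>x. (1 + norm x) ^ n *\<^sub>R iter_deriv bs f x)))}"

definition schwartz_norm :: "nat \<Rightarrow> ('a::euclidean_space \<Rightarrow> complex) \<Rightarrow> real" where
  "schwartz_norm n f =
     (SUP (x, bs) \<in> UNIV \<times> {bs \<in> lists Basis. length bs \<le> n}.
        (1 + norm x) ^ n * norm (iter_deriv bs f x))"

text \<open>A distribution is a functional on all functions of which only the values on
  \<^const>\<open>schwartz\<close> matter. The norms \<^const>\<open>schwartz_norm\<close> increase with \<open>n\<close>, so the balls below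
  form a neighbourhood base of the Schwartz topology, and the last conjunct is continuity.\<close>

definition temperate :: "(('a::euclidean_space \<Rightarrow> complex) \<Rightarrow> complex) \<Rightarrow> bool" where
  "temperate T \<longleftrightarrow>
     (\<forall>f\<in>schwartz. \<forall>g\<in>schwartz. T (\<lambda>x. f x + g x) = T f + T g) \<and>
     (\<forall>f\<in>schwartz. \<forall>c. T (\<lambda>x. c * f x) = c * T f) \<and>
     (\<forall>f\<in>schwartz. \<forall>e>0. \<exists>n. \<exists>d>0. \<forall>g\<in>schwartz.
        schwartz_norm n (\<lambda>x. g x - f x) < d \<longrightarrow> dist (T g) (T f) < e)"

definition fourier :: "('a::euclidean_space \<Rightarrow> complex) \<Rightarrow> 'a \<Rightarrow> complex" where
  "fourier f y = (LINT x|lborel. f x * exp (- (2 * of_real pi * \<i> * of_real (x \<bullet> y))))"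

definition fourier_distr ::
    "(('a::euclidean_space \<Rightarrow> complex) \<Rightarrow> complex) \<Rightarrow> ('a \<Rightarrow> complex) \<Rightarrow> complex" where
  "fourier_distr T = (\<lambda>f. T (fourier f))"


section \<open>Complex Radon measures\<close>

text \<open>A locally finite complex measure is a set function that is countably additive on the
  bounded Borel sets. It need not have a value on unbounded sets; by convention it is \<open>0\<close> off the
  bounded Borel sets, so that two such measures coincide iff they are equal as functions.\<close>

definition bounded_borel :: "'a::euclidean_space set set" where
  "bounded_borel = {B \<in> sets borel. bounded B}"

definition complex_radon :: "('a::euclidean_space set \<Rightarrow> complex) \<Rightarrow> bool" where
  "complex_radon \<mu> \<longleftrightarrow>
     (\<forall>A :: nat \<Rightarrow> 'a set. range A \<subseteq> bounded_borel \<longrightarrow> disjoint_family A \<longrightarrow> bounded (\<Union>n. A n) \<longrightarrow>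
        (\<lambda>n. \<mu> (A n)) sums \<mu> (\<Union>n. A n)) \<and>
     (\<forall>B. B \<notin> bounded_borel \<longrightarrow> \<mu> B = 0)"

text \<open>For a complex Radon measure, the set functions in the next two definitions are countably
  additive on the Borel sets, so \<^const>\<open>measure_of\<close> does turn them into measures with these values.
  The partitions and subsets are restricted to bounded sets only because \<open>\<mu>\<close> has no other
  values.\<close>

definition total_variation :: "('a::euclidean_space set \<Rightarrow> complex) \<Rightarrow> 'a measure" where
  "total_variation \<mu> = measure_of UNIV (sets borel)
     (\<lambda>A. SUP P \<in> {P. finite P \<and> disjoint P \<and> P \<subseteq> bounded_borel \<and> \<Union>P \<subseteq> A}.
            \<Sum>E\<in>P. ennreal (cmod (\<mu> E)))"

text \<open>Positive part in the Jordan decomposition of a signed measure. Note that \<^const>\<open>ennreal\<close>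
  sends negative numbers to \<open>0\<close>.\<close>

definition positive_variation :: "('a::euclidean_space set \<Rightarrow> real) \<Rightarrow> 'a measure" where
  "positive_variation \<sigma> = measure_of UNIV (sets borel)
     (\<lambda>A. SUP E \<in> {E \<in> bounded_borel. E \<subseteq> A}. ennreal (\<sigma> E))"

definition radon_integral ::
    "('a::euclidean_space set \<Rightarrow> complex) \<Rightarrow> ('a \<Rightarrow> complex) \<Rightarrow> complex" where
  "radon_integral \<mu> f =
     (LINT x|positive_variation (\<lambda>B. Re (\<mu> B)). f x)
     - (LINT x|positive_variation (\<lambda>B. - Re (\<mu> B)). f x)
     + \<i> * ((LINT x|positive_variation (\<lambda>B. Im (\<mu> B)). f x)
            - (LINT x|positive_variation (\<lambda>B. - Im (\<mu> B)). f x))"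

definition msupp :: "('a::euclidean_space set \<Rightarrow> complex) \<Rightarrow> 'a set" where
  "msupp \<mu> = - \<Union>{U. open U \<and> emeasure (total_variation \<mu>) U = 0}"

definition discrete_measure :: "('a::euclidean_space set \<Rightarrow> complex) \<Rightarrow> bool" where
  "discrete_measure \<mu> \<longleftrightarrow> (\<forall>x\<in>msupp \<mu>. \<exists>\<epsilon>>0. ball x \<epsilon> \<inter> msupp \<mu> = {x})"


section \<open>Fourier quasicrystals\<close>

text \<open>The temperate distribution \<open>T\<close> extends the functional \<open>L\<close> given on test functions. Since test
  functions are dense in the Schwartz space, \<open>T\<close> is determined by \<open>L\<close> on
  \<^const>\<open>schwartz\<close>.\<close>

definition temperate_ext ::
    "(('a::euclidean_space \<Rightarrow> complex) \<Rightarrow> complex) \<Rightarrow> (('a \<Rightarrow> complex) \<Rightarrow> complex) \<Rightarrow> bool" where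
  "temperate_ext T L \<longleftrightarrow> temperate T \<and> (\<forall>f\<in>test_functions. T f = L f)"

definition temperate_measure :: "('a::euclidean_space set \<Rightarrow> complex) \<Rightarrow> bool" where
  "temperate_measure \<mu> \<longleftrightarrow> (\<exists>T. temperate_ext T (radon_integral \<mu>))"

definition temperate_variation :: "('a::euclidean_space set \<Rightarrow> complex) \<Rightarrow> bool" where
  "temperate_variation \<mu> \<longleftrightarrow>
     (\<exists>T. temperate_ext T (\<lambda>f. LINT x|total_variation \<mu>. f x))"

text \<open>The Fourier transform of the temperate distribution defined by \<open>\<mu>\<close> is the complex Radon
  measure \<open>\<sigma>\<close>.\<close>

definition is_fourier_measure ::
    "('a::euclidean_space set \<Rightarrow> complex) \<Rightarrow> ('a set \<Rightarrow> complex) \<Rightarrow> bool" where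
  "is_fourier_measure \<mu> \<sigma> \<longleftrightarrow> complex_radon \<sigma> \<and>
     (\<exists>T. temperate_ext T (radon_integral \<mu>) \<and>
          temperate_ext (fourier_distr T) (radon_integral \<sigma>))"

text \<open>There is at most one such \<open>\<sigma>\<close>, so the choice below is no choice. The value is meaningful only
  when the Fourier transform of \<open>\<mu>\<close> is a measure.\<close>

definition fourier_measure ::
    "('a::euclidean_space set \<Rightarrow> complex) \<Rightarrow> 'a set \<Rightarrow> complex" where
  "fourier_measure \<mu> = (SOME \<sigma>. is_fourier_measure \<mu> \<sigma>)"

definition fourier_quasicrystal :: "('a::euclidean_space set \<Rightarrow> complex) \<Rightarrow> bool" where
  "fourier_quasicrystal \<mu> \<longleftrightarrow>
     complex_radon \<mu> \<and> temperate_measure \<mu> \<and>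
     (\<exists>\<sigma>. is_fourier_measure \<mu> \<sigma>) \<and>
     discrete_measure \<mu> \<and> discrete_measure (fourier_measure \<mu>) \<and>
     temperate_variation \<mu> \<and> temperate_variation (fourier_measure \<mu>)"

definition spectrum :: "('a::euclidean_space set \<Rightarrow> complex) \<Rightarrow> 'a set" where
  "spectrum \<mu> = msupp (fourier_measure \<mu>)"

end

theory Submission
  imports Defs "HOL-Complex_Analysis.Great_Picard"
begin

text \<open>For a test function \<open>\<psi>\<close> the function \<open>F t = (\<mu>^ - \<nu>^)(\<psi>(\<sqdot> - t))\<close> is an absolutely
  convergent series \<open>\<Sum>x. (\<mu>{x} - \<nu>{x}) \<psi>^(x) e(-\<langle>t, x\<rangle>)\<close>, because \<open>\<bar>\<mu>\<bar>\<close> and \<open>\<bar>\<nu>\<bar>\<close> are temperate;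
  in particular it is almost periodic. The masses of \<open>\<nu>^\<close> need not be bounded, so \<open>F\<close> is not
  obviously small at infinity. Choose therefore a ball of radius \<open>R\<close> that contains the maximal number
  of points of the spectrum of \<open>\<nu>\<close>. Along a sequence of almost periods tending to infinity the
  translates of this ball have exactly one point near each point of the original one, so the masses
  in them stay bounded and the hypotheses give \<open>\<mu>^ = \<nu>^\<close> on the ball. Hence \<open>F\<close> vanishes on
  arbitrarily large balls, so \<open>F = 0\<close> by almost periodicity, and all its coefficients vanish.\<close>

section \<open>Smooth functions\<close>

text \<open>The Fourier side enters through two facts. The transform of a test function decays
  faster than any power, so it makes a series converge whose masses grow polynomially over balls. A
  narrow enough bump has a transform that does not vanish at a prescribed point, and this reads off
  the coefficients at the end. Almost periodicity is used in sequential form: the frequencies are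
  countable, so along a subsequence all characters converge at once, and dominated convergence
  passes to the series.

  The delicate quantity is \<open>\<mu>^{\<lambda>_n} \<psi>(\<lambda>_n - t) - \<nu>^{\<gamma>_n}
  \<psi>(\<gamma>_n - t)\<close>. It splits into a difference of masses, which tends to 0, and a
  displacement multiplied by a mass of \<nu>^. A displacement tending to 0 says nothing against an
  unbounded mass; this is the obstacle that the maximal balls remove. Since paired points may lie on
  different sides of a boundary, the comparison is made with test functions supported in a slightly
  smaller concentric ball.\<close>

primrec diff_upto :: "nat \<Rightarrow> ('a::euclidean_space \<Rightarrow> complex) \<Rightarrow> bool" where
  "diff_upto 0 f \<longleftrightarrow> (\<forall>x. f differentiable (at x))"
| "diff_upto (Suc n) f \<longleftrightarrow> (\<forall>x. f differentiable (at x)) \<and>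
     (\<forall>b\<in>Basis. diff_upto n (\<lambda>x. frechet_derivative f (at x) b))"

lemma diff_upto_differentiable: "diff_upto n f \<Longrightarrow> f differentiable (at x)"
  by (cases n) auto

lemma diff_upto_Suc_imp: "diff_upto (Suc n) f \<Longrightarrow> diff_upto n f"
proof (induction n arbitrary: f)
  case (Suc n)
  then show ?case
    by (simp del: diff_upto.simps add: diff_upto.simps(2)[of "Suc n"] diff_upto.simps(2)[of n])
qed simp

lemma iter_deriv_append: "iter_deriv (bs @ cs) f = iter_deriv bs (iter_deriv cs f)"
  by (induction bs) auto

text \<open>\<open>iter_deriv\<close> adds a new direction on the outside, whereas
  \<open>diff_upto\<close> differentiates f itself first. The induction therefore takes the list
  apart at its end, where \<open>iter_deriv_append\<close> exposes the innermost derivative. The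
  inner recursion suits product and chain rules, because its induction hypothesis applies to partial
  derivatives of the factors.\<close>

lemma diff_upto_iff:
  "diff_upto n f \<longleftrightarrow> (\<forall>bs\<in>lists Basis. length bs \<le> n \<longrightarrow> (\<forall>x. iter_deriv bs f differentiable (at x)))"
proof (induction n arbitrary: f)
  case 0
  have "bs \<in> lists Basis \<and> length bs \<le> 0 \<longleftrightarrow> bs = []" for bs :: "'a list" by auto
  then show ?case by auto
next
  case (Suc n)
  show ?case
  proof
    assume L: "diff_upto (Suc n) f"
    show "\<forall>bs\<in>lists Basis. length bs \<le> Suc n \<longrightarrow> (\<forall>x. iter_deriv bs f differentiable (at x))"
    proof (intro ballI impI allI)
      fix bs :: "'a list" and x
      assume "bs \<in> lists Basis" "length bs \<le> Suc n"
      then show "iter_deriv bs f differentiable (at x)"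
      proof (cases bs rule: rev_cases)
        case (snoc cs b)
        then have "iter_deriv bs f = iter_deriv cs (\<lambda>x. frechet_derivative f (at x) b)"
          by (simp add: iter_deriv_append)
        moreover have "b \<in> Basis" "cs \<in> lists Basis" "length cs \<le> n"
          using snoc \<open>bs \<in> lists Basis\<close> \<open>length bs \<le> Suc n\<close> by auto
        ultimately show ?thesis using L Suc.IH by auto
      qed (use L in auto)
    qed
  next
    assume R: "\<forall>bs\<in>lists Basis. length bs \<le> Suc n \<longrightarrow> (\<forall>x. iter_deriv bs f differentiable (at x))"
    have "iter_deriv bs (\<lambda>x. frechet_derivative f (at x) b) differentiable (at x)"
      if "b \<in> Basis" "bs \<in> lists Basis" "length bs \<le> n" for b bs x
      using R[rule_format, of "bs @ [b]" x] that by (simp add: iter_deriv_append)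
    moreover have "f differentiable (at x)" for x
      using R[rule_format, of "[]" x] by simp
    ultimately show "diff_upto (Suc n) f" by (auto simp: Suc.IH)
  qed
qed

lemma smooth_fun_iff_diff_upto: "smooth_fun f \<longleftrightarrow> (\<forall>n. diff_upto n f)"
  unfolding smooth_fun_def diff_upto_iff by auto

lemma smooth_fun_differentiable: "smooth_fun f \<Longrightarrow> f differentiable (at x)"
  using diff_upto_differentiable smooth_fun_iff_diff_upto by blast

lemma smooth_fun_continuous: "smooth_fun f \<Longrightarrow> continuous_on A f"
  by (simp add: continuous_at_imp_continuous_on differentiable_imp_continuous_within
      smooth_fun_differentiable)

lemma smooth_fun_partial:
  "smooth_fun f \<Longrightarrow> b \<in> Basis \<Longrightarrow> smooth_fun (\<lambda>x. frechet_derivative f (at x) b)"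
  unfolding smooth_fun_iff_diff_upto by (metis diff_upto.simps(2))

lemma smooth_fun_iter_deriv: "smooth_fun f \<Longrightarrow> bs \<in> lists Basis \<Longrightarrow> smooth_fun (iter_deriv bs f)"
  by (induction bs) (auto intro: smooth_fun_partial)

lemma partial_add:
  "f differentiable (at x) \<Longrightarrow> g differentiable (at x) \<Longrightarrow>
   frechet_derivative (\<lambda>x. f x + g x) (at x) b = frechet_derivative f (at x) b + frechet_derivative g (at x) b"
  using frechet_derivative_at[OF has_derivative_add, of f "frechet_derivative f (at x)" x g
      "frechet_derivative g (at x)", symmetric]
  by (simp add: frechet_derivative_works[symmetric])

lemma partial_mult:
  fixes f g :: "'a::euclidean_space \<Rightarrow> complex"
  assumes "f differentiable (at x)" "g differentiable (at x)"
  shows "frechet_derivative (\<lambda>x. f x * g x) (at x) b =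
     frechet_derivative f (at x) b * g x + f x * frechet_derivative g (at x) b"
proof -
  have "((\<lambda>x. f x * g x) has_derivative
     (\<lambda>h. f x * frechet_derivative g (at x) h + frechet_derivative f (at x) h * g x)) (at x)"
    using assms by (intro has_derivative_mult) (simp_all add: frechet_derivative_works[symmetric])
  from frechet_derivative_at[OF this] show ?thesis by (metis add.commute)
qed

lemma diff_upto_add: "diff_upto n f \<Longrightarrow> diff_upto n g \<Longrightarrow> diff_upto n (\<lambda>x. f x + g x)"
  by (induction n arbitrary: f g) (simp_all add: partial_add)

text \<open>A partial derivative of a product is a sum of two products of lower order; the
  undifferentiated factor is lowered from \<open>Suc n\<close> to n by
  \<open>diff_upto_Suc_imp\<close>.\<close>

lemma diff_upto_mult: "diff_upto n f \<Longrightarrow> diff_upto n g \<Longrightarrow> diff_upto n (\<lambda>x. f x * g x)"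
proof (induction n arbitrary: f g)
  case (Suc n)
  have "diff_upto n f" "diff_upto n g" using Suc.prems diff_upto_Suc_imp by blast+
  with Suc show ?case
    by (auto simp: partial_mult intro!: diff_upto_add)
qed simp

lemma smooth_fun_add: "smooth_fun f \<Longrightarrow> smooth_fun g \<Longrightarrow> smooth_fun (\<lambda>x. f x + g x)"
  by (simp add: smooth_fun_iff_diff_upto diff_upto_add)

lemma smooth_fun_mult: "smooth_fun f \<Longrightarrow> smooth_fun g \<Longrightarrow> smooth_fun (\<lambda>x. f x * g x)"
  by (simp add: smooth_fun_iff_diff_upto diff_upto_mult)

lemma diff_upto_const: "diff_upto n (\<lambda>x. c)"
  by (induction n arbitrary: c) auto

lemma smooth_fun_const: "smooth_fun (\<lambda>x. c)"
  by (simp add: smooth_fun_iff_diff_upto diff_upto_const)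

lemma smooth_fun_inner: "smooth_fun (\<lambda>x. complex_of_real (x \<bullet> v))"
  unfolding smooth_fun_iff_diff_upto
proof
  fix n
  have D: "((\<lambda>x. complex_of_real (x \<bullet> v)) has_derivative (\<lambda>h. complex_of_real (h \<bullet> v))) (at x)" for x
    by (auto intro!: derivative_eq_intros)
  have "frechet_derivative (\<lambda>x. complex_of_real (x \<bullet> v)) (at x) = (\<lambda>h. complex_of_real (h \<bullet> v))" for x
    using frechet_derivative_at[OF D] by simp
  moreover have "(\<lambda>x. complex_of_real (x \<bullet> v)) differentiable (at x)" for x
    using D differentiable_def by blast
  ultimately show "diff_upto n (\<lambda>x. complex_of_real (x \<bullet> v))"
    by (cases n) (auto simp: diff_upto_const)
qed

lemma partial_affine:
  fixes f :: "'a::euclidean_space \<Rightarrow> complex"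
  assumes "f differentiable (at (c *\<^sub>R x + t))"
  shows "frechet_derivative (\<lambda>x. f (c *\<^sub>R x + t)) (at x) b = of_real c * frechet_derivative f (at (c *\<^sub>R x + t)) b"
    and "(\<lambda>x. f (c *\<^sub>R x + t)) differentiable (at x)"
proof -
  have "((\<lambda>x. c *\<^sub>R x + t) has_derivative (\<lambda>h. c *\<^sub>R h)) (at x)"
    by (auto intro!: derivative_eq_intros)
  moreover have "(f has_derivative frechet_derivative f (at (c *\<^sub>R x + t))) (at (c *\<^sub>R x + t))"
    using assms frechet_derivative_works by blast
  ultimately have D: "((\<lambda>x. f (c *\<^sub>R x + t)) has_derivative
      (\<lambda>h. frechet_derivative f (at (c *\<^sub>R x + t)) (c *\<^sub>R h))) (at x)"
    by (rule has_derivative_compose)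
  then show "(\<lambda>x. f (c *\<^sub>R x + t)) differentiable (at x)"
    using differentiable_def by blast
  have "frechet_derivative f (at (c *\<^sub>R x + t)) (c *\<^sub>R b) = c *\<^sub>R frechet_derivative f (at (c *\<^sub>R x + t)) b"
    using assms by (intro linear_cmul linear_frechet_derivative)
  with frechet_derivative_at[OF D, symmetric]
  show "frechet_derivative (\<lambda>x. f (c *\<^sub>R x + t)) (at x) b = of_real c * frechet_derivative f (at (c *\<^sub>R x + t)) b"
    by (simp add: scaleR_conv_of_real)
qed

lemma iter_deriv_cmult:
  assumes "smooth_fun f" "bs \<in> lists Basis"
  shows "iter_deriv bs (\<lambda>x. c * f x) = (\<lambda>x. c * iter_deriv bs f x)"
  using assms(2)
proof (induction bs)
  case (Cons b bs)
  then have "iter_deriv bs f differentiable (at x)" for x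
    using assms(1) by (auto simp: smooth_fun_def)
  with Cons show ?case by (auto simp: partial_mult)
qed simp

lemma iter_deriv_add:
  assumes "smooth_fun f" "smooth_fun g" "bs \<in> lists Basis"
  shows "iter_deriv bs (\<lambda>x. f x + g x) = (\<lambda>x. iter_deriv bs f x + iter_deriv bs g x)"
  using assms(3)
proof (induction bs)
  case (Cons b bs)
  then have "iter_deriv bs f differentiable (at x)" "iter_deriv bs g differentiable (at x)" for x
    using assms(1,2) by (auto simp: smooth_fun_def)
  with Cons show ?case by (auto simp: partial_add)
qed simp

lemma iter_deriv_affine:
  assumes "smooth_fun f" "bs \<in> lists Basis"
  shows "iter_deriv bs (\<lambda>x. f (c *\<^sub>R x + t)) = (\<lambda>x. of_real c ^ length bs * iter_deriv bs f (c *\<^sub>R x + t))"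
  using assms(2)
proof (induction bs)
  case (Cons b bs)
  then have D: "iter_deriv bs f differentiable (at x)" for x
    using assms(1) by (auto simp: smooth_fun_def)
  with Cons partial_affine[where f="iter_deriv bs f" and c=c and t=t]
  show ?case by (auto simp: partial_mult)
qed simp

lemma smooth_fun_affine:
  assumes "smooth_fun f"
  shows "smooth_fun (\<lambda>x. f (c *\<^sub>R x + t))"
  unfolding smooth_fun_def
proof (intro ballI allI)
  fix bs :: "'a list" and x assume bs: "bs \<in> lists Basis"
  then have "iter_deriv bs f differentiable (at x)" for x
    using assms(1) by (auto simp: smooth_fun_def)
  then show "iter_deriv bs (\<lambda>x. f (c *\<^sub>R x + t)) differentiable (at x)"
    using partial_affine(2)[where f="iter_deriv bs f" and c=c and t=t]
    by (simp add: iter_deriv_affine assms bs)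
qed

lemma iter_deriv_outside_support:
  fixes f :: "'a::euclidean_space \<Rightarrow> complex"
  assumes "closed K" "\<And>x. x \<notin> K \<Longrightarrow> f x = 0" "x \<notin> K"
  shows "iter_deriv bs f x = 0"
  using assms(3)
proof (induction bs arbitrary: x)
  case (Cons b bs)
  have "(iter_deriv bs f has_derivative (\<lambda>h. 0)) (at x)"
    by (rule has_derivative_transform_within_open[where f="\<lambda>x. 0" and s="-K"])
      (use assms Cons in auto)
  from frechet_derivative_at[OF this] show ?case by (metis iter_deriv.simps(2))
qed (use assms in auto)

section \<open>Smooth bump functions\<close>

text \<open>The function exp(-1/t), glued to 0, with an extra factor t^(-n). This factor makes the
  family closed under differentiation up to linear combinations, so one induction proves all members
  smooth.\<close>

definition flat_exp :: "nat \<Rightarrow> real \<Rightarrow> real" where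
  "flat_exp n t = (if t > 0 then exp (- inverse t) * inverse t ^ n else 0)"

lemma flat_exp_tendsto_0: "(flat_exp n \<longlongrightarrow> 0) (at 0)"
proof -
  have "((\<lambda>y::real. y ^ n / exp y) \<longlongrightarrow> 0) at_top"
    by (rule tendsto_power_div_exp_0)
  then have "((\<lambda>t::real. inverse t ^ n / exp (inverse t)) \<longlongrightarrow> 0) (at_right 0)"
    by (rule filterlim_compose[OF _ filterlim_inverse_at_top_right])
  then have R: "(flat_exp n \<longlongrightarrow> 0) (at_right 0)"
  proof (rule Lim_transform_eventually)
    show "\<forall>\<^sub>F t in at_right 0. inverse t ^ n / exp (inverse t) = flat_exp n t"
      by (auto simp: flat_exp_def exp_minus field_simps eventually_at_right[of 0 1] intro: exI[of _ 1])
  qed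
  have L: "(flat_exp n \<longlongrightarrow> 0) (at_left 0)"
    by (rule Lim_transform_eventually[OF tendsto_const])
      (auto simp: flat_exp_def eventually_at_left[of "-1" 0] intro: exI[of _ "-1"])
  show ?thesis using L R by (simp add: filterlim_at_split)
qed

lemma flat_exp_has_derivative:
  "(flat_exp n has_real_derivative (flat_exp (n + 2) t - n * flat_exp (n + 1) t)) (at t)"
proof -
  consider "t > 0" | "t < 0" | "t = 0" by linarith
  then show ?thesis
  proof cases
    case 1
    have "((\<lambda>t. exp (- inverse t) * inverse t ^ n) has_real_derivative
       (flat_exp (n + 2) t - n * flat_exp (n + 1) t)) (at t)"
      using 1 by (auto intro!: derivative_eq_intros simp: flat_exp_def)
        (cases n; simp add: power2_eq_square algebra_simps)
    then show ?thesis
      by (rule has_field_derivative_transform_within[where d=t])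
        (use 1 in \<open>auto simp: flat_exp_def dist_real_def\<close>)
  next
    case 2
    have "((\<lambda>t. 0) has_real_derivative (flat_exp (n + 2) t - n * flat_exp (n + 1) t)) (at t)"
      using 2 by (auto simp: flat_exp_def)
    then show ?thesis
      by (rule has_field_derivative_transform_within[where d="-t"])
        (use 2 in \<open>auto simp: flat_exp_def dist_real_def\<close>)
  next
    case 3
    \<comment> \<open>The difference quotient at 0 is the next member of the family, also at h = 0,
      where division by zero yields 0; flatness then gives the derivative.\<close>
    have "(\<lambda>h. (flat_exp n (0 + h) - flat_exp n 0) / h) = flat_exp (Suc n)"
      by (auto simp: flat_exp_def divide_inverse)
    then show ?thesis
      using flat_exp_tendsto_0[of "Suc n"] 3 by (simp add: DERIV_def) (simp add: flat_exp_def)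
  qed
qed

lemma partial_flat_exp_compose:
  fixes \<rho> :: "'a::euclidean_space \<Rightarrow> real"
  assumes "\<rho> differentiable (at x)"
  shows "(\<lambda>x. complex_of_real (flat_exp n (\<rho> x))) differentiable (at x)"
    and "frechet_derivative (\<lambda>x. complex_of_real (flat_exp n (\<rho> x))) (at x) b =
      complex_of_real (frechet_derivative \<rho> (at x) b) *
        (complex_of_real (flat_exp (n + 2) (\<rho> x)) +
         complex_of_real (- real n) * complex_of_real (flat_exp (n + 1) (\<rho> x)))"
proof -
  have "(\<rho> has_derivative frechet_derivative \<rho> (at x)) (at x)"
    using assms frechet_derivative_works by blast
  moreover have "(flat_exp n has_derivative
      (\<lambda>h. (flat_exp (n + 2) (\<rho> x) - n * flat_exp (n + 1) (\<rho> x)) * h)) (at (\<rho> x))"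
    using flat_exp_has_derivative by (rule has_field_derivative_imp_has_derivative)
  ultimately have D0: "((\<lambda>x. flat_exp n (\<rho> x)) has_derivative
      (\<lambda>h. (flat_exp (n + 2) (\<rho> x) - n * flat_exp (n + 1) (\<rho> x)) * frechet_derivative \<rho> (at x) h)) (at x)"
    by (rule has_derivative_compose)
  have D: "((\<lambda>x. complex_of_real (flat_exp n (\<rho> x))) has_derivative
      (\<lambda>h. complex_of_real ((flat_exp (n + 2) (\<rho> x) - n * flat_exp (n + 1) (\<rho> x)) * frechet_derivative \<rho> (at x) h))) (at x)"
    using D0 by (rule has_derivative_of_real)
  then show "(\<lambda>x. complex_of_real (flat_exp n (\<rho> x))) differentiable (at x)"
    using differentiable_def by blast
  show "frechet_derivative (\<lambda>x. complex_of_real (flat_exp n (\<rho> x))) (at x) b =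
      complex_of_real (frechet_derivative \<rho> (at x) b) *
        (complex_of_real (flat_exp (n + 2) (\<rho> x)) +
         complex_of_real (- real n) * complex_of_real (flat_exp (n + 1) (\<rho> x)))"
    by (simp add: frechet_derivative_at[OF D, symmetric] algebra_simps)
qed

text \<open>Differentiation raises the power n, so the induction on k keeps n arbitrary. The
  coefficients that appear are partial derivatives of the inner function, smooth by
  assumption.\<close>

lemma diff_upto_flat_exp_compose:
  fixes \<rho> :: "'a::euclidean_space \<Rightarrow> real"
  assumes diff: "\<And>x. \<rho> differentiable (at x)"
    and part: "\<And>b. b \<in> Basis \<Longrightarrow> smooth_fun (\<lambda>x. complex_of_real (frechet_derivative \<rho> (at x) b))"
  shows "diff_upto k (\<lambda>x. complex_of_real (flat_exp n (\<rho> x)))"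
proof (induction k arbitrary: n)
  case 0
  then show ?case by (simp add: partial_flat_exp_compose diff)
next
  case (Suc k)
  have "diff_upto k (\<lambda>x. complex_of_real (frechet_derivative \<rho> (at x) b) *
        (complex_of_real (flat_exp (n + 2) (\<rho> x)) +
         complex_of_real (- real n) * complex_of_real (flat_exp (n + 1) (\<rho> x))))" if "b \<in> Basis" for b
    using part[OF that] Suc unfolding smooth_fun_iff_diff_upto
    by (intro diff_upto_mult diff_upto_add diff_upto_const) auto
  moreover have "(\<lambda>x. frechet_derivative (\<lambda>x. complex_of_real (flat_exp n (\<rho> x))) (at x) b) =
     (\<lambda>x. complex_of_real (frechet_derivative \<rho> (at x) b) *
        (complex_of_real (flat_exp (n + 2) (\<rho> x)) +
         complex_of_real (- real n) * complex_of_real (flat_exp (n + 1) (\<rho> x))))" for b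
    by (rule ext, rule partial_flat_exp_compose(2)[OF diff])
  ultimately show ?case
    by (simp add: partial_flat_exp_compose(1)[OF diff])
qed

text \<open>Composing with the squared norm keeps smoothness at the origin; for r > 0 the argument
  is positive exactly on the open ball of radius r.\<close>

definition bump :: "real \<Rightarrow> 'a::euclidean_space \<Rightarrow> real" where
  "bump r x = flat_exp 0 (r\<^sup>2 - x \<bullet> x)"

lemma bump_nonneg: "bump r x \<ge> 0"
  by (simp add: bump_def flat_exp_def)

lemma bump_pos_iff: "r > 0 \<Longrightarrow> bump r x > 0 \<longleftrightarrow> norm x < r"
  using power_strict_mono[of "norm x" r 2] power_less_imp_less_base[of "norm x" 2 r]
  by (auto simp add: bump_def flat_exp_def power2_norm_eq_inner[symmetric])

lemma bump_eq_0: "r > 0 \<Longrightarrow> norm x \<ge> r \<Longrightarrow> bump r x = 0"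
  using bump_pos_iff[of r x] bump_nonneg[of r x] by linarith

lemma bump_antimono: 
  assumes "norm x \<le> norm y"
  shows "bump r y \<le> bump r x"
proof -
  have *: "x \<bullet> x \<le> y \<bullet> y"
    using assms by (simp add: norm_eq_sqrt_inner)
  have "exp (- inverse (r\<^sup>2 - y \<bullet> y)) \<le> exp (- inverse (r\<^sup>2 - x \<bullet> x))" if "r\<^sup>2 - y \<bullet> y > 0"
    using that * by (simp add: le_imp_inverse_le)
  then show ?thesis using * by (auto simp: bump_def flat_exp_def)
qed

lemma smooth_fun_bump: "smooth_fun (\<lambda>x::'a::euclidean_space. complex_of_real (bump r x))"
proof -
  let ?\<rho> = "\<lambda>x::'a. r\<^sup>2 - x \<bullet> x"
  have D: "(?\<rho> has_derivative (\<lambda>h. - (2 * (x \<bullet> h)))) (at x)" for x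
    by (auto intro!: derivative_eq_intros simp: inner_commute)
  have "smooth_fun (\<lambda>x. complex_of_real (frechet_derivative ?\<rho> (at x) b))" for b
    using smooth_fun_mult[OF smooth_fun_const[of "-2"] smooth_fun_inner[of b]]
    by (simp add: frechet_derivative_at[OF D, symmetric])
  then show ?thesis
    unfolding bump_def smooth_fun_iff_diff_upto[of "\<lambda>x. complex_of_real (flat_exp 0 (r\<^sup>2 - x \<bullet> x))"]
    using D by (intro allI diff_upto_flat_exp_compose) (auto intro: differentiableI)
qed

section \<open>Compactly supported smooth functions\<close>

lemma test_functionsI:
  fixes f :: "'a::euclidean_space \<Rightarrow> complex"
  assumes "smooth_fun f" "bounded {x. f x \<noteq> 0}"
  shows "f \<in> test_functions"
  using assms by (simp add: test_functions_def compact_closure)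

lemma test_functions_smooth: "f \<in> test_functions \<Longrightarrow> smooth_fun f"
  by (simp add: test_functions_def)

lemma test_functions_bounded_support: "f \<in> test_functions \<Longrightarrow> bounded {x. f x \<noteq> 0}"
  by (simp add: test_functions_def compact_closure)

lemma test_functions_supportE:
  fixes f :: "'a::euclidean_space \<Rightarrow> complex"
  assumes "f \<in> test_functions"
  obtains R where "R > 0" "\<And>x. norm x > R \<Longrightarrow> f x = 0"
  using test_functions_bounded_support[OF assms] unfolding bounded_pos by force

lemma test_functions_mult:
  assumes "f \<in> test_functions" "smooth_fun g"
  shows "(\<lambda>x. f x * g x) \<in> test_functions" and "(\<lambda>x. g x * f x) \<in> test_functions"
proof -
  have "bounded {x. f x * g x \<noteq> 0}" "bounded {x. g x * f x \<noteq> 0}"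
    by (rule bounded_subset[OF test_functions_bounded_support[OF assms(1)]]; force)+
  then show "(\<lambda>x. f x * g x) \<in> test_functions" "(\<lambda>x. g x * f x) \<in> test_functions"
    using assms by (simp_all add: test_functionsI smooth_fun_mult test_functions_smooth)
qed

lemma test_functions_iter_deriv:
  assumes "f \<in> test_functions" "bs \<in> lists Basis"
  shows "iter_deriv bs f \<in> test_functions"
proof (rule test_functionsI)
  obtain R where R: "\<And>x. norm x > R \<Longrightarrow> f x = 0" using test_functions_supportE assms(1) by blast
  have "iter_deriv bs f x = 0" if "norm x > R" for x
    by (rule iter_deriv_outside_support[of "cball 0 R"]) (use R that in auto)
  then show "bounded {x. iter_deriv bs f x \<noteq> 0}"
    unfolding bounded_iff by (force intro: exI[of _ R])
qed (use assms in \<open>simp add: smooth_fun_iter_deriv test_functions_smooth\<close>)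

lemma test_functions_affine:
  assumes "f \<in> test_functions" "c \<noteq> 0"
  shows "(\<lambda>x. f (c *\<^sub>R x + t)) \<in> test_functions"
proof (rule test_functionsI)
  obtain R where R: "\<And>x. norm x > R \<Longrightarrow> f x = 0" using test_functions_supportE assms(1) by blast
  have "norm x \<le> (R + norm t) / \<bar>c\<bar>" if "f (c *\<^sub>R x + t) \<noteq> 0" for x
  proof -
    have "norm (c *\<^sub>R x) \<le> norm (c *\<^sub>R x + t) + norm t"
      by (metis add.commute add_diff_cancel norm_triangle_ineq4 )
    also have "norm (c *\<^sub>R x + t) \<le> R" using R that by force
    finally show ?thesis using assms(2) by (simp add: field_simps)
  qed
  then show "bounded {x. f (c *\<^sub>R x + t) \<noteq> 0}"
    unfolding bounded_iff by blast
qed (use assms in \<open>simp add: smooth_fun_affine test_functions_smooth\<close>)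

lemma test_functions_bound:
  fixes f :: "'a::euclidean_space \<Rightarrow> complex"
  assumes "f \<in> test_functions"
  obtains M::real where "M > 0" "\<And>x. norm (f x) \<le> M"
proof -
  have "compact (closure {x. f x \<noteq> 0})" using assms by (simp add: test_functions_def)
  then have "bounded (f ` closure {x. f x \<noteq> 0})"
    using assms by (intro compact_imp_bounded compact_continuous_image smooth_fun_continuous test_functions_smooth)
  then obtain M where "M > 0" "\<And>x. x \<in> closure {x. f x \<noteq> 0} \<Longrightarrow> norm (f x) \<le> M"
    unfolding bounded_pos by auto
  then have "norm (f x) \<le> M" for x
    using closure_subset[of "{x. f x \<noteq> 0}"] by (cases "f x = 0") auto
  with \<open>M > 0\<close> show ?thesis using that by blast
qed

lemma test_functions_subset_schwartz: "test_functions \<subseteq> (schwartz :: ('a::euclidean_space \<Rightarrow> complex) set)"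
proof
  fix f :: "'a \<Rightarrow> complex" assume f: "f \<in> test_functions"
  have "bounded (range (\<lambda>x. (1 + norm x) ^ n *\<^sub>R iter_deriv bs f x))" if bs: "bs \<in> lists Basis" for n bs
  proof -
    obtain R where R: "R > 0" "\<And>x. norm x > R \<Longrightarrow> iter_deriv bs f x = 0"
      using test_functions_supportE[OF test_functions_iter_deriv[OF f bs]] by blast
    obtain M where M: "M > 0" "\<And>x. norm (iter_deriv bs f x) \<le> M"
      using test_functions_bound[OF test_functions_iter_deriv[OF f bs]] by blast
    have "norm ((1 + norm x) ^ n *\<^sub>R iter_deriv bs f x) \<le> (1 + R) ^ n * M" for x
      using R M by (cases "norm x > R") (auto intro!: mult_mono power_mono)
    then show ?thesis unfolding bounded_iff by blast
  qed
  with f show "f \<in> schwartz" by (auto simp: schwartz_def test_functions_smooth)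
qed

lemma test_functions_bump:
  assumes "r > 0"
  shows "(\<lambda>x. complex_of_real (bump r x)) \<in> test_functions"
proof (rule test_functionsI[OF smooth_fun_bump])
  have "norm x \<le> r" if "bump r x \<noteq> 0" for x :: 'a
    using bump_eq_0[OF assms, of x] that by linarith
  then show "bounded {x::'a. complex_of_real (bump r x) \<noteq> 0}"
    unfolding bounded_iff by auto
qed

text \<open>Each partial derivative is a test function, hence bounded. Expanding a direction in the
  basis bounds the operator norm of the derivative uniformly, and the mean value inequality applies
  on the whole space.\<close>

lemma test_functions_lipschitz:
  fixes f :: "'a::euclidean_space \<Rightarrow> complex"
  assumes "f \<in> test_functions"
  obtains L where "L > 0" "\<And>x y. norm (f x - f y) \<le> L * norm (x - y)"
proof -
  have "\<exists>M. \<forall>x. norm (frechet_derivative f (at x) b) \<le> M" if "b \<in> Basis" for b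
  proof -
    have "iter_deriv [b] f \<in> test_functions" using assms that by (intro test_functions_iter_deriv) auto
    from test_functions_bound[OF this] show ?thesis by auto
  qed
  then obtain M where M: "\<And>b x. b \<in> Basis \<Longrightarrow> norm (frechet_derivative f (at x) b) \<le> M b"
    by metis
  define L where "L = (\<Sum>b\<in>(Basis::'a set). M b)"
  have diff: "f differentiable (at x)" for x
    using assms smooth_fun_differentiable test_functions_smooth by blast
  have "onorm (frechet_derivative f (at x)) \<le> L" for x
  proof (rule onorm_le)
    fix h
    have lin: "linear (frechet_derivative f (at x))" using diff by (rule linear_frechet_derivative)
    have "frechet_derivative f (at x) h = frechet_derivative f (at x) (\<Sum>b\<in>Basis. (h \<bullet> b) *\<^sub>R b)"
      by (simp add: euclidean_representation)
    also have "\<dots> = (\<Sum>b\<in>Basis. (h \<bullet> b) *\<^sub>R frechet_derivative f (at x) b)"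
      using lin by (simp add: linear_sum linear_cmul)
    also have "norm \<dots> \<le> (\<Sum>b\<in>Basis. M b * norm h)"
      by (intro sum_norm_le) (auto intro!: mult_mono' M simp: mult.commute[of _ "norm h"] Basis_le_norm)
    finally show "norm (frechet_derivative f (at x) h) \<le> L * norm h" by (simp add: L_def sum_distrib_right)
  qed
  then have "norm (f x - f y) \<le> L * norm (x - y)" for x y
    by (intro differentiable_bound[where S=UNIV and f'="\<lambda>x. frechet_derivative f (at x)"])
      (use diff frechet_derivative_works in auto)
  moreover have "L * norm (x - y) \<le> (\<bar>L\<bar> + 1) * norm (x - y)" for x y :: 'a
    by (intro mult_right_mono) auto
  ultimately have "norm (f x - f y) \<le> (\<bar>L\<bar> + 1) * norm (x - y)" for x y
    by (rule order_trans)
  moreover have "\<bar>L\<bar> + 1 > 0" by linarith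
  ultimately show ?thesis using that by blast
qed

section \<open>Fourier transforms of test functions\<close>

text \<open>The sign of the Fourier kernel is built in: the transform at y integrates
  \<open>f x * chr (x \<bullet> y)\<close>.\<close>

definition chr :: "real \<Rightarrow> complex" where
  "chr t = cis (- (2 * pi * t))"

lemma chr_add: "chr (s + t) = chr s * chr t"
  by (simp add: chr_def cis_mult algebra_simps)

lemma chr_0 [simp]: "chr 0 = 1"
  by (simp add: chr_def)

lemma norm_chr [simp]: "norm (chr t) = 1"
  by (simp add: chr_def)

lemma chr_minus: "chr (- t) = cnj (chr t)"
  by (simp add: chr_def cis_cnj)

lemma continuous_chr [continuous_intros]:
  "continuous_on A f \<Longrightarrow> continuous_on A (\<lambda>x. chr (f x))"
  unfolding chr_def by (intro continuous_intros)

lemma borel_measurable_chr [measurable]: "chr \<in> borel_measurable borel"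
  by (intro borel_measurable_continuous_onI continuous_intros)

lemma chr_conv_exp: "chr t = exp (- (2 * of_real pi * \<i> * of_real t))"
  by (simp add: chr_def cis_conv_exp algebra_simps)

lemma norm_chr_taylor0: "norm (chr t - 1) \<le> 2 * pi * \<bar>t\<bar>"
  using Taylor_exp[of "- (2 * of_real pi * \<i> * of_real t)" 0]
  by (simp add: chr_conv_exp norm_mult)

lemma norm_chr_taylor1: "norm (chr t - 1 + 2 * of_real pi * \<i> * of_real t) \<le> (2 * pi * \<bar>t\<bar>)\<^sup>2"
  using Taylor_exp[of "- (2 * of_real pi * \<i> * of_real t)" 1]
  by (simp add: chr_conv_exp norm_mult algebra_simps power2_eq_square)

lemma fourier_eq: "fourier f y = (LINT x|lborel. f x * chr (x \<bullet> y))"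
  by (simp add: fourier_def chr_conv_exp)

lemma integrable_test_mult:
  fixes f g :: "'a::euclidean_space \<Rightarrow> complex"
  assumes "f \<in> test_functions" "continuous_on UNIV g"
  shows "integrable lborel (\<lambda>x. f x * g x)"
proof -
  obtain R where R: "\<And>x. norm x > R \<Longrightarrow> f x = 0" using test_functions_supportE assms(1) by blast
  have "integrable lborel (\<lambda>x. indicator (cball 0 R) x *\<^sub>R (f x * g x))"
    using assms by (intro borel_integrable_compact continuous_intros smooth_fun_continuous
        test_functions_smooth continuous_on_subset[OF assms(2)]) auto
  moreover have "(\<lambda>x. indicator (cball 0 R) x *\<^sub>R (f x * g x)) = (\<lambda>x. f x * g x)"
    using R by (auto simp: indicator_def fun_eq_iff not_le)
  ultimately show ?thesis by simp
qed

lemma integrable_test: "f \<in> test_functions \<Longrightarrow> integrable lborel f"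
  using integrable_test_mult[of f "\<lambda>x. 1"] by simp

lemma integrable_fourier:
  "f \<in> test_functions \<Longrightarrow> integrable lborel (\<lambda>x. f x * chr (x \<bullet> y))"
  by (intro integrable_test_mult continuous_intros)

lemma norm_fourier_le:
  assumes "f \<in> test_functions"
  shows "norm (fourier f y) \<le> (LINT x|lborel. norm (f x))"
proof -
  have "norm (fourier f y) \<le> (LINT x|lborel. norm (f x * chr (x \<bullet> y)))"
    unfolding fourier_eq by (rule integral_norm_bound)
  then show ?thesis by (simp add: norm_mult)
qed

text \<open>A translation only twists the transform by a character; this is why pairing with
  translates produces an almost periodic series with fixed coefficients.\<close>

lemma fourier_translate:
  fixes f :: "'a::euclidean_space \<Rightarrow> complex"
  assumes "f \<in> test_functions"
  shows "fourier (\<lambda>x. f (x - t)) y = chr (t \<bullet> y) * fourier f y"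
proof -
  have [measurable]: "f \<in> borel_measurable borel"
    using integrable_test[OF assms] borel_measurable_integrable by force
  have "fourier (\<lambda>x. f (x - t)) y = (LINT x|distr lborel borel ((+) t). f (x - t) * chr (x \<bullet> y))"
    by (simp add: lborel_distr_plus fourier_eq)
  also have "\<dots> = (LINT x|lborel. f (t + x - t) * chr ((t + x) \<bullet> y))"
    by (rule integral_distr) simp_all
  also have "\<dots> = (LINT x|lborel. chr (t \<bullet> y) * (f x * chr (x \<bullet> y)))"
    by (simp add: inner_add_left chr_add mult_ac)
  also have "\<dots> = chr (t \<bullet> y) * fourier f y"
    unfolding fourier_eq by simp
  finally show ?thesis .
qed

lemma smooth_fun_linear_factor: "smooth_fun (\<lambda>x. - (2 * of_real pi * \<i> * complex_of_real (x \<bullet> h)))"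
  using smooth_fun_mult[OF smooth_fun_const[of "- (2 * of_real pi * \<i>)"] smooth_fun_inner[of h]]
  by simp

text \<open>On the support of f the second-order remainder of the character is quadratic in the
  increment with a constant depending on R alone, so the remainder of the transform is quadratic
  too. The derivative is again the transform of a test function, f times a linear factor, which
  allows iteration.\<close>

lemma fourier_has_derivative:
  fixes f :: "'a::euclidean_space \<Rightarrow> complex"
  assumes "f \<in> test_functions"
  shows "(fourier f has_derivative
    (\<lambda>h. fourier (\<lambda>x. f x * - (2 * of_real pi * \<i> * of_real (x \<bullet> h))) y)) (at y)"
    (is "(_ has_derivative ?D) _")
proof -
  obtain R where R: "R > 0" "\<And>x. norm x > R \<Longrightarrow> f x = 0" using test_functions_supportE assms by blast
  have int: "integrable lborel (\<lambda>x. f x * - (2 * of_real pi * \<i> * of_real (x \<bullet> h)) * chr (x \<bullet> y))" for h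
    by (intro integrable_fourier test_functions_mult assms smooth_fun_linear_factor)
  have "linear ?D"
  proof (rule linearI)
    show "?D (h + k) = ?D h + ?D k" for h k
      unfolding fourier_eq using Bochner_Integration.integral_add[OF int[of h] int[of k], symmetric]
      by (simp add: inner_add_right algebra_simps)
    show "?D (c *\<^sub>R h) = c *\<^sub>R ?D h" for c h
      unfolding fourier_eq integral_scaleR_right[symmetric]
      by (simp add: scaleR_conv_of_real algebra_simps)
  qed
  then have bl: "bounded_linear ?D" by (simp add: linear_conv_bounded_linear)
  define C where "C = (LINT x|lborel. norm (f x) * (2 * pi * R)\<^sup>2)"
  have est: "norm (fourier f z - fourier f y - ?D (z - y)) \<le> C * (norm (z - y))\<^sup>2" for z
  proof -
    let ?h = "z - y"
    have "fourier f z - fourier f y - ?D ?h =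
       (LINT x|lborel. f x * chr (x \<bullet> z) - f x * chr (x \<bullet> y)
          - f x * - (2 * of_real pi * \<i> * of_real (x \<bullet> ?h)) * chr (x \<bullet> y))"
      unfolding fourier_eq
        Bochner_Integration.integral_diff[OF Bochner_Integration.integrable_diff
          [OF integrable_fourier[OF assms] integrable_fourier[OF assms]] int]
        Bochner_Integration.integral_diff[OF integrable_fourier[OF assms] integrable_fourier[OF assms]]
      ..
    also have "norm \<dots> \<le> (LINT x|lborel. norm (f x) * (2 * pi * R)\<^sup>2 * (norm ?h)\<^sup>2)"
    proof (rule Bochner_Integration.integral_norm_bound_integral)
      show "integrable lborel (\<lambda>x. f x * chr (x \<bullet> z) - f x * chr (x \<bullet> y)
          - f x * - (2 * of_real pi * \<i> * of_real (x \<bullet> ?h)) * chr (x \<bullet> y))"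
        by (intro Bochner_Integration.integrable_diff integrable_fourier assms int)
      show "integrable lborel (\<lambda>x. norm (f x) * (2 * pi * R)\<^sup>2 * (norm ?h)\<^sup>2)"
        using integrable_test[OF assms] by (intro integrable_mult_left integrable_norm)
      fix x
      have "f x * chr (x \<bullet> z) - f x * chr (x \<bullet> y)
          - f x * - (2 * of_real pi * \<i> * of_real (x \<bullet> ?h)) * chr (x \<bullet> y)
        = f x * chr (x \<bullet> y) * (chr (x \<bullet> ?h) - 1 + 2 * of_real pi * \<i> * of_real (x \<bullet> ?h))"
        using chr_add[of "x \<bullet> y" "x \<bullet> ?h"] by (simp add: inner_diff_right algebra_simps)
      also have "norm \<dots> = norm (f x) * norm (chr (x \<bullet> ?h) - 1 + 2 * of_real pi * \<i> * of_real (x \<bullet> ?h))"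
        by (simp add: norm_mult)
      also have "\<dots> \<le> norm (f x) * (2 * pi * R * norm ?h)\<^sup>2"
      proof (cases "norm x > R")
        case False
        then have "\<bar>x \<bullet> ?h\<bar> \<le> R * norm ?h"
          by (intro order_trans[OF Cauchy_Schwarz_ineq2] mult_right_mono) auto
        then have "(2 * pi * \<bar>x \<bullet> ?h\<bar>)\<^sup>2 \<le> (2 * pi * (R * norm ?h))\<^sup>2"
          by (intro power_mono mult_left_mono) auto
        then show ?thesis
          using norm_chr_taylor1[of "x \<bullet> ?h"] by (intro mult_left_mono) (auto simp: mult.assoc)
      qed (use R in auto)
      finally show "norm (f x * chr (x \<bullet> z) - f x * chr (x \<bullet> y)
          - f x * - (2 * of_real pi * \<i> * of_real (x \<bullet> ?h)) * chr (x \<bullet> y))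
         \<le> norm (f x) * (2 * pi * R)\<^sup>2 * (norm ?h)\<^sup>2"
        by (simp add: power_mult_distrib mult_ac)
    qed
    also have "\<dots> = C * (norm ?h)\<^sup>2" by (simp add: C_def)
    finally show ?thesis .
  qed
  show ?thesis
  proof (rule has_derivativeI_sandwich[where e=1 and H="\<lambda>z. C * norm (z - y)"])
    show "norm (fourier f z - fourier f y - ?D (z - y)) / norm (z - y) \<le> C * norm (z - y)"
      if "z \<noteq> y" for z
      using est[of z] that by (simp add: divide_le_eq power2_eq_square mult.assoc)
    have "((\<lambda>z. C * norm (z - y)) \<longlongrightarrow> C * norm (y - y)) (at y)"
      by (intro tendsto_intros)
    then show "((\<lambda>z. C * norm (z - y)) \<longlongrightarrow> 0) (at y)" by simp
  qed (use bl in auto)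
qed

lemma iter_deriv_fourier:
  assumes "f \<in> test_functions" "bs \<in> lists Basis"
  shows "\<exists>g\<in>test_functions. iter_deriv bs (fourier f) = fourier g"
  using assms(2)
proof (induction bs)
  case Nil
  then show ?case using assms(1) by auto
next
  case (Cons b bs)
  then obtain g where g: "g \<in> test_functions" "iter_deriv bs (fourier f) = fourier g" by auto
  have "iter_deriv (b # bs) (fourier f) = fourier (\<lambda>x. g x * - (2 * of_real pi * \<i> * of_real (x \<bullet> b)))"
    by (simp add: g frechet_derivative_at[OF fourier_has_derivative[OF g(1)], symmetric])
  then show ?case
    using test_functions_mult(1)[OF g(1) smooth_fun_linear_factor[of b]] by blast
qed

text \<open>The derivative is a limit of difference quotients of f. A translate of f transforms into
  a twist by a character, so the integral of the quotient equals \<open>fourier f y\<close> times a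
  difference quotient of that character, and both limits can be computed.\<close>

lemma fourier_partial:
  fixes f :: "'a::euclidean_space \<Rightarrow> complex"
  assumes f: "f \<in> test_functions" and b: "b \<in> Basis"
  shows "fourier (\<lambda>x. frechet_derivative f (at x) b) y = 2 * of_real pi * \<i> * of_real (y \<bullet> b) * fourier f y"
proof -
  obtain R where R: "R > 0" "\<And>x. norm x > R \<Longrightarrow> f x = 0" using test_functions_supportE f by blast
  obtain L where L: "L > 0" "\<And>x y. norm (f x - f y) \<le> L * norm (x - y)" using test_functions_lipschitz[OF f] by blast
  have nb: "norm b = 1" using b by simp
  define h where "h n = inverse (real (Suc n))" for n
  have h: "h \<longlonglongrightarrow> 0" "\<And>n. h n > 0" "\<And>n. h n \<le> 1"
    unfolding h_def by (rule LIMSEQ_inverse_real_of_nat) (auto simp: field_simps)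
  have hfilter: "filterlim h (at 0) sequentially"
    using h by (simp add: filterlim_at less_imp_neq[symmetric])
  define s where "s n x = (f (x + h n *\<^sub>R b) - f x) / of_real (h n) * chr (x \<bullet> y)" for n x
  have shift: "(\<lambda>x. f (x - (- h n *\<^sub>R b))) \<in> test_functions" for n
    using test_functions_affine[OF f, of 1 "h n *\<^sub>R b"] by simp
  have sint: "integral\<^sup>L lborel (s n) = (chr (- h n * (y \<bullet> b)) - 1) / of_real (h n) * fourier f y" for n
  proof -
    have "s n = (\<lambda>x. (f (x - (- h n *\<^sub>R b)) * chr (x \<bullet> y) - f x * chr (x \<bullet> y)) / of_real (h n))"
      by (auto simp: s_def fun_eq_iff diff_divide_distrib left_diff_distrib)
    then have "integral\<^sup>L lborel (s n) = (fourier (\<lambda>x. f (x - (- h n *\<^sub>R b))) y - fourier f y) / of_real (h n)"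
      using integrable_fourier[OF shift[of n], of y] integrable_fourier[OF f, of y]
      by (simp add: fourier_eq)
    also have "\<dots> = (chr (- h n * (y \<bullet> b)) - 1) / of_real (h n) * fourier f y"
      by (subst fourier_translate[OF f]) (simp add: inner_commute field_simps)
    finally show ?thesis .
  qed
  have "(\<lambda>n. integral\<^sup>L lborel (s n)) \<longlonglongrightarrow> fourier (\<lambda>x. frechet_derivative f (at x) b) y"
    unfolding fourier_eq
  \<comment> \<open>The majorant is uniform in n because \<open>h n \<le> 1\<close>: the quotient is
    bounded by the Lipschitz constant and vanishes outside the ball of radius R + 1.\<close>
  proof (rule integral_dominated_convergence[where w="\<lambda>x. L * indicator (cball 0 (R + 1)) x"])
    have "iter_deriv [b] f \<in> test_functions" using b by (intro test_functions_iter_deriv f) auto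
    then have "(\<lambda>x. frechet_derivative f (at x) b) \<in> test_functions" by simp
    from borel_measurable_integrable[OF integrable_fourier[OF this]]
    show "(\<lambda>x. frechet_derivative f (at x) b * chr (x \<bullet> y)) \<in> borel_measurable lborel" .
    show "s n \<in> borel_measurable lborel" for n
    proof -
      have [measurable]: "f \<in> borel_measurable borel"
        using integrable_test[OF f] borel_measurable_integrable by force
      show ?thesis unfolding s_def by measurable
    qed
    show "integrable lborel (\<lambda>x::'a. L * indicator (cball 0 (R + 1)) x)"
      using emeasure_lborel_cball_finite[of "0::'a" "R + 1"] by (intro integrable_mult_right) (simp add: integrable_indicator_iff)
    show "AE x in lborel. (\<lambda>n. s n x) \<longlonglongrightarrow> frechet_derivative f (at x) b * chr (x \<bullet> y)"
    proof (intro AE_I2)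
      fix x
      have "f differentiable (at x)" using f smooth_fun_differentiable test_functions_smooth by blast
      then have D: "(f has_derivative frechet_derivative f (at x)) (at x)"
        using frechet_derivative_works by blast
      have "((\<lambda>t::real. x + t *\<^sub>R b) has_vector_derivative b) (at 0)"
        by (auto intro!: derivative_eq_intros)
      then have "((\<lambda>t::real. f (x + t *\<^sub>R b)) has_vector_derivative frechet_derivative f (at x) b) (at 0)"
        using D vector_derivative_diff_chain_within[of "\<lambda>t. x + t *\<^sub>R b" b 0 UNIV f "frechet_derivative f (at x)"]
        by (simp add: o_def has_derivative_at_withinI)
      then have "((\<lambda>t::real. norm (f (x + t *\<^sub>R b) - f x - t *\<^sub>R frechet_derivative f (at x) b) / norm t) \<longlongrightarrow> 0) (at 0)"
        by (simp add: has_vector_derivative_def has_derivative_at)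
      moreover have "norm (f (x + t *\<^sub>R b) - f x - t *\<^sub>R frechet_derivative f (at x) b) / norm t =
          norm ((f (x + t *\<^sub>R b) - f x) /\<^sub>R t - frechet_derivative f (at x) b)" if "t \<noteq> 0" for t
      proof -
        have "f (x + t *\<^sub>R b) - f x - t *\<^sub>R frechet_derivative f (at x) b =
           t *\<^sub>R ((f (x + t *\<^sub>R b) - f x) /\<^sub>R t - frechet_derivative f (at x) b)"
          using that by (simp add: scaleR_diff_right)
        then show ?thesis using that by simp
      qed
      ultimately have "((\<lambda>t::real. norm ((f (x + t *\<^sub>R b) - f x) /\<^sub>R t - frechet_derivative f (at x) b)) \<longlongrightarrow> 0) (at 0)"
        by (auto elim: Lim_transform_within[where d=1])
      then have "((\<lambda>t. (f (x + t *\<^sub>R b) - f x) /\<^sub>R t) \<longlongrightarrow> frechet_derivative f (at x) b) (at 0)"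
        by (simp add: tendsto_norm_zero_iff LIM_zero_iff)
      from filterlim_compose[OF this hfilter]
      have "(\<lambda>n. (f (x + h n *\<^sub>R b) - f x) /\<^sub>R h n) \<longlonglongrightarrow> frechet_derivative f (at x) b" .
      then have "(\<lambda>n. (f (x + h n *\<^sub>R b) - f x) /\<^sub>R h n * chr (x \<bullet> y)) \<longlonglongrightarrow> frechet_derivative f (at x) b * chr (x \<bullet> y)"
        by (intro tendsto_intros)
      then show "(\<lambda>n. s n x) \<longlonglongrightarrow> frechet_derivative f (at x) b * chr (x \<bullet> y)"
        by (simp add: s_def scaleR_conv_of_real divide_inverse mult_ac)
    qed
    fix n
    show "AE x in lborel. norm (s n x) \<le> L * indicator (cball 0 (R + 1)) x"
    proof (intro AE_I2)
      fix x :: 'a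
      show "norm (s n x) \<le> L * indicator (cball 0 (R + 1)) x"
      proof (cases "norm x \<le> R + 1")
        case True
        have "norm (f (x + h n *\<^sub>R b) - f x) \<le> L * h n"
          using L(2)[of "x + h n *\<^sub>R b" x] h(2)[of n] nb by simp
        then have "norm (s n x) \<le> L" using h(2)[of n]
          by (simp add: s_def norm_mult norm_divide divide_le_eq)
        then show ?thesis using True by simp
      next
        case False
        have "norm x \<le> norm (x + h n *\<^sub>R b) + norm (h n *\<^sub>R b)"
          by (metis add_diff_cancel norm_triangle_ineq4)
        then have "norm (x + h n *\<^sub>R b) > R" using False h(2,3)[of n] nb by simp
        then have "f (x + h n *\<^sub>R b) = 0" "f x = 0" using False R by auto
        then show ?thesis using L(1) by (simp add: s_def)
      qed
    qed
  qed
  moreover have "(\<lambda>n. integral\<^sup>L lborel (s n)) \<longlonglongrightarrow> 2 * of_real pi * \<i> * of_real (y \<bullet> b) * fourier f y"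
    unfolding sint
  proof (intro tendsto_mult tendsto_const)
    define D where "D = 2 * of_real pi * \<i> * complex_of_real (y \<bullet> b)"
    have "(\<lambda>n. (chr (- h n * (y \<bullet> b)) - 1) / of_real (h n) - D) \<longlonglongrightarrow> 0"
    proof (rule Lim_null_comparison)
      have "norm ((chr (- h n * (y \<bullet> b)) - 1) / of_real (h n) - D) \<le> (2 * pi * \<bar>y \<bullet> b\<bar>)\<^sup>2 * h n" for n
      proof -
        have "(chr (- h n * (y \<bullet> b)) - 1) / of_real (h n) - D =
           (chr (- h n * (y \<bullet> b)) - 1 + 2 * of_real pi * \<i> * of_real (- h n * (y \<bullet> b))) / of_real (h n)"
          using h(2)[of n] by (simp add: D_def field_simps)
        also have "norm \<dots> \<le> (2 * pi * \<bar>- h n * (y \<bullet> b)\<bar>)\<^sup>2 / h n"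
          using h(2)[of n] norm_chr_taylor1[of "- h n * (y \<bullet> b)"]
          by (simp add: norm_divide divide_right_mono)
        also have "\<dots> = (2 * pi * \<bar>y \<bullet> b\<bar>)\<^sup>2 * h n"
          using h(2)[of n] by (simp add: power2_eq_square abs_mult)
        finally show ?thesis .
      qed
      then show "\<forall>\<^sub>F n in sequentially. norm ((chr (- h n * (y \<bullet> b)) - 1) / of_real (h n) - D) \<le> (2 * pi * \<bar>y \<bullet> b\<bar>)\<^sup>2 * h n"
        by simp
      show "(\<lambda>n. (2 * pi * \<bar>y \<bullet> b\<bar>)\<^sup>2 * h n) \<longlonglongrightarrow> 0"
        using tendsto_mult_right_zero[OF h(1)] by simp
    qed
    then show "(\<lambda>n. (chr (- h n * (y \<bullet> b)) - 1) / of_real (h n)) \<longlonglongrightarrow> 2 * of_real pi * \<i> * complex_of_real (y \<bullet> b)"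
      unfolding D_def by (simp add: LIM_zero_iff)
  qed
  ultimately show ?thesis by (rule LIMSEQ_unique)
qed

text \<open>\<open>1 + norm y\<close> is at most 1 plus the sum of the absolute coordinates, and
  multiplying the transform by a coordinate gives, up to the factor 2 pi > 1, the transform of a
  partial derivative. Each power of decay thus costs one differentiation.\<close>

lemma fourier_decay:
  fixes f :: "'a::euclidean_space \<Rightarrow> complex"
  assumes "f \<in> test_functions"
  shows "\<exists>C. \<forall>y. (1 + norm y) ^ n * norm (fourier f y) \<le> C"
  using assms
proof (induction n arbitrary: f)
  case 0
  then show ?case using norm_fourier_le by fastforce
next
  case (Suc n)
  obtain C where C: "\<And>y. (1 + norm y) ^ n * norm (fourier f y) \<le> C" using Suc by blast
  have "\<exists>C. \<forall>y. (1 + norm y) ^ n * norm (fourier (\<lambda>x. frechet_derivative f (at x) b) y) \<le> C" if "b \<in> Basis" for b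
  proof -
    have "iter_deriv [b] f \<in> test_functions" using that by (intro test_functions_iter_deriv Suc) auto
    then show ?thesis using Suc.IH[of "\<lambda>x. frechet_derivative f (at x) b"] by simp
  qed
  then obtain D where D: "\<And>b y. b \<in> Basis \<Longrightarrow>
      (1 + norm y) ^ n * norm (fourier (\<lambda>x. frechet_derivative f (at x) b) y) \<le> D b" by metis
  have "(1 + norm y) ^ Suc n * norm (fourier f y) \<le> C + (\<Sum>b\<in>Basis. D b)" for y :: 'a
  proof -
    have "(1 + norm y) ^ Suc n * norm (fourier f y) = (1 + norm y) * ((1 + norm y) ^ n * norm (fourier f y))"
      by simp
    also have "\<dots> \<le> (1 + (\<Sum>b\<in>Basis. \<bar>y \<bullet> b\<bar>)) * ((1 + norm y) ^ n * norm (fourier f y))"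
      using norm_le_l1[of y] by (intro mult_right_mono) auto
    also have "\<dots> = (1 + norm y) ^ n * norm (fourier f y) +
        (\<Sum>b\<in>Basis. (1 + norm y) ^ n * (\<bar>y \<bullet> b\<bar> * norm (fourier f y)))"
      by (simp add: algebra_simps sum_distrib_left)
    also have "\<dots> \<le> C + (\<Sum>b\<in>Basis. D b)"
    proof (intro add_mono sum_mono C)
      fix b :: 'a assume b: "b \<in> Basis"
      have "\<bar>y \<bullet> b\<bar> * norm (fourier f y) \<le> 2 * pi * (\<bar>y \<bullet> b\<bar> * norm (fourier f y))"
        using pi_ge_two mult_right_mono[of 1 "2 * pi" "\<bar>y \<bullet> b\<bar> * norm (fourier f y)"] by simp
      also have "\<dots> = norm (fourier (\<lambda>x. frechet_derivative f (at x) b) y)"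
        using fourier_partial[OF Suc.prems b, of y] by (simp add: norm_mult)
      finally have "(1 + norm y) ^ n * (\<bar>y \<bullet> b\<bar> * norm (fourier f y)) \<le>
         (1 + norm y) ^ n * norm (fourier (\<lambda>x. frechet_derivative f (at x) b) y)"
        by (intro mult_left_mono) auto
      then show "(1 + norm y) ^ n * (\<bar>y \<bullet> b\<bar> * norm (fourier f y)) \<le> D b"
        using D[OF b, of y] by linarith
    qed
    finally show ?thesis .
  qed
  then show ?case by blast
qed

lemma fourier_test_schwartz:
  assumes "f \<in> test_functions"
  shows "fourier f \<in> schwartz"
proof -
  have "smooth_fun (fourier f)"
    unfolding smooth_fun_def
  proof (intro ballI allI)
    fix bs :: "'a list" and x assume "bs \<in> lists Basis"
    then obtain g where "g \<in> test_functions" "iter_deriv bs (fourier f) = fourier g"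
      using iter_deriv_fourier[OF assms] by blast
    then show "iter_deriv bs (fourier f) differentiable at x"
      using differentiableI[OF fourier_has_derivative] by simp
  qed
  moreover have "bounded (range (\<lambda>x. (1 + norm x) ^ n *\<^sub>R iter_deriv bs (fourier f) x))"
    if bs: "bs \<in> lists Basis" for n bs
  proof -
    obtain g where g: "g \<in> test_functions" "iter_deriv bs (fourier f) = fourier g"
      using iter_deriv_fourier[OF assms bs] by blast
    obtain C where "\<And>y. (1 + norm y) ^ n * norm (fourier g y) \<le> C" using fourier_decay[OF g(1)] by blast
    then have "\<And>y. norm ((1 + norm y) ^ n *\<^sub>R fourier g y) \<le> C" by simp
    then show ?thesis unfolding bounded_iff g(2) by auto
  qed
  ultimately show ?thesis by (simp add: schwartz_def)
qed

text \<open>The constant makes \<open>2 * pi * \<bar>x \<bullet> y\<bar>\<close> at most 1/2 on the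
  ball of radius r, so the character is within 1/2 of 1 there. The transform then lies within half
  of the integral of the bump, which is positive.\<close>

lemma fourier_bump_nonzero:
  fixes y :: "'a::euclidean_space"
  assumes r: "r > 0" "r * norm y \<le> 1 / (4 * pi)"
  shows "fourier (\<lambda>x. complex_of_real (bump r x)) y \<noteq> 0"
proof -
  let ?f = "\<lambda>x::'a. complex_of_real (bump r x)"
  note tf = test_functions_bump[OF r(1), where 'a='a]
  have int: "integrable lborel (\<lambda>x::'a. bump r x)"
    using integrable_Re[OF integrable_test[OF tf]] by simp
  have "(LINT x|lborel. bump r (x::'a)) \<noteq> 0"
  proof
    assume "(LINT x|lborel. bump r (x::'a)) = 0"
    then have "AE x::'a in lborel. bump r x = 0"
      using integral_nonneg_eq_0_iff_AE[OF int] bump_nonneg by auto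
    then have "AE x in lborel. x \<notin> ball (0::'a) r"
      by eventually_elim (use bump_pos_iff[OF r(1)] in force)
    then have "emeasure lborel (ball (0::'a) r) = 0"
      by (subst (asm) AE_iff_measurable[of "ball (0::'a) r"]) auto
    then show False
      using content_ball_pos[OF r(1), of "0::'a"] by (simp add: measure_def)
  qed
  then have pos: "(LINT x|lborel. bump r (x::'a)) > 0"
    using Bochner_Integration.integral_nonneg[of lborel "\<lambda>x::'a. bump r x"] bump_nonneg by (auto simp: less_eq_real_def)
  have "norm (fourier ?f y - of_real (LINT x|lborel. bump r (x::'a))) =
     norm (LINT x|lborel. ?f x * chr (x \<bullet> y) - ?f x)"
    unfolding fourier_eq using integrable_fourier[OF tf, of y] integrable_test[OF tf]
    by (simp add: Bochner_Integration.integral_diff)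
  also have "\<dots> \<le> (LINT x|lborel. bump r (x::'a) * (1 / 2))"
  proof (rule Bochner_Integration.integral_norm_bound_integral)
    show "integrable lborel (\<lambda>x. ?f x * chr (x \<bullet> y) - ?f x)"
      by (intro Bochner_Integration.integrable_diff integrable_fourier integrable_test tf)
    show "integrable lborel (\<lambda>x::'a. bump r x * (1 / 2))" using int by simp
    fix x :: 'a
    have "?f x * chr (x \<bullet> y) - ?f x = ?f x * (chr (x \<bullet> y) - 1)" by (simp add: algebra_simps)
    then have "norm (?f x * chr (x \<bullet> y) - ?f x) = bump r x * norm (chr (x \<bullet> y) - 1)"
      using bump_nonneg[of r x] by (simp add: norm_mult)
    also have "\<dots> \<le> bump r x * (1 / 2)"
    proof (cases "norm x < r")
      case True
      then have "\<bar>x \<bullet> y\<bar> \<le> r * norm y"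
        by (intro order_trans[OF Cauchy_Schwarz_ineq2] mult_right_mono) auto
      then have "2 * pi * \<bar>x \<bullet> y\<bar> \<le> 2 * pi * (1 / (4 * pi))"
        using r by (intro mult_left_mono) auto
      then show ?thesis using norm_chr_taylor0[of "x \<bullet> y"] bump_nonneg[of r x]
        by (intro mult_left_mono) auto
    qed (simp add: bump_eq_0[OF r(1), of x])
    finally show "norm (?f x * chr (x \<bullet> y) - ?f x) \<le> bump r x * (1 / 2)" .
  qed
  also have "\<dots> = (LINT x|lborel. bump r (x::'a)) / 2" by simp
  finally show ?thesis using pos by auto
qed

section \<open>Cutoffs and temperate distributions\<close>

text \<open>A rescaled bump without plateau: it equals 1 only at the origin and tends to 1 at a rate
  given by the Lipschitz constant of \<open>cutoff 0\<close>. The use of \<open>Suc k\<close> keeps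
  the scale positive.\<close>

definition cutoff :: "nat \<Rightarrow> 'a::euclidean_space \<Rightarrow> complex" where
  "cutoff k x = of_real (bump 1 (inverse (real (Suc k)) *\<^sub>R x) / bump 1 (0::'a))"

lemma bump_1_0_pos: "bump 1 (0::'a::euclidean_space) > 0"
  by (simp add: bump_pos_iff)

lemma cutoff_0_test: "(cutoff 0 :: 'a::euclidean_space \<Rightarrow> complex) \<in> test_functions"
proof -
  have "(\<lambda>x::'a. complex_of_real (bump 1 x) * (1 / of_real (bump 1 (0::'a)))) \<in> test_functions"
    by (intro test_functions_mult test_functions_bump smooth_fun_const) simp
  then show ?thesis by (simp add: cutoff_def[abs_def])
qed

lemma cutoff_scale: "cutoff k x = cutoff 0 (inverse (real (Suc k)) *\<^sub>R x)"
  by (simp add: cutoff_def)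

lemma cutoff_test: "cutoff k \<in> test_functions"
  using test_functions_affine[OF cutoff_0_test, of "inverse (real (Suc k))" 0]
  by (simp add: cutoff_scale[symmetric] del: of_nat_Suc)

lemma smooth_cutoff: "smooth_fun (cutoff k)"
  using cutoff_test test_functions_smooth by blast

lemma cutoff_nonneg: "Re (cutoff k x) \<ge> 0"
  by (simp add: cutoff_def bump_nonneg)

lemma cutoff_eq_0: "norm x \<ge> real (Suc k) \<Longrightarrow> cutoff k x = 0"
  by (simp add: cutoff_def bump_eq_0 field_simps)

lemma norm_cutoff_le: "norm (cutoff k x) \<le> 1"
  using bump_antimono[of 0 "inverse (real (Suc k)) *\<^sub>R x" 1] bump_1_0_pos[where 'a='a]
  by (simp add: cutoff_def norm_divide bump_nonneg)

text \<open>The bump decreases with the norm, so its value at norm 1/2 is a lower bound on the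
  half-size ball, uniformly in k. It converts tests against cutoffs into bounds for masses of
  balls.\<close>

lemma cutoff_lower_bound:
  obtains c where "c > 0" "\<And>k (x::'a::euclidean_space). norm x \<le> real (Suc k) / 2 \<Longrightarrow> Re (cutoff k x) \<ge> c"
proof -
  obtain e :: 'a where e: "norm e = 1 / 2" using vector_choose_size[of "1/2"] by auto
  show ?thesis
  proof (rule that[of "bump 1 e / bump 1 (0::'a)"])
    show "bump 1 e / bump 1 (0::'a) > 0"
      using e by (simp add: bump_pos_iff)
    fix k and x :: 'a assume "norm x \<le> real (Suc k) / 2"
    then have "norm (inverse (real (Suc k)) *\<^sub>R x) \<le> norm e" by (simp add: e field_simps)
    from bump_antimono[OF this, of 1]
    show "bump 1 e / bump 1 (0::'a) \<le> Re (cutoff k x)"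
      using bump_1_0_pos[where 'a='a] by (simp add: cutoff_def divide_right_mono)
  qed
qed

lemma cutoff_tendsto_1: "(\<lambda>k. cutoff k (x::'a::euclidean_space)) \<longlonglongrightarrow> 1"
proof -
  have "isCont (cutoff 0) (0::'a)"
    using smooth_fun_continuous[OF smooth_cutoff[of 0], of "UNIV :: 'a set"]
    by (simp add: continuous_on_eq_continuous_at)
  moreover have "(\<lambda>k. inverse (real (Suc k)) *\<^sub>R x) \<longlonglongrightarrow> 0 *\<^sub>R x"
    by (intro tendsto_intros LIMSEQ_inverse_real_of_nat)
  ultimately have "(\<lambda>k. cutoff 0 (inverse (real (Suc k)) *\<^sub>R x)) \<longlonglongrightarrow> cutoff 0 (0::'a)"
    by (intro isCont_tendsto_compose[where g="cutoff 0"]) auto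
  moreover have "cutoff 0 (0::'a) = 1" using bump_1_0_pos[where 'a='a] by (simp add: cutoff_def)
  ultimately show ?thesis by (simp add: cutoff_scale[of _ x, symmetric] del: of_nat_Suc)
qed

lemma iter_deriv_cutoff:
  assumes "bs \<in> lists Basis"
  shows "iter_deriv bs (cutoff k) =
    (\<lambda>x. of_real (inverse (real (Suc k))) ^ length bs * iter_deriv bs (cutoff 0) (inverse (real (Suc k)) *\<^sub>R x))"
  using iter_deriv_affine[OF smooth_cutoff assms, of 0 "inverse (real (Suc k))" 0]
  by (simp add: cutoff_scale[of k, symmetric] del: of_nat_Suc)

lemma iter_deriv_cutoff_bound:
  fixes bs :: "'a::euclidean_space list"
  assumes "bs \<in> lists Basis"
  obtains C where "C > 0" "\<And>k x. norm (iter_deriv bs (cutoff k) x) \<le> C * inverse (real (Suc k)) ^ length bs"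
proof -
  obtain C where C: "C > 0" "\<And>x. norm (iter_deriv bs (cutoff 0) x) \<le> C"
    using test_functions_bound[OF test_functions_iter_deriv[OF cutoff_0_test assms]] by blast
  have "norm (iter_deriv bs (cutoff k) x) \<le> C * inverse (real (Suc k)) ^ length bs" for k x
  proof -
    have "\<bar>inverse (real (Suc k))\<bar> = inverse (real (Suc k))" by (simp only: abs_of_nat abs_inverse)
    then have "norm (iter_deriv bs (cutoff k) x) =
        inverse (real (Suc k)) ^ length bs * norm (iter_deriv bs (cutoff 0) (inverse (real (Suc k)) *\<^sub>R x))"
      by (simp only: iter_deriv_cutoff[OF assms, of k] norm_mult norm_power norm_of_real)
    also have "\<dots> \<le> inverse (real (Suc k)) ^ length bs * C"
      by (intro mult_left_mono C zero_le_power) simp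
    finally show ?thesis by (simp only: mult.commute)
  qed
  with C(1) show ?thesis using that by blast
qed

section \<open>Convergence and growth of distributions on cutoffs\<close>

text \<open>Uniform smallness fails for \<open>cutoff k - 1\<close>, which is -1 far away; the
  weight \<open>1 + norm x\<close> allows for this at the price of one power of decay of a Schwartz
  function. All derivatives are included so that the property passes to partial derivatives and the
  product rule can be iterated.\<close>

definition vanishing_family :: "(nat \<Rightarrow> 'a::euclidean_space \<Rightarrow> complex) \<Rightarrow> bool" where
  "vanishing_family h \<longleftrightarrow> (\<forall>k. smooth_fun (h k)) \<and>
     (\<forall>bs\<in>lists Basis. \<exists>C\<ge>0. \<forall>k x. norm (iter_deriv bs (h k) x) \<le> C / real (Suc k) * (1 + norm x))"

lemma iter_deriv_const: "bs \<noteq> [] \<Longrightarrow> iter_deriv bs (\<lambda>x. c) = (\<lambda>x. 0)"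
proof (induction bs)
  case (Cons b bs)
  then show ?case by (cases "bs = []") auto
qed simp

lemma vanishing_family_cutoff: "vanishing_family (\<lambda>k x::'a::euclidean_space. cutoff k x - 1)"
  unfolding vanishing_family_def
proof (intro conjI allI ballI)
  show "smooth_fun (\<lambda>x::'a. cutoff k x - 1)" for k
    using smooth_fun_add[OF smooth_cutoff smooth_fun_const[of "-1"], of k] by simp
  fix bs :: "'a list" assume bs: "bs \<in> lists Basis"
  show "\<exists>C\<ge>0. \<forall>k x. norm (iter_deriv bs (\<lambda>x. cutoff k x - 1) x) \<le> C / real (Suc k) * (1 + norm x)"
  proof (cases "bs = []")
    case True
    \<comment> \<open>Without differentiation the smallness is the Lipschitz bound of
      \<open>cutoff 0\<close> between x/(k+1) and 0; with differentiation, scaling supplies the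
      factor 1/(k+1).\<close>
    obtain L where L: "L > 0" "\<And>x y::'a. norm (cutoff 0 x - cutoff 0 y) \<le> L * norm (x - y)"
      using test_functions_lipschitz[OF cutoff_0_test] by blast
    have "norm (cutoff k x - 1) \<le> L / real (Suc k) * (1 + norm x)" for k and x :: 'a
    proof -
      have "cutoff 0 (0::'a) = 1" using bump_1_0_pos[where 'a='a] by (simp add: cutoff_def)
      then have "norm (cutoff k x - 1) \<le> L / real (Suc k) * norm x"
        using L(2)[of "inverse (real (Suc k)) *\<^sub>R x" 0]
        by (simp add: cutoff_scale[of k, symmetric] divide_inverse mult.assoc del: of_nat_Suc)
      also have "\<dots> \<le> L / real (Suc k) * (1 + norm x)" using L(1) by (intro mult_left_mono) auto
      finally show ?thesis .
    qed
    then show ?thesis using True L(1) by (auto intro!: exI[of _ L])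
  next
    case False
    obtain C where C: "C > 0" "\<And>k x. norm (iter_deriv bs (cutoff k) x) \<le> C * inverse (real (Suc k)) ^ length bs"
      using iter_deriv_cutoff_bound[OF bs] by blast
    have "norm (iter_deriv bs (\<lambda>x. cutoff k x - 1) x) \<le> C / real (Suc k) * (1 + norm x)" for k and x :: 'a
    proof -
      have "iter_deriv bs (\<lambda>x. cutoff k x - 1) x = iter_deriv bs (cutoff k) x"
        using iter_deriv_add[OF smooth_cutoff smooth_fun_const[of "-1"] bs, of k] iter_deriv_const[OF False, of "-1"]
        by simp
      also have "norm \<dots> \<le> C * inverse (real (Suc k)) ^ length bs" by (rule C)
      also have "inverse (real (Suc k)) ^ length bs \<le> inverse (real (Suc k)) ^ 1"
        using False by (intro power_decreasing) (auto simp: Suc_le_eq field_simps)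
      also have "C * inverse (real (Suc k)) ^ 1 \<le> C / real (Suc k) * (1 + norm x)"
        using C(1) mult_left_mono[of 1 "1 + norm x" "C / real (Suc k)"] by (simp add: divide_inverse)
      finally show ?thesis using C(1) by simp
    qed
    then show ?thesis using C(1) by (auto intro!: exI[of _ C])
  qed
qed

lemma vanishing_family_partial:
  assumes "vanishing_family h" "b \<in> Basis"
  shows "vanishing_family (\<lambda>k x. frechet_derivative (h k) (at x) b)"
  unfolding vanishing_family_def
proof (intro conjI allI ballI)
  show "smooth_fun (\<lambda>x. frechet_derivative (h k) (at x) b)" for k
    using assms by (simp add: vanishing_family_def smooth_fun_partial)
  fix bs :: "'a list" assume "bs \<in> lists Basis"
  then have "bs @ [b] \<in> lists Basis" using assms by simp
  with assms(1) have "\<exists>C\<ge>0. \<forall>k x. norm (iter_deriv (bs @ [b]) (h k) x) \<le> C / real (Suc k) * (1 + norm x)"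
    unfolding vanishing_family_def by blast
  then show "\<exists>C\<ge>0. \<forall>k x. norm (iter_deriv bs (\<lambda>x. frechet_derivative (h k) (at x) b) x) \<le> C / real (Suc k) * (1 + norm x)"
    by (simp add: iter_deriv_append)
qed

lemma schwartz_smooth: "f \<in> schwartz \<Longrightarrow> smooth_fun f"
  by (simp add: schwartz_def)

lemma schwartz_partial:
  assumes "f \<in> schwartz" "b \<in> Basis"
  shows "(\<lambda>x. frechet_derivative f (at x) b) \<in> schwartz"
proof -
  have "bounded (range (\<lambda>x. (1 + norm x) ^ n *\<^sub>R iter_deriv bs (\<lambda>x. frechet_derivative f (at x) b) x))"
    if "bs \<in> lists Basis" for bs n
  proof -
    have "bs @ [b] \<in> lists Basis" using assms that by simp
    with assms(1) have "bounded (range (\<lambda>x. (1 + norm x) ^ n *\<^sub>R iter_deriv (bs @ [b]) f x))"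
      unfolding schwartz_def by blast
    then show ?thesis by (simp add: iter_deriv_append)
  qed
  with assms show ?thesis by (simp add: schwartz_def smooth_fun_partial)
qed

lemma schwartz_decay:
  fixes f :: "'a::euclidean_space \<Rightarrow> complex"
  assumes "f \<in> schwartz"
  obtains C where "C > 0" "\<And>x. (1 + norm x) ^ n * norm (f x) \<le> C"
proof -
  have "bounded (range (\<lambda>x. (1 + norm x) ^ n *\<^sub>R iter_deriv [] f x))"
    using assms unfolding schwartz_def by blast
  then show ?thesis using that unfolding bounded_pos by auto
qed

text \<open>Reverse induction applies the product rule to the innermost derivative. Both resulting
  products again consist of a vanishing family and a Schwartz function, so the estimate reproduces
  itself. In the base case the weight \<open>1 + norm x\<close> uses one of n + 1 powers of
  decay.\<close>

lemma vanishing_family_mult_schwartz: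
  fixes f :: "'a::euclidean_space \<Rightarrow> complex"
  assumes "bs \<in> lists Basis" "vanishing_family h" "f \<in> schwartz"
  shows "\<exists>C. \<forall>k x. (1 + norm x) ^ n * norm (iter_deriv bs (\<lambda>x. h k x * f x) x) \<le> C / real (Suc k)"
  using assms
proof (induction bs arbitrary: h f rule: rev_induct)
  case Nil
  have "\<exists>C\<ge>0. \<forall>k x. norm (iter_deriv [] (h k) x) \<le> C / real (Suc k) * (1 + norm x)"
    using Nil.prems unfolding vanishing_family_def by blast
  then obtain C where C: "C \<ge> 0" "\<And>k x. norm (h k x) \<le> C / real (Suc k) * (1 + norm x)" by auto
  obtain M where M: "M > 0" "\<And>x. (1 + norm x) ^ Suc n * norm (f x) \<le> M"
    using schwartz_decay[OF Nil.prems(3)] by blast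
  have "(1 + norm x) ^ n * norm (h k x * f x) \<le> (C * M) / real (Suc k)" for k x
  proof -
    have "(1 + norm x) ^ n * norm (h k x * f x) \<le> (1 + norm x) ^ n * ((C / real (Suc k) * (1 + norm x)) * norm (f x))"
      unfolding norm_mult by (intro mult_left_mono mult_right_mono C) auto
    also have "\<dots> = C / real (Suc k) * ((1 + norm x) ^ Suc n * norm (f x))" by (simp add: mult_ac)
    also have "\<dots> \<le> C / real (Suc k) * M" using C by (intro mult_left_mono M) auto
    finally show ?thesis by simp
  qed
  then show ?case by auto
next
  case (snoc b bs)
  then have b: "b \<in> Basis" and bs: "bs \<in> lists Basis" by auto
  have sh: "smooth_fun (h k)" for k using snoc.prems by (simp add: vanishing_family_def)
  have sf: "smooth_fun f" using snoc.prems schwartz_smooth by blast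
  obtain C where C: "\<And>k x. (1 + norm x) ^ n * norm (iter_deriv bs (\<lambda>x. frechet_derivative (h k) (at x) b * f x) x) \<le> C / real (Suc k)"
    using snoc.IH[OF bs vanishing_family_partial[OF snoc.prems(2) b] snoc.prems(3)] by blast
  obtain D where D: "\<And>k x. (1 + norm x) ^ n * norm (iter_deriv bs (\<lambda>x. h k x * frechet_derivative f (at x) b) x) \<le> D / real (Suc k)"
    using snoc.IH[OF bs snoc.prems(2) schwartz_partial[OF snoc.prems(3) b]] by blast
  have "(1 + norm x) ^ n * norm (iter_deriv (bs @ [b]) (\<lambda>x. h k x * f x) x) \<le> (C + D) / real (Suc k)" for k x
  proof -
    have "iter_deriv (bs @ [b]) (\<lambda>x. h k x * f x) =
        iter_deriv bs (\<lambda>x. frechet_derivative (h k) (at x) b * f x + h k x * frechet_derivative f (at x) b)"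
      by (simp add: iter_deriv_append partial_mult smooth_fun_differentiable sh sf)
    also have "\<dots> = (\<lambda>x. iter_deriv bs (\<lambda>x. frechet_derivative (h k) (at x) b * f x) x +
        iter_deriv bs (\<lambda>x. h k x * frechet_derivative f (at x) b) x)"
      by (intro iter_deriv_add smooth_fun_mult smooth_fun_partial sh sf b bs)
    finally have "norm (iter_deriv (bs @ [b]) (\<lambda>x. h k x * f x) x) \<le>
        norm (iter_deriv bs (\<lambda>x. frechet_derivative (h k) (at x) b * f x) x) +
        norm (iter_deriv bs (\<lambda>x. h k x * frechet_derivative f (at x) b) x)"
      by (simp add: norm_triangle_ineq)
    then have "(1 + norm x) ^ n * norm (iter_deriv (bs @ [b]) (\<lambda>x. h k x * f x) x) \<le>
        (1 + norm x) ^ n * (norm (iter_deriv bs (\<lambda>x. frechet_derivative (h k) (at x) b * f x) x) +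
        norm (iter_deriv bs (\<lambda>x. h k x * frechet_derivative f (at x) b) x))"
      by (intro mult_left_mono) auto
    also have "\<dots> \<le> C / real (Suc k) + D / real (Suc k)"
      unfolding distrib_left by (intro add_mono C D)
    finally show ?thesis by (simp add: add_divide_distrib)
  qed
  then show ?case by blast
qed

lemma finite_multi_indices: "finite {bs \<in> lists (Basis :: 'a::euclidean_space set). length bs \<le> n}"
proof -
  have "{bs \<in> lists (Basis :: 'a set). length bs \<le> n} = {bs. set bs \<subseteq> Basis \<and> length bs \<le> n}" by auto
  then show ?thesis using finite_lists_length_le[of "Basis :: 'a set" n] by simp
qed

lemma schwartz_norm_le:
  assumes "\<And>bs x. bs \<in> lists Basis \<Longrightarrow> length bs \<le> n \<Longrightarrow> (1 + norm x) ^ n * norm (iter_deriv bs f x) \<le> M"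
  shows "schwartz_norm n f \<le> M"
  unfolding schwartz_norm_def
proof (rule cSUP_least)
  have "[] \<in> {bs \<in> lists (Basis :: 'a set). length bs \<le> n}" by simp
  then show "UNIV \<times> {bs \<in> lists (Basis :: 'a set). length bs \<le> n} \<noteq> {}" by blast
qed (use assms in auto)

text \<open>A measure prescribes its distribution on test functions, while a transform
  \<open>fourier \<psi>\<close> is in general only Schwartz; this bridges the gap. The error is
  \<open>(cutoff k - 1) * f\<close>, and the finitely many derivatives entering
  \<open>schwartz_norm n\<close> are O(1/(k+1)) with their weights.\<close>

lemma temperate_cutoff_tendsto:
  assumes T: "temperate T" and f: "f \<in> schwartz"
  shows "(\<lambda>k. T (\<lambda>x. cutoff k x * f x)) \<longlonglongrightarrow> T f"
proof (rule tendstoI)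
  fix e :: real assume "e > 0"
  then obtain n d where d: "d > 0" "\<And>g. g \<in> schwartz \<Longrightarrow> schwartz_norm n (\<lambda>x. g x - f x) < d \<Longrightarrow> dist (T g) (T f) < e"
    using T f unfolding temperate_def by meson
  obtain C where C: "\<And>bs k x. bs \<in> lists Basis \<Longrightarrow>
      (1 + norm x) ^ n * norm (iter_deriv bs (\<lambda>x. (cutoff k x - 1) * f x) x) \<le> C bs / real (Suc k)"
    using vanishing_family_mult_schwartz[OF _ vanishing_family_cutoff f, of _ n] by metis
  define M where "M = (\<Sum>bs\<in>{bs \<in> lists Basis. length bs \<le> n}. \<bar>C bs\<bar>)"
  have "schwartz_norm n (\<lambda>x. cutoff k x * f x - f x) \<le> M / real (Suc k)" for k
  proof (rule schwartz_norm_le)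
    fix bs :: "'a list" and x
    assume bs: "bs \<in> lists Basis" "length bs \<le> n"
    have "(\<lambda>x. cutoff k x * f x - f x) = (\<lambda>x. (cutoff k x - 1) * f x)" by (simp add: algebra_simps)
    then have "(1 + norm x) ^ n * norm (iter_deriv bs (\<lambda>x. cutoff k x * f x - f x) x) \<le> C bs / real (Suc k)"
      using C[OF bs(1)] by simp
    also have "C bs \<le> M"
      using member_le_sum[of bs "{bs \<in> lists Basis. length bs \<le> n}" "\<lambda>bs. \<bar>C bs\<bar>"] bs finite_multi_indices[of n]
      by (auto simp: M_def intro: order_trans[OF abs_ge_self])
    then have "C bs / real (Suc k) \<le> M / real (Suc k)" by (intro divide_right_mono) auto
    finally show "(1 + norm x) ^ n * norm (iter_deriv bs (\<lambda>x. cutoff k x * f x - f x) x) \<le> M / real (Suc k)" .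
  qed
  moreover have "\<forall>\<^sub>F k in sequentially. M / real (Suc k) < d"
  proof (rule order_tendstoD(2)[OF _ d(1)])
    show "(\<lambda>k. M / real (Suc k)) \<longlonglongrightarrow> 0"
      using tendsto_mult_right_zero[OF LIMSEQ_inverse_real_of_nat] by (simp add: divide_inverse)
  qed
  ultimately have "\<forall>\<^sub>F k in sequentially. schwartz_norm n (\<lambda>x. cutoff k x * f x - f x) < d"
    by (auto elim!: eventually_mono intro: le_less_trans)
  moreover have "(\<lambda>x. cutoff k x * f x) \<in> schwartz" for k
    using test_functions_mult(1)[OF cutoff_test schwartz_smooth[OF f]] test_functions_subset_schwartz by blast
  ultimately show "\<forall>\<^sub>F k in sequentially. dist (T (\<lambda>x. cutoff k x * f x)) (T f) < e"
    by (auto elim!: eventually_mono intro: d(2))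
qed

text \<open>Continuity at 0 and homogeneity turn into a polynomial bound, because
  \<open>schwartz_norm n\<close> of a cutoff grows at most like the n-th power of the size of its
  support.\<close>

lemma temperate_cutoff_growth:
  fixes T :: "('a::euclidean_space \<Rightarrow> complex) \<Rightarrow> complex"
  assumes T: "temperate T"
  obtains C n where "C > 0" "\<And>k. norm (T (cutoff k)) \<le> C * real (Suc k) ^ n"
proof -
  have sc: "cutoff k \<in> (schwartz :: ('a \<Rightarrow> complex) set)" for k
    using cutoff_test test_functions_subset_schwartz by blast
  have hom: "T (\<lambda>x. c * f x) = c * T f" if "f \<in> schwartz" for f c
    using T that unfolding temperate_def by blast
  have z: "(\<lambda>x. 0) \<in> (schwartz :: ('a \<Rightarrow> complex) set)"
    using test_functions_mult(1)[OF cutoff_test[where 'a='a] smooth_fun_const[of 0]] test_functions_subset_schwartz by auto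
  have T0: "T (\<lambda>x. 0) = 0" using hom[OF z, of 0] by simp
  obtain n d where d: "d > 0" "\<And>g. g \<in> schwartz \<Longrightarrow> schwartz_norm n (\<lambda>x. g x - 0) < d \<Longrightarrow> dist (T g) (T (\<lambda>x. 0)) < 1"
    using T z zero_less_one unfolding temperate_def by meson
  have "\<exists>C>0. \<forall>k x. norm (iter_deriv bs (cutoff k) x) \<le> C" if bs: "bs \<in> lists Basis" for bs :: "'a list"
  proof -
    obtain C where C: "C > 0" "\<And>k x. norm (iter_deriv bs (cutoff k) x) \<le> C * inverse (real (Suc k)) ^ length bs"
      using iter_deriv_cutoff_bound[OF bs] by blast
    have "norm (iter_deriv bs (cutoff k) x) \<le> C" for k x
    proof -
      have "inverse (real (Suc k)) ^ length bs \<le> 1" by (intro power_le_one) (auto simp: field_simps)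
      then have "C * inverse (real (Suc k)) ^ length bs \<le> C * 1" using C(1) by (intro mult_left_mono) auto
      then show ?thesis using C(2)[of k x] by linarith
    qed
    with C(1) show ?thesis by blast
  qed
  then obtain C where C: "\<And>bs. bs \<in> lists Basis \<Longrightarrow> C bs > 0"
      "\<And>bs k (x::'a). bs \<in> lists Basis \<Longrightarrow> norm (iter_deriv bs (cutoff k) x) \<le> C bs" by metis
  define M where "M = 1 + (\<Sum>bs\<in>{bs \<in> lists (Basis::'a set). length bs \<le> n}. C bs)"
  have CM: "C bs \<le> M" if "bs \<in> lists Basis" "length bs \<le> n" for bs
    using member_le_sum[of bs "{bs \<in> lists (Basis::'a set). length bs \<le> n}" C] that finite_multi_indices C(1)
    by (force simp: M_def intro: less_imp_le)
  have M: "M > 0" unfolding M_def by (intro add_pos_nonneg sum_nonneg) (auto intro: less_imp_le C(1))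
  have "norm (T (cutoff k)) \<le> (2 * M * 2 ^ n / d) * real (Suc k) ^ n" for k
  proof -
    \<comment> \<open>Scaled to bring the norm down to d/2, strictly inside the range of continuity:
      M bounds all derivatives up to order n, and the weight is at most
      \<open>(1 + real (Suc k)) ^ n\<close> on the support.\<close>
    define c where "c = d / (2 * M * (1 + real (Suc k)) ^ n)"
    have c: "c > 0" using d M by (simp add: c_def)
    have "schwartz_norm n (\<lambda>x::'a. of_real c * cutoff k x - 0) \<le> d / 2"
    proof (rule schwartz_norm_le)
      fix bs :: "'a list" and x :: 'a
      assume bs: "bs \<in> lists Basis" "length bs \<le> n"
      have *: "(1 + norm x) ^ n * norm (iter_deriv bs (cutoff k) x) \<le> (1 + real (Suc k)) ^ n * M"
      proof (cases "norm x \<le> real (Suc k)")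
        case True
        then show ?thesis using C(2)[OF bs(1), of k x] CM[OF bs] M
          by (intro mult_mono power_mono) auto
      next
        case False
        have "iter_deriv bs (cutoff k) x = 0"
          by (rule iter_deriv_outside_support[of "cball 0 (real (Suc k))"])
            (use False in \<open>auto simp del: of_nat_Suc intro: cutoff_eq_0\<close>)
        then show ?thesis using M by simp
      qed
      have "(1 + norm x) ^ n * norm (iter_deriv bs (\<lambda>x. of_real c * cutoff k x - 0) x) =
         c * ((1 + norm x) ^ n * norm (iter_deriv bs (cutoff k) x))"
        using c by (simp add: iter_deriv_cmult[OF smooth_cutoff bs(1)] norm_mult)
      also have "\<dots> \<le> c * ((1 + real (Suc k)) ^ n * M)"
        using * c by (intro mult_left_mono) auto
      also have "\<dots> = d / 2" using M by (simp add: c_def)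
      finally show "(1 + norm x) ^ n * norm (iter_deriv bs (\<lambda>x. of_real c * cutoff k x - 0) x) \<le> d / 2" .
    qed
    moreover have "(\<lambda>x::'a. of_real c * cutoff k x) \<in> schwartz"
      using test_functions_mult(2)[OF cutoff_test[where 'a='a] smooth_fun_const[of "of_real c"]] test_functions_subset_schwartz by auto
    ultimately have "dist (T (\<lambda>x. of_real c * cutoff k x)) (T (\<lambda>x. 0)) < 1"
      using d by (intro d(2)) auto
    then have "c * norm (T (cutoff k)) < 1"
      using c by (simp add: T0 hom[OF sc] norm_mult)
    then have "norm (T (cutoff k)) \<le> 1 / c" using c by (simp add: field_simps)
    also have "\<dots> = (2 * M / d) * (1 + real (Suc k)) ^ n" by (simp add: c_def)
    also have "\<dots> \<le> (2 * M / d) * (2 * real (Suc k)) ^ n"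
      using M d by (intro mult_left_mono power_mono) auto
    finally show ?thesis by (simp add: power_mult_distrib del: of_nat_Suc)
  qed
  moreover have "2 * M * 2 ^ n / d > 0" using M d by simp
  ultimately show ?thesis using that by blast
qed

section \<open>Discrete complex Radon measures\<close>

lemma bounded_borel_iff: "B \<in> bounded_borel \<longleftrightarrow> B \<in> sets borel \<and> bounded B"
  by (simp add: bounded_borel_def)

lemma bounded_borel_subset: "B \<in> bounded_borel \<Longrightarrow> A \<in> sets borel \<Longrightarrow> A \<subseteq> B \<Longrightarrow> A \<in> bounded_borel"
  by (auto simp: bounded_borel_iff intro: bounded_subset)

lemma bounded_borel_Un: "A \<in> bounded_borel \<Longrightarrow> B \<in> bounded_borel \<Longrightarrow> A \<union> B \<in> bounded_borel"
  by (auto simp: bounded_borel_iff)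

lemma bounded_borel_finite: "finite X \<Longrightarrow> X \<in> bounded_borel"
  by (simp add: bounded_borel_iff finite_imp_bounded finite_imp_closed borel_closed)

text \<open>Countable additivity is available for bounded unions; intersecting with the bounded set
  B brings arbitrary Borel pieces into that form.\<close>

lemma complex_radon_sums:
  assumes "complex_radon \<mu>" "B \<in> bounded_borel"
    "\<And>n. A n \<in> sets borel" "disjoint_family A" "B \<subseteq> (\<Union>n. A n)"
  shows "(\<lambda>n::nat. \<mu> (B \<inter> A n)) sums \<mu> B"
proof -
  have "range (\<lambda>n. B \<inter> A n) \<subseteq> bounded_borel"
    using assms(2,3) by (auto intro: bounded_borel_subset simp: bounded_borel_iff)
  moreover have "disjoint_family (\<lambda>n. B \<inter> A n)"
    using assms(4) by (auto simp: disjoint_family_on_def)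
  moreover have "(\<Union>n. B \<inter> A n) = B" using assms(5) by auto
  moreover have "bounded B" using assms(2) by (simp add: bounded_borel_iff)
  ultimately show ?thesis using assms(1) unfolding complex_radon_def by metis
qed

lemma complex_radon_empty:
  assumes "complex_radon \<mu>"
  shows "\<mu> {} = 0"
proof -
  have "(\<lambda>n::nat. \<mu> ({} \<inter> {})) sums \<mu> {}"
    by (rule complex_radon_sums[OF assms]) (auto simp: bounded_borel_iff disjoint_family_on_def)
  then have "(\<lambda>n::nat. \<mu> {}) \<longlonglongrightarrow> 0" using sums_summable summable_LIMSEQ_zero by force
  then show ?thesis by (simp add: LIMSEQ_const_iff)
qed

lemma complex_radon_Un:
  assumes "complex_radon \<mu>" "A \<in> bounded_borel" "B \<in> bounded_borel" "A \<inter> B = {}"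
  shows "\<mu> (A \<union> B) = \<mu> A + \<mu> B"
proof -
  let ?F = "binaryset A B"
  have *: "(\<lambda>n. \<mu> ((A \<union> B) \<inter> ?F n)) sums \<mu> (A \<union> B)"
  proof (rule complex_radon_sums[OF assms(1) bounded_borel_Un[OF assms(2,3)]])
    show "binaryset A B n \<in> sets borel" for n
      using assms(2,3) by (auto simp: binaryset_def bounded_borel_iff)
    show "disjoint_family (binaryset A B)"
      using assms(4) by (auto simp: disjoint_family_on_def binaryset_def)
  qed (simp add: UN_binaryset_eq)
  have "(\<lambda>n. \<mu> ((A \<union> B) \<inter> ?F n)) sums (\<Sum>n<2. \<mu> ((A \<union> B) \<inter> ?F n))"
    by (rule sums_finite) (auto simp: binaryset_def complex_radon_empty[OF assms(1)])
  moreover have "(\<Sum>n<2. \<mu> ((A \<union> B) \<inter> ?F n)) = \<mu> A + \<mu> B"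
    by (simp add: binaryset_def eval_nat_numeral Int_absorb1)
  ultimately show ?thesis using * sums_unique2 by metis
qed

lemma complex_radon_finite:
  assumes "complex_radon \<mu>" "finite X"
  shows "\<mu> X = (\<Sum>x\<in>X. \<mu> {x})"
  using assms(2)
proof (induction X)
  case (insert x X)
  then have "\<mu> ({x} \<union> X) = \<mu> {x} + \<mu> X"
    by (intro complex_radon_Un assms bounded_borel_finite) auto
  with insert show ?case by simp
qed (simp add: complex_radon_empty assms)

section \<open>Countable additivity of the total variation\<close>

definition variation_partitions :: "'a::euclidean_space set \<Rightarrow> 'a set set set" where
  "variation_partitions A = {P. finite P \<and> disjoint P \<and> P \<subseteq> bounded_borel \<and> \<Union>P \<subseteq> A}"

definition variation :: "('a::euclidean_space set \<Rightarrow> complex) \<Rightarrow> 'a set \<Rightarrow> ennreal" where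
  "variation \<mu> A = (SUP P \<in> variation_partitions A. \<Sum>E\<in>P. ennreal (cmod (\<mu> E)))"

lemma total_variation_eq: "total_variation \<mu> = measure_of UNIV (sets borel) (variation \<mu>)"
  unfolding total_variation_def variation_def[abs_def] variation_partitions_def ..

lemma empty_variation_partition: "{} \<in> variation_partitions A"
  by (simp add: variation_partitions_def)

lemma variation_mono: "A \<subseteq> B \<Longrightarrow> variation \<mu> A \<le> variation \<mu> B"
  unfolding variation_def by (rule SUP_subset_mono) (auto simp: variation_partitions_def)

lemma variation_superadditive:
  assumes \<mu>: "complex_radon \<mu>" and "A \<inter> B = {}"
  shows "variation \<mu> A + variation \<mu> B \<le> variation \<mu> (A \<union> B)"
proof -
  have *: "(\<Sum>E\<in>P. ennreal (cmod (\<mu> E))) + (\<Sum>E\<in>Q. ennreal (cmod (\<mu> E))) \<le> variation \<mu> (A \<union> B)"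
    if P: "P \<in> variation_partitions A" and Q: "Q \<in> variation_partitions B" for P Q
  proof -
    \<comment> \<open>A set belonging to both P and Q can only be empty, of measure 0, so the sum
      over \<open>P \<union> Q\<close> is the sum of the two sums.\<close>
    have PQ: "E \<inter> F = {}" if "E \<in> P" "F \<in> Q" for E F
      using that P Q \<open>A \<inter> B = {}\<close> unfolding variation_partitions_def by blast
    then have "\<mu> E = 0" if "E \<in> P \<inter> Q" for E
      using that complex_radon_empty[OF \<mu>] by (metis Int_iff Int_absorb)
    then have "(\<Sum>E\<in>P \<inter> Q. ennreal (cmod (\<mu> E))) = 0"
      by (intro sum.neutral ballI) (simp only: norm_zero ennreal_0)
    then have "(\<Sum>E\<in>P. ennreal (cmod (\<mu> E))) + (\<Sum>E\<in>Q. ennreal (cmod (\<mu> E))) =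
        (\<Sum>E\<in>P \<union> Q. ennreal (cmod (\<mu> E)))"
      using sum.union_inter[of P Q "\<lambda>E. ennreal (cmod (\<mu> E))"] P Q by (simp add: variation_partitions_def)
    also have "\<dots> \<le> variation \<mu> (A \<union> B)"
      unfolding variation_def
    proof (rule SUP_upper)
      have "disjoint (P \<union> Q)"
      proof (rule disjoint_union)
        show "\<Union>P \<inter> \<Union>Q = {}" using PQ by blast
      qed (use P Q in \<open>auto simp: variation_partitions_def\<close>)
      then show "P \<union> Q \<in> variation_partitions (A \<union> B)"
        using P Q unfolding variation_partitions_def by auto
    qed
    finally show ?thesis .
  qed
  have "variation_partitions C \<noteq> {}" for C :: "'a set" using empty_variation_partition by blast
  then show ?thesis
    unfolding variation_def[of \<mu> A] variation_def[of \<mu> B]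
    by (simp only: ennreal_SUP_add_left[symmetric] ennreal_SUP_add_right SUP_le_iff not_False_eq_True *)
      (intro ballI *)
qed

lemma variation_sum_le:
  fixes A :: "nat \<Rightarrow> 'a::euclidean_space set"
  assumes \<mu>: "complex_radon \<mu>" and "disjoint_family A"
  shows "(\<Sum>n<N. variation \<mu> (A n)) \<le> variation \<mu> (\<Union>n<N. A n)"
proof (induction N)
  case (Suc N)
  have "(\<Sum>n<Suc N. variation \<mu> (A n)) \<le> variation \<mu> (\<Union>n<N. A n) + variation \<mu> (A N)"
    using Suc by (simp add: add_right_mono)
  also have "\<dots> \<le> variation \<mu> ((\<Union>n<N. A n) \<union> A N)"
  proof (rule variation_superadditive[OF \<mu>])
    have "A n \<inter> A N = {}" if "n < N" for n
      using disjoint_family_onD[OF assms(2), of n N] that by simp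
    then show "(\<Union>n<N. A n) \<inter> A N = {}" by blast
  qed
  also have "(\<Union>n<N. A n) \<union> A N = (\<Union>n<Suc N. A n)" by (auto simp: lessThan_Suc)
  finally show ?case .
qed simp

lemma norm_sums_le_suminf_ennreal:
  assumes "(\<lambda>n. m n) sums (z::complex)"
  shows "ennreal (cmod z) \<le> (\<Sum>n. ennreal (cmod (m n)))"
proof (rule LIMSEQ_le_const2)
  have "(\<lambda>N. cmod (\<Sum>n<N. m n)) \<longlonglongrightarrow> cmod z"
    using assms unfolding sums_def by (rule tendsto_norm)
  then show "(\<lambda>N. ennreal (cmod (\<Sum>n<N. m n))) \<longlonglongrightarrow> ennreal (cmod z)" by simp
  have "ennreal (cmod (\<Sum>n<N. m n)) \<le> (\<Sum>n. ennreal (cmod (m n)))" for N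
  proof -
    have "ennreal (cmod (\<Sum>n<N. m n)) \<le> ennreal (\<Sum>n<N. cmod (m n))"
      by (intro ennreal_leI norm_sum)
    also have "\<dots> = (\<Sum>n<N. ennreal (cmod (m n)))" by (simp add: sum_ennreal)
    also have "\<dots> \<le> (\<Sum>n. ennreal (cmod (m n)))" by (intro sum_le_suminf) auto
    finally show ?thesis .
  qed
  then show "\<exists>N. \<forall>n\<ge>N. ennreal (cmod (\<Sum>n<n. m n)) \<le> (\<Sum>n. ennreal (cmod (m n)))" by blast
qed

text \<open>Superadditivity on finite unions gives one inequality. For the other, each member of a
  finite partition is cut along the sets A n; it is bounded, so its measure is the sum over the
  pieces.\<close>

lemma variation_countably_additive:
  assumes \<mu>: "complex_radon \<mu>" and A: "\<And>n. A n \<in> sets borel" "disjoint_family A"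
  shows "(\<Sum>n. variation \<mu> (A n)) = variation \<mu> (\<Union>n::nat. A n)"
proof (rule antisym)
  show "(\<Sum>n. variation \<mu> (A n)) \<le> variation \<mu> (\<Union>n. A n)"
  proof (rule suminf_le_const)
    fix N
    have "(\<Sum>n<N. variation \<mu> (A n)) \<le> variation \<mu> (\<Union>n<N. A n)" by (rule variation_sum_le[OF \<mu> A(2)])
    also have "\<dots> \<le> variation \<mu> (\<Union>n. A n)" by (rule variation_mono) auto
    finally show "(\<Sum>n<N. variation \<mu> (A n)) \<le> variation \<mu> (\<Union>n. A n)" .
  qed simp
  show "variation \<mu> (\<Union>n. A n) \<le> (\<Sum>n. variation \<mu> (A n))"
    unfolding variation_def[of \<mu> "\<Union>n. A n"]
  proof (rule SUP_least)
    fix P assume P: "P \<in> variation_partitions (\<Union>n. A n)"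
    then have fin: "finite P" and bb: "\<And>E. E \<in> P \<Longrightarrow> E \<in> bounded_borel"
      and sub: "\<And>E. E \<in> P \<Longrightarrow> E \<subseteq> (\<Union>n. A n)"
      and disj: "\<And>E F. E \<in> P \<Longrightarrow> F \<in> P \<Longrightarrow> E \<noteq> F \<Longrightarrow> E \<inter> F = {}"
      by (auto simp: variation_partitions_def disjoint_def)
    have "(\<Sum>E\<in>P. ennreal (cmod (\<mu> E))) \<le> (\<Sum>E\<in>P. \<Sum>n. ennreal (cmod (\<mu> (E \<inter> A n))))"
      by (intro sum_mono norm_sums_le_suminf_ennreal complex_radon_sums \<mu> A bb sub)
    also have "\<dots> = (\<Sum>n. \<Sum>E\<in>P. ennreal (cmod (\<mu> (E \<inter> A n))))"
      by (rule suminf_sum[symmetric]) simp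
    also have "\<dots> \<le> (\<Sum>n. variation \<mu> (A n))"
    proof (rule suminf_le)
      fix n
      have "(\<Sum>E\<in>P. ennreal (cmod (\<mu> (E \<inter> A n)))) = (\<Sum>E\<in>(\<lambda>E. E \<inter> A n) ` P. ennreal (cmod (\<mu> E)))"
      \<comment> \<open>Cutting need not be injective, but distinct members with the same trace on A
        n have an empty trace, which contributes 0.\<close>
      proof (rule sum.reindex_nontrivial[symmetric, unfolded o_def])
        fix E F assume "E \<in> P" "F \<in> P" "E \<noteq> F" "E \<inter> A n = F \<inter> A n"
        with disj[of E F] have "E \<inter> A n = {}" by blast
        then show "ennreal (cmod (\<mu> (E \<inter> A n))) = 0" by (simp add: complex_radon_empty[OF \<mu>])
      qed (rule fin)
      also have "\<dots> \<le> variation \<mu> (A n)"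
        unfolding variation_def
      proof (rule SUP_upper)
        have "E \<inter> A n \<in> bounded_borel" if "E \<in> P" for E
          using bb[OF that] A(1)[of n] by (auto intro: bounded_borel_subset simp: bounded_borel_iff)
        moreover have "disjoint ((\<lambda>E. E \<inter> A n) ` P)"
          using disj unfolding disjoint_def by blast
        ultimately show "(\<lambda>E. E \<inter> A n) ` P \<in> variation_partitions (A n)"
          using fin by (auto simp: variation_partitions_def)
      qed
      finally show "(\<Sum>E\<in>P. ennreal (cmod (\<mu> (E \<inter> A n)))) \<le> variation \<mu> (A n)" .
    qed simp_all
    finally show "(\<Sum>E\<in>P. ennreal (cmod (\<mu> E))) \<le> (\<Sum>n. variation \<mu> (A n))" .
  qed
qed

lemma variation_empty:
  assumes "complex_radon \<mu>"
  shows "variation \<mu> {} = 0"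
proof -
  have "(\<Sum>E\<in>P. ennreal (cmod (\<mu> E))) = 0" if "P \<in> variation_partitions {}" for P
    using that complex_radon_empty[OF assms]
    by (intro sum.neutral) (auto simp: variation_partitions_def)
  then show ?thesis
    unfolding variation_def using empty_variation_partition by (subst SUP_eq_const) auto
qed

lemma sets_total_variation [simp]: "sets (total_variation \<mu>) = sets borel"
  and space_total_variation [simp]: "space (total_variation \<mu>) = UNIV"
  using sets.sigma_sets_eq[of borel]
  by (auto simp: total_variation_eq sets_measure_of_conv space_measure_of_conv)

lemma emeasure_total_variation:
  assumes "complex_radon \<mu>" "A \<in> sets borel"
  shows "emeasure (total_variation \<mu>) A = variation \<mu> A"
  unfolding total_variation_eq
proof (rule emeasure_measure_of_sigma)
  show "sigma_algebra UNIV (sets borel)" using sets.sigma_algebra_axioms[of borel] by simp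
  show "positive (sets borel) (variation \<mu>)" by (simp add: positive_def variation_empty assms)
  show "countably_additive (sets borel) (variation \<mu>)"
    using variation_countably_additive[OF assms(1)] by (auto simp: countably_additive_def)
qed (rule assms)

lemma norm_le_variation:
  assumes "E \<in> bounded_borel" "E \<subseteq> A"
  shows "ennreal (cmod (\<mu> E)) \<le> variation \<mu> A"
proof -
  have "(\<Sum>E\<in>{E}. ennreal (cmod (\<mu> E))) \<le> variation \<mu> A"
    unfolding variation_def using assms by (intro SUP_upper) (auto simp: variation_partitions_def)
  then show ?thesis by simp
qed

section \<open>Support and masses of a discrete measure\<close>

lemma closed_msupp: "closed (msupp \<mu>)"
  unfolding msupp_def by (auto simp: closed_def)

text \<open>Discreteness only isolates the points of the support. Because the support is closed, an
  accumulation point of an infinite bounded part would belong to it and contradict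
  isolation.\<close>

lemma discrete_measure_locally_finite:
  assumes "discrete_measure \<mu>" "bounded B"
  shows "finite (msupp \<mu> \<inter> B)"
proof (rule ccontr)
  assume inf: "infinite (msupp \<mu> \<inter> B)"
  have "compact (msupp \<mu> \<inter> closure B)"
    using assms(2) by (intro closed_Int_compact closed_msupp) (simp add: compact_closure)
  moreover have "msupp \<mu> \<inter> B \<subseteq> msupp \<mu> \<inter> closure B" using closure_subset by blast
  ultimately obtain x where x: "x \<in> msupp \<mu>" "x islimpt (msupp \<mu> \<inter> B)"
    using inf unfolding compact_eq_Bolzano_Weierstrass by blast
  obtain \<epsilon> where "\<epsilon> > 0" "ball x \<epsilon> \<inter> msupp \<mu> = {x}"
    using assms(1) x(1) unfolding discrete_measure_def by blast
  with x(2) show False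
    unfolding islimpt_def by (metis Int_iff centre_in_ball open_ball singletonD Int_commute)
qed

text \<open>The complement of the support is a union of possibly uncountably many open null sets;
  Lindelof reduces it to a countable union.\<close>

lemma variation_outside_msupp:
  assumes \<mu>: "complex_radon \<mu>"
  shows "variation \<mu> (- msupp \<mu>) = 0"
proof -
  let ?\<F> = "{U. open U \<and> emeasure (total_variation \<mu>) U = 0}"
  obtain \<G> where \<G>: "\<G> \<subseteq> ?\<F>" "countable \<G>" "\<Union>\<G> = \<Union>?\<F>"
    using Lindelof[of ?\<F>] by blast
  have "(\<Union>U\<in>\<G>. U) \<in> null_sets (total_variation \<mu>)"
    using \<G> by (intro null_sets_UN') (auto simp: null_sets_def)
  then have "emeasure (total_variation \<mu>) (- msupp \<mu>) = 0"
    using \<G>(3) by (simp add: msupp_def null_sets_def)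
  moreover have "- msupp \<mu> \<in> sets borel" using closed_msupp[of \<mu>] by (simp add: borel_open closed_open)
  ultimately show ?thesis by (simp add: emeasure_total_variation[OF \<mu>])
qed

lemma discrete_measure_eq_sum:
  assumes \<mu>: "complex_radon \<mu>" "discrete_measure \<mu>" and B: "B \<in> bounded_borel"
  shows "\<mu> B = (\<Sum>x\<in>msupp \<mu> \<inter> B. \<mu> {x})"
proof -
  have fin: "finite (msupp \<mu> \<inter> B)" using discrete_measure_locally_finite[OF \<mu>(2)] B by (simp add: bounded_borel_iff)
  have "msupp \<mu> \<in> sets borel" using closed_msupp by (rule borel_closed)
  then have bb: "B - msupp \<mu> \<in> bounded_borel" using B by (auto intro: bounded_borel_subset simp: bounded_borel_iff)
  have "ennreal (cmod (\<mu> (B - msupp \<mu>))) \<le> variation \<mu> (- msupp \<mu>)"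
    by (rule norm_le_variation[OF bb]) auto
  then have 0: "\<mu> (B - msupp \<mu>) = 0" by (simp add: variation_outside_msupp[OF \<mu>(1)])
  have "\<mu> ((B - msupp \<mu>) \<union> (msupp \<mu> \<inter> B)) = \<mu> (B - msupp \<mu>) + \<mu> (msupp \<mu> \<inter> B)"
    by (intro complex_radon_Un \<mu> bb bounded_borel_finite fin) auto
  moreover have "(B - msupp \<mu>) \<union> (msupp \<mu> \<inter> B) = B" by auto
  ultimately show ?thesis using 0 complex_radon_finite[OF \<mu>(1) fin] by simp
qed

text \<open>Near an isolated point the measure is carried by that point alone, so mass 0 would make
  a whole ball null and expel the point from the support. Later this guarantees that narrow bumps
  see every point of the spectrum.\<close>

lemma discrete_measure_mass_nonzero:
  assumes \<mu>: "complex_radon \<mu>" "discrete_measure \<mu>" and x: "x \<in> msupp \<mu>"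
  shows "\<mu> {x} \<noteq> 0"
proof
  assume 0: "\<mu> {x} = 0"
  obtain \<epsilon> where e: "\<epsilon> > 0" "ball x \<epsilon> \<inter> msupp \<mu> = {x}"
    using \<mu>(2) x unfolding discrete_measure_def by blast
  have "\<mu> E = 0" if "E \<in> bounded_borel" "E \<subseteq> ball x \<epsilon>" for E
  proof -
    have "msupp \<mu> \<inter> E \<subseteq> {x}" using that e by blast
    then show ?thesis using 0 discrete_measure_eq_sum[OF \<mu> that(1)] by (auto intro!: sum.neutral)
  qed
  then have "(\<Sum>E\<in>P. ennreal (cmod (\<mu> E))) = 0" if "P \<in> variation_partitions (ball x \<epsilon>)" for P
    using that by (intro sum.neutral) (auto simp: variation_partitions_def)
  then have "variation \<mu> (ball x \<epsilon>) = 0"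
    unfolding variation_def using empty_variation_partition by (subst SUP_eq_const) auto
  then have "emeasure (total_variation \<mu>) (ball x \<epsilon>) = 0"
    by (simp add: emeasure_total_variation[OF \<mu>(1)])
  then have "x \<notin> msupp \<mu>" unfolding msupp_def using e(1) by (auto intro!: exI[of _ "ball x \<epsilon>"])
  with x show False by simp
qed

section \<open>Variations of discrete measures as point masses\<close>

text \<open>The image under the identity replaces the power set of S by the Borel sets, so that
  equality with measures built by \<open>measure_of\<close> is possible.\<close>

definition point_masses :: "'a::euclidean_space set \<Rightarrow> ('a \<Rightarrow> ennreal) \<Rightarrow> 'a measure" where
  "point_masses S w = distr (density (count_space S) w) borel (\<lambda>x. x)"

lemma sets_point_masses [simp]: "sets (point_masses S w) = sets borel"
  and space_point_masses [simp]: "space (point_masses S w) = UNIV"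
  by (simp_all add: point_masses_def)

lemma emeasure_point_masses:
  assumes "A \<in> sets borel" "finite (S \<inter> A)"
  shows "emeasure (point_masses S w) A = (\<Sum>x\<in>S \<inter> A. w x)"
proof -
  have "emeasure (point_masses S w) A = emeasure (density (count_space S) w) (S \<inter> A)"
    using assms by (simp add: point_masses_def emeasure_distr Int_commute)
  also have "\<dots> = (\<integral>\<^sup>+x. w x * indicator (S \<inter> A) x \<partial>count_space S)"
    by (subst emeasure_density) auto
  also have "\<dots> = (\<Sum>x\<in>S \<inter> A. w x * indicator (S \<inter> A) x)"
    by (rule nn_integral_count_space'[OF assms(2)]) (auto simp: indicator_def)
  also have "\<dots> = (\<Sum>x\<in>S \<inter> A. w x)" by (intro sum.cong) auto
  finally show ?thesis .
qed

text \<open>Once F agrees with the point masses on Borel sets, \<open>measure_of\<close> returns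
  that measure, and the additivity of F is a consequence. The lower bound is tested on finite sets
  of atoms and extended by exhaustion with balls, where S is finite. The positive and the total
  variation are both instances.\<close>

lemma measure_of_eq_point_masses:
  assumes S: "\<And>B. bounded B \<Longrightarrow> finite (S \<inter> B)"
    and le: "\<And>A. A \<in> sets borel \<Longrightarrow> F A \<le> emeasure (point_masses S w) A"
    and ge: "\<And>A X. A \<in> sets borel \<Longrightarrow> finite X \<Longrightarrow> X \<subseteq> S \<inter> A \<Longrightarrow> (\<Sum>x\<in>X. w x) \<le> F A"
  shows "measure_of UNIV (sets borel) F = point_masses S w"
proof -
  have "F A = emeasure (point_masses S w) A" if A: "A \<in> sets borel" for A
  proof (rule antisym[OF le[OF A]])
    let ?B = "\<lambda>n. A \<inter> cball 0 (real n)"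
    have "(SUP n. emeasure (point_masses S w) (?B n)) = emeasure (point_masses S w) (\<Union>n. ?B n)"
      using A by (intro SUP_emeasure_incseq) (auto simp: incseq_def)
    moreover have "(\<Union>n. ?B n) = A" using real_arch_simple by auto
    moreover have "emeasure (point_masses S w) (?B n) \<le> F A" for n
    proof -
      have fin: "finite (S \<inter> ?B n)" using S[of "cball 0 (real n)"] by (auto intro: finite_subset[rotated])
      have "emeasure (point_masses S w) (?B n) = (\<Sum>x\<in>S \<inter> ?B n. w x)"
        using A fin by (intro emeasure_point_masses) auto
      also have "\<dots> \<le> F A" by (rule ge[OF A fin]) auto
      finally show ?thesis .
    qed
    ultimately show "emeasure (point_masses S w) A \<le> F A" by (metis SUP_least)
  qed
  then have "measure_of UNIV (sets borel) F = measure_of UNIV (sets borel) (emeasure (point_masses S w))"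
    using sets.sigma_sets_eq[of "borel :: 'a measure"] by (intro measure_of_eq) auto
  also have "\<dots> = point_masses S w"
    using measure_of_of_measure[of "point_masses S w"] by simp
  finally show ?thesis .
qed

lemma sum_le_emeasure_point_masses:
  assumes "A \<in> sets borel" "finite X" "X \<subseteq> S \<inter> A"
  shows "(\<Sum>x\<in>X. w x) \<le> emeasure (point_masses S w) A"
proof -
  have "(\<Sum>x\<in>X. w x) = emeasure (point_masses S w) X"
    using emeasure_point_masses[of X S w] assms bounded_borel_finite[of X]
    by (simp add: bounded_borel_iff Int_absorb1 subset_iff)
  also have "\<dots> \<le> emeasure (point_masses S w) A"
    using assms by (intro emeasure_mono) auto
  finally show ?thesis .
qed

lemma positive_variation_point_masses:
  fixes \<sigma> :: "'a::euclidean_space set \<Rightarrow> real"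
  assumes S: "\<And>B. bounded B \<Longrightarrow> finite (S \<inter> B)"
    and \<sigma>: "\<And>B. B \<in> bounded_borel \<Longrightarrow> \<sigma> B = (\<Sum>x\<in>S \<inter> B. s x)"
  shows "positive_variation \<sigma> = point_masses S (\<lambda>x. ennreal (s x))"
  unfolding positive_variation_def
proof (rule measure_of_eq_point_masses[OF S])
  fix A :: "'a set" assume A: "A \<in> sets borel"
  show "(SUP E\<in>{E \<in> bounded_borel. E \<subseteq> A}. ennreal (\<sigma> E)) \<le> emeasure (point_masses S (\<lambda>x. ennreal (s x))) A"
  proof (rule SUP_least)
    fix E assume E: "E \<in> {E \<in> bounded_borel. E \<subseteq> A}"
    have "ennreal (\<sigma> E) \<le> ennreal (\<Sum>x\<in>S \<inter> E. max 0 (s x))"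
      using \<sigma> E by (auto intro!: ennreal_leI sum_mono)
    also have "\<dots> = (\<Sum>x\<in>S \<inter> E. ennreal (max 0 (s x)))" by (rule sum_ennreal[symmetric]) simp
    also have "\<dots> = (\<Sum>x\<in>S \<inter> E. ennreal (s x))"
      by (intro sum.cong) (auto simp: max_def ennreal_neg)
    also have "\<dots> \<le> emeasure (point_masses S (\<lambda>x. ennreal (s x))) A"
      using A E S[of E] by (intro sum_le_emeasure_point_masses) (auto simp: bounded_borel_iff)
    finally show "ennreal (\<sigma> E) \<le> emeasure (point_masses S (\<lambda>x. ennreal (s x))) A" .
  qed
next
  fix A X :: "'a set" assume X: "A \<in> sets borel" "finite X" "X \<subseteq> S \<inter> A"
  \<comment> \<open>Negative atoms would lower \<open>\<sigma> E\<close>, while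
    \<open>ennreal\<close> truncates their terms to 0; discarding them therefore realises the whole
    sum by a single set.\<close>
  let ?E = "{x \<in> X. s x \<ge> 0}"
  have "(\<Sum>x\<in>X. ennreal (s x)) = (\<Sum>x\<in>?E. ennreal (s x))"
    using X(2) by (intro sum.mono_neutral_right) (auto simp: ennreal_eq_0_iff)
  also have "\<dots> = ennreal (\<Sum>x\<in>?E. s x)" by (rule sum_ennreal) auto
  also have "S \<inter> ?E = ?E" using X by auto
  then have "(\<Sum>x\<in>?E. s x) = \<sigma> ?E" using \<sigma>[of ?E] bounded_borel_finite[of ?E] X by simp
  also have "ennreal (\<sigma> ?E) \<le> (SUP E\<in>{E \<in> bounded_borel. E \<subseteq> A}. ennreal (\<sigma> E))"
    using X bounded_borel_finite[of ?E] by (intro SUP_upper) auto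
  finally show "(\<Sum>x\<in>X. ennreal (s x)) \<le> (SUP E\<in>{E \<in> bounded_borel. E \<subseteq> A}. ennreal (\<sigma> E))" .
qed

lemma total_variation_point_masses:
  fixes \<mu> :: "'a::euclidean_space set \<Rightarrow> complex"
  assumes \<mu>: "complex_radon \<mu>" "discrete_measure \<mu>"
  shows "total_variation \<mu> = point_masses (msupp \<mu>) (\<lambda>x. ennreal (cmod (\<mu> {x})))"
  unfolding total_variation_eq
proof (rule measure_of_eq_point_masses)
  show lf: "finite (msupp \<mu> \<inter> B)" if "bounded B" for B
    using discrete_measure_locally_finite[OF \<mu>(2) that] .
  let ?M = "point_masses (msupp \<mu>) (\<lambda>x. ennreal (cmod (\<mu> {x})))"
  fix A :: "'a set" assume A: "A \<in> sets borel"
  show "variation \<mu> A \<le> emeasure ?M A"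
    unfolding variation_def
  proof (rule SUP_least)
    fix P assume "P \<in> variation_partitions A"
    then have P: "finite P" "disjoint P" "\<And>E. E \<in> P \<Longrightarrow> E \<in> bounded_borel" "\<Union>P \<subseteq> A"
      by (auto simp: variation_partitions_def)
    have fin: "finite (msupp \<mu> \<inter> E)" if "E \<in> P" for E using lf P(3) that by (simp add: bounded_borel_iff)
    have "(\<Sum>E\<in>P. ennreal (cmod (\<mu> E))) \<le> (\<Sum>E\<in>P. \<Sum>x\<in>msupp \<mu> \<inter> E. ennreal (cmod (\<mu> {x})))"
    proof (rule sum_mono)
      fix E assume "E \<in> P"
      then have "cmod (\<mu> E) \<le> (\<Sum>x\<in>msupp \<mu> \<inter> E. cmod (\<mu> {x}))"
        using discrete_measure_eq_sum[OF \<mu> P(3)] by (simp add: norm_sum)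
      then show "ennreal (cmod (\<mu> E)) \<le> (\<Sum>x\<in>msupp \<mu> \<inter> E. ennreal (cmod (\<mu> {x})))"
        by (subst sum_ennreal) (auto intro: ennreal_leI)
    qed
    also have "\<dots> = (\<Sum>x\<in>(\<Union>E\<in>P. msupp \<mu> \<inter> E). ennreal (cmod (\<mu> {x})))"
      using P fin by (intro sum.UNION_disjoint[symmetric]) (auto simp: disjoint_def)
    also have "\<dots> \<le> emeasure ?M A"
      by (intro sum_le_emeasure_point_masses A finite_UN_I P(1) fin) (use P(4) in auto)
    finally show "(\<Sum>E\<in>P. ennreal (cmod (\<mu> E))) \<le> emeasure ?M A" .
  qed
next
  fix A X :: "'a set" assume X: "A \<in> sets borel" "finite X" "X \<subseteq> msupp \<mu> \<inter> A"
  have "(\<Sum>x\<in>X. ennreal (cmod (\<mu> {x}))) = (\<Sum>E\<in>(\<lambda>x. {x}) ` X. ennreal (cmod (\<mu> E)))"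
    by (subst sum.reindex) auto
  also have "\<dots> \<le> variation \<mu> A"
    unfolding variation_def using X
    by (intro SUP_upper) (auto simp: variation_partitions_def disjoint_def bounded_borel_finite)
  finally show "(\<Sum>x\<in>X. ennreal (cmod (\<mu> {x}))) \<le> variation \<mu> A" .
qed

lemma integral_point_masses:
  fixes f :: "'a::euclidean_space \<Rightarrow> complex"
  assumes S: "finite (S \<inter> K)" and f: "f \<in> borel_measurable borel" "\<And>x. x \<notin> K \<Longrightarrow> f x = 0"
  shows "(LINT x|point_masses S (\<lambda>x. ennreal (s x)). f x) = (\<Sum>x\<in>S \<inter> K. of_real (max 0 (s x)) * f x)"
proof -
  have e: "(\<lambda>x. ennreal (s x)) = (\<lambda>x. ennreal (max 0 (s x)))"
    by (auto simp: max_def ennreal_neg)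
  have "(LINT x|point_masses S (\<lambda>x. ennreal (s x)). f x) = (LINT x|density (count_space S) (\<lambda>x. ennreal (max 0 (s x))). f x)"
    unfolding point_masses_def e using f by (intro integral_distr) auto
  also have "\<dots> = (LINT x|count_space S. max 0 (s x) *\<^sub>R f x)"
    by (rule integral_density) auto
  also have "\<dots> = (\<Sum>x | x \<in> S \<and> max 0 (s x) *\<^sub>R f x \<noteq> 0. max 0 (s x) *\<^sub>R f x)"
    using f(2) by (intro lebesgue_integral_count_space_finite_support finite_subset[OF _ S]) auto
  also have "\<dots> = (\<Sum>x\<in>S \<inter> K. max 0 (s x) *\<^sub>R f x)"
    using f(2) by (intro sum.mono_neutral_left S) auto
  finally show ?thesis by (simp add: scaleR_conv_of_real)
qed

text \<open>The four variations become positive and negative parts over the same atoms and recombine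
  by t = max 0 t - max 0 (- t). The set K confines f, which keeps every sum finite.\<close>

lemma radon_integral_discrete:
  fixes f :: "'a::euclidean_space \<Rightarrow> complex"
  assumes \<mu>: "complex_radon \<mu>" "discrete_measure \<mu>" and K: "bounded K"
    and f: "f \<in> borel_measurable borel" "\<And>x. x \<notin> K \<Longrightarrow> f x = 0"
  shows "radon_integral \<mu> f = (\<Sum>x\<in>msupp \<mu> \<inter> K. \<mu> {x} * f x)"
proof -
  let ?S = "msupp \<mu>"
  have lf: "finite (?S \<inter> B)" if "bounded B" for B
    using discrete_measure_locally_finite[OF \<mu>(2) that] .
  have eq: "\<mu> B = (\<Sum>x\<in>?S \<inter> B. \<mu> {x})" if "B \<in> bounded_borel" for B
    using discrete_measure_eq_sum[OF \<mu> that] .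
  have Re: "Re (\<mu> B) = (\<Sum>x\<in>?S \<inter> B. Re (\<mu> {x}))" and Im: "Im (\<mu> B) = (\<Sum>x\<in>?S \<inter> B. Im (\<mu> {x}))"
    if "B \<in> bounded_borel" for B
    using arg_cong[OF eq[OF that], of Re] arg_cong[OF eq[OF that], of Im] by simp_all
  have 1: "positive_variation (\<lambda>B. Re (\<mu> B)) = point_masses ?S (\<lambda>x. ennreal (Re (\<mu> {x})))"
    by (rule positive_variation_point_masses[OF lf Re])
  have 2: "positive_variation (\<lambda>B. - Re (\<mu> B)) = point_masses ?S (\<lambda>x. ennreal (- Re (\<mu> {x})))"
    by (rule positive_variation_point_masses[OF lf]) (use Re in \<open>auto simp: sum_negf\<close>)
  have 3: "positive_variation (\<lambda>B. Im (\<mu> B)) = point_masses ?S (\<lambda>x. ennreal (Im (\<mu> {x})))"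
    by (rule positive_variation_point_masses[OF lf Im])
  have 4: "positive_variation (\<lambda>B. - Im (\<mu> B)) = point_masses ?S (\<lambda>x. ennreal (- Im (\<mu> {x})))"
    by (rule positive_variation_point_masses[OF lf]) (use Im in \<open>auto simp: sum_negf\<close>)
  have int: "(LINT x|point_masses ?S (\<lambda>x. ennreal (s x)). f x) = (\<Sum>x\<in>?S \<inter> K. of_real (max 0 (s x)) * f x)" for s
    by (rule integral_point_masses[OF lf[OF K] f])
  have "radon_integral \<mu> f = (\<Sum>x\<in>?S \<inter> K.
      of_real (max 0 (Re (\<mu> {x}))) * f x - of_real (max 0 (- Re (\<mu> {x}))) * f x +
      \<i> * (of_real (max 0 (Im (\<mu> {x}))) * f x - of_real (max 0 (- Im (\<mu> {x}))) * f x))"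
    unfolding radon_integral_def 1 2 3 4 int
    by (simp add: sum.distrib sum_subtractf sum_distrib_left[symmetric])
  also have "\<dots> = (\<Sum>x\<in>?S \<inter> K. \<mu> {x} * f x)"
  proof (rule sum.cong)
    fix x
    have pm: "of_real (max 0 t) - of_real (max 0 (- t)) = complex_of_real t" for t :: real
      by (simp add: max_def)
    have "of_real (max 0 (Re (\<mu> {x}))) * f x - of_real (max 0 (- Re (\<mu> {x}))) * f x +
      \<i> * (of_real (max 0 (Im (\<mu> {x}))) * f x - of_real (max 0 (- Im (\<mu> {x}))) * f x) =
      (of_real (Re (\<mu> {x})) + \<i> * of_real (Im (\<mu> {x}))) * f x"
      unfolding left_diff_distrib[symmetric] pm by (simp add: algebra_simps)
    also have "\<dots> = \<mu> {x} * f x" by (simp add: complex_eq[symmetric])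
    finally show "of_real (max 0 (Re (\<mu> {x}))) * f x - of_real (max 0 (- Re (\<mu> {x}))) * f x +
      \<i> * (of_real (max 0 (Im (\<mu> {x}))) * f x - of_real (max 0 (- Im (\<mu> {x}))) * f x) = \<mu> {x} * f x" .
  qed simp
  finally show ?thesis .
qed

lemma integral_total_variation_discrete:
  fixes f :: "'a::euclidean_space \<Rightarrow> complex"
  assumes \<mu>: "complex_radon \<mu>" "discrete_measure \<mu>" and K: "bounded K"
    and f: "f \<in> borel_measurable borel" "\<And>x. x \<notin> K \<Longrightarrow> f x = 0"
  shows "(LINT x|total_variation \<mu>. f x) = (\<Sum>x\<in>msupp \<mu> \<inter> K. of_real (cmod (\<mu> {x})) * f x)"
  using integral_point_masses[OF discrete_measure_locally_finite[OF \<mu>(2) K] f, where s="\<lambda>x. cmod (\<mu> {x})"]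
  unfolding total_variation_point_masses[OF \<mu>] by (simp add: max_def)

section \<open>Almost periodic series\<close>

text \<open>Cutoffs are nonnegative, so their integrals against the total variation dominate the
  mass of a ball; as values of a temperate distribution these integrals grow at most
  polynomially.\<close>

lemma temperate_variation_growth:
  fixes \<mu> :: "'a::euclidean_space set \<Rightarrow> complex"
  assumes \<mu>: "complex_radon \<mu>" "discrete_measure \<mu>" and tv: "temperate_variation \<mu>"
  obtains C n where "C > 0" "\<And>k. (\<Sum>x\<in>msupp \<mu> \<inter> cball 0 (real k). cmod (\<mu> {x})) \<le> C * real (Suc k) ^ n"
proof -
  obtain T where T: "temperate T" "\<And>f. f \<in> test_functions \<Longrightarrow> T f = (LINT x|total_variation \<mu>. f x)"
    using tv by (auto simp: temperate_variation_def temperate_ext_def)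
  obtain C n where C: "C > 0" "\<And>k. norm (T (cutoff k)) \<le> C * real (Suc k) ^ n"
    using temperate_cutoff_growth[OF T(1)] by blast
  obtain c where c: "c > 0" "\<And>k (x::'a). norm x \<le> real (Suc k) / 2 \<Longrightarrow> Re (cutoff k x) \<ge> c"
    using cutoff_lower_bound by blast
  have "(\<Sum>x\<in>msupp \<mu> \<inter> cball 0 (real k). cmod (\<mu> {x})) \<le> (C * 2 ^ n / c) * real (Suc k) ^ n" for k
  proof -
    \<comment> \<open>With this index the lower bound for the cutoff holds up to norm (2k + 1)/2,
      which covers the ball of radius k.\<close>
    let ?j = "2 * k"
    let ?K = "cball (0::'a) (real (Suc ?j))"
    have fin: "finite (msupp \<mu> \<inter> ?K)" by (rule discrete_measure_locally_finite[OF \<mu>(2)]) simp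
    have Tj: "T (cutoff ?j) = (\<Sum>x\<in>msupp \<mu> \<inter> ?K. of_real (cmod (\<mu> {x})) * cutoff ?j x)"
      unfolding T(2)[OF cutoff_test]
    proof (rule integral_total_variation_discrete[OF \<mu>])
      show "cutoff ?j \<in> borel_measurable borel"
        by (intro borel_measurable_continuous_onI smooth_fun_continuous smooth_cutoff)
    qed (auto intro: cutoff_eq_0 simp del: of_nat_Suc)
    have "c * (\<Sum>x\<in>msupp \<mu> \<inter> cball 0 (real k). cmod (\<mu> {x})) =
        (\<Sum>x\<in>msupp \<mu> \<inter> cball 0 (real k). cmod (\<mu> {x}) * c)"
      by (simp add: sum_distrib_left mult.commute)
    also have "\<dots> \<le> (\<Sum>x\<in>msupp \<mu> \<inter> cball 0 (real k). cmod (\<mu> {x}) * Re (cutoff ?j x))"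
      by (intro sum_mono mult_left_mono c(2)) auto
    also have "\<dots> \<le> (\<Sum>x\<in>msupp \<mu> \<inter> ?K. cmod (\<mu> {x}) * Re (cutoff ?j x))"
      by (rule sum_mono2[OF fin]) (auto intro: mult_nonneg_nonneg cutoff_nonneg)
    also have "\<dots> = Re (T (cutoff ?j))" by (simp add: Tj)
    also have "\<dots> \<le> C * real (Suc ?j) ^ n" using C(2) complex_Re_le_cmod order_trans by blast
    also have "\<dots> \<le> C * (2 * real (Suc k)) ^ n" using C(1) by (intro mult_left_mono power_mono) auto
    also have "\<dots> = c * ((C * 2 ^ n / c) * real (Suc k) ^ n)"
      using c(1) by (simp add: power_mult_distrib del: of_nat_Suc)
    finally show ?thesis using c(1) by (simp only: mult_le_cancel_left_pos)
  qed
  moreover have "C * 2 ^ n / c > 0" using C c by simp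
  ultimately show ?thesis using that by blast
qed

lemma complex_radon_point_outside:
  assumes "complex_radon \<mu>" "discrete_measure \<mu>" "x \<notin> msupp \<mu>"
  shows "\<mu> {x} = 0"
  using discrete_measure_eq_sum[OF assms(1,2), of "{x}"] assms(3) by (simp add: bounded_borel_finite)

text \<open>The atoms are grouped into shells by the integer part j of the norm. A shell carries
  mass O((j+1)^n), and n + 2 powers of decay of g leave the summable 1/(j+1)^2. The series runs over
  the whole space, with zero terms off the support, so that series for different measures can be
  subtracted.\<close>

lemma integrable_masses_mult_rapidly_decreasing:
  fixes \<mu> :: "'a::euclidean_space set \<Rightarrow> complex"
  assumes \<mu>: "complex_radon \<mu>" "discrete_measure \<mu>" and tv: "temperate_variation \<mu>"
    and g: "\<And>n. \<exists>D. \<forall>x. (1 + norm x) ^ n * norm (g x) \<le> D"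
  shows "integrable (count_space UNIV) (\<lambda>x. \<mu> {x} * (g x :: complex))"
proof -
  obtain C n where C: "C > 0" "\<And>k. (\<Sum>x\<in>msupp \<mu> \<inter> cball 0 (real k). cmod (\<mu> {x})) \<le> C * real (Suc k) ^ n"
    using temperate_variation_growth[OF \<mu> tv] by blast
  obtain D where D: "\<And>x. (1 + norm x) ^ (n + 2) * norm (g x) \<le> D" using g by blast
  have D0: "D \<ge> 0" using D[of 0] by (meson norm_ge_zero order_trans mult_nonneg_nonneg zero_le_power add_nonneg_nonneg zero_le_one)
  \<comment> \<open>The shell j lies in the ball of radius j + 1, whose mass is at most C (j+2)^n;
    the factor 2^n comes from j + 2 \<le> 2(j + 1).\<close>
  define a where "a j = C * 2 ^ n * D / real (Suc j) ^ 2" for j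
  have a0: "a j \<ge> 0" for j using C D0 by (simp add: a_def)
  have suma: "summable a"
    unfolding a_def using inverse_power_summable[of 2, where 'a=real]
    by (subst summable_Suc_iff[of "\<lambda>j. C * 2 ^ n * D / real j ^ 2"])
      (auto simp: divide_inverse intro!: summable_mult)
  have bound: "(\<Sum>x\<in>F. norm (\<mu> {x} * g x)) \<le> suminf a" if F: "finite F" for F
  proof -
    let ?N = "\<lambda>x::'a. nat \<lfloor>norm x\<rfloor>"
    have N: "real (?N x) \<le> norm x" "norm x \<le> real (Suc (?N x))" for x by (simp_all add: le_of_int_ceiling) linarith+
    have "(\<Sum>x\<in>F. norm (\<mu> {x} * g x)) = (\<Sum>j\<in>?N ` F. \<Sum>x\<in>{x \<in> F. ?N x = j}. norm (\<mu> {x} * g x))"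
      using F by (intro sum.group[symmetric]) auto
    also have "\<dots> \<le> (\<Sum>j\<in>?N ` F. a j)"
    proof (rule sum_mono)
      fix j
      let ?F = "{x \<in> F. ?N x = j}"
      have "(\<Sum>x\<in>?F. norm (\<mu> {x} * g x)) \<le> (\<Sum>x\<in>?F. cmod (\<mu> {x}) * (D / real (Suc j) ^ (n + 2)))"
      proof (rule sum_mono)
        fix x assume "x \<in> ?F"
        then have "real (Suc j) \<le> 1 + norm x" using N(1)[of x] by auto
        then have "real (Suc j) ^ (n + 2) * norm (g x) \<le> (1 + norm x) ^ (n + 2) * norm (g x)"
          by (intro mult_right_mono power_mono) auto
        also have "\<dots> \<le> D" by (rule D)
        finally have "norm (g x) \<le> D / real (Suc j) ^ (n + 2)"
          by (simp add: pos_le_divide_eq mult.commute del: of_nat_Suc power_Suc)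
        then show "norm (\<mu> {x} * g x) \<le> cmod (\<mu> {x}) * (D / real (Suc j) ^ (n + 2))"
          unfolding norm_mult by (intro mult_left_mono) auto
      qed
      also have "\<dots> = (\<Sum>x\<in>?F. cmod (\<mu> {x})) * (D / real (Suc j) ^ (n + 2))"
        by (rule sum_distrib_right[symmetric])
      finally have 1: "(\<Sum>x\<in>?F. norm (\<mu> {x} * g x)) \<le>
          (\<Sum>x\<in>?F. cmod (\<mu> {x})) * (D / real (Suc j) ^ (n + 2))" .
      have "(\<Sum>x\<in>?F. cmod (\<mu> {x})) \<le> (\<Sum>x\<in>msupp \<mu> \<inter> cball 0 (real (Suc j)). cmod (\<mu> {x}))"
      proof -
        have "(\<Sum>x\<in>?F. cmod (\<mu> {x})) = (\<Sum>x\<in>?F \<inter> msupp \<mu>. cmod (\<mu> {x}))"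
          using F complex_radon_point_outside[OF \<mu>] by (intro sum.mono_neutral_right) auto
        also have "\<dots> \<le> (\<Sum>x\<in>msupp \<mu> \<inter> cball 0 (real (Suc j)). cmod (\<mu> {x}))"
          using N(2) discrete_measure_locally_finite[OF \<mu>(2)] by (intro sum_mono2) auto
        finally show ?thesis .
      qed
      also have "\<dots> \<le> C * real (Suc (Suc j)) ^ n" by (rule C)
      also have "\<dots> \<le> C * (2 * real (Suc j)) ^ n" using C(1) by (intro mult_left_mono power_mono) auto
      finally have "(\<Sum>x\<in>?F. cmod (\<mu> {x})) * (D / real (Suc j) ^ (n + 2)) \<le>
          C * (2 * real (Suc j)) ^ n * (D / real (Suc j) ^ (n + 2))"
        by (rule mult_right_mono) (simp add: D0)
      also have "\<dots> = a j"
        by (simp add: a_def power_mult_distrib power_add power2_eq_square field_simps del: of_nat_Suc)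
      finally show "(\<Sum>x\<in>?F. norm (\<mu> {x} * g x)) \<le> a j"
        using 1 by linarith
    qed
    also have "\<dots> \<le> suminf a" using F by (intro sum_le_suminf suma) (auto intro: a0)
    finally show ?thesis .
  qed
  have "(\<lambda>x. norm (\<mu> {x} * g x)) summable_on UNIV"
    using bound by (intro nonneg_bdd_above_summable_on bdd_aboveI2[where M="suminf a"]) auto
  then show ?thesis
    using abs_summable_equivalent[of "\<lambda>x. \<mu> {x} * g x" UNIV] by (simp add: abs_summable_on_def)
qed

text \<open>The Schwartz function \<open>fourier \<psi>\<close> is approached by its cutoffs, on
  which T is a finite sum over atoms. Continuity of T gives one limit, dominated convergence with
  the absolutely convergent series as majorant gives the other.\<close>

lemma fourier_measure_sum:
  fixes \<mu> \<sigma> :: "'a::euclidean_space set \<Rightarrow> complex"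
  assumes \<mu>: "complex_radon \<mu>" "discrete_measure \<mu>" and tv: "temperate_variation \<mu>"
    and F: "is_fourier_measure \<mu> \<sigma>" and \<psi>: "\<psi> \<in> test_functions"
  shows "integrable (count_space UNIV) (\<lambda>x. \<mu> {x} * fourier \<psi> x)"
    and "radon_integral \<sigma> \<psi> = (LINT x|count_space UNIV. \<mu> {x} * fourier \<psi> x)"
proof -
  show int: "integrable (count_space UNIV) (\<lambda>x. \<mu> {x} * fourier \<psi> x)"
    by (rule integrable_masses_mult_rapidly_decreasing[OF \<mu> tv fourier_decay[OF \<psi>]])
  obtain T where T: "temperate T" "\<And>f. f \<in> test_functions \<Longrightarrow> T f = radon_integral \<mu> f"
    "\<And>f. f \<in> test_functions \<Longrightarrow> fourier_distr T f = radon_integral \<sigma> f"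
    using F by (auto simp: is_fourier_measure_def temperate_ext_def)
  have sm: "smooth_fun (fourier \<psi>)" by (intro schwartz_smooth fourier_test_schwartz \<psi>)
  have Tk: "T (\<lambda>x. cutoff k x * fourier \<psi> x) = (LINT x|count_space UNIV. \<mu> {x} * (cutoff k x * fourier \<psi> x))" for k
  proof -
    let ?K = "cball (0::'a) (real (Suc k))"
    let ?h = "\<lambda>x. cutoff k x * fourier \<psi> x"
    have h: "?h \<in> test_functions" by (intro test_functions_mult cutoff_test sm)
    have h0: "?h x = 0" if "x \<notin> ?K" for x using that cutoff_eq_0[of k x] by (simp del: of_nat_Suc)
    have supp: "x \<in> msupp \<mu> \<inter> ?K" if "\<mu> {x} * ?h x \<noteq> 0" for x
      using that h0[of x] complex_radon_point_outside[OF \<mu>, of x] by fastforce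
    have fin: "finite (msupp \<mu> \<inter> ?K)" by (rule discrete_measure_locally_finite[OF \<mu>(2)]) simp
    have "T ?h = (\<Sum>x\<in>msupp \<mu> \<inter> ?K. \<mu> {x} * ?h x)"
      unfolding T(2)[OF h]
    proof (rule radon_integral_discrete[OF \<mu>])
      show "?h \<in> borel_measurable borel"
        by (intro borel_measurable_continuous_onI smooth_fun_continuous test_functions_smooth h)
    qed (use h0 in auto)
    also have "\<dots> = (\<Sum>x | x \<in> UNIV \<and> \<mu> {x} * ?h x \<noteq> 0. \<mu> {x} * ?h x)"
      using supp by (intro sum.mono_neutral_right fin) blast+
    also have "\<dots> = (LINT x|count_space UNIV. \<mu> {x} * ?h x)"
      using supp
      by (intro lebesgue_integral_count_space_finite_support[symmetric] finite_subset[OF _ fin]) blast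
    finally show ?thesis .
  qed
  have "(\<lambda>k. T (\<lambda>x. cutoff k x * fourier \<psi> x)) \<longlonglongrightarrow> T (fourier \<psi>)"
    by (rule temperate_cutoff_tendsto[OF T(1) fourier_test_schwartz[OF \<psi>]])
  moreover have "(\<lambda>k. T (\<lambda>x. cutoff k x * fourier \<psi> x)) \<longlonglongrightarrow> (LINT x|count_space UNIV. \<mu> {x} * fourier \<psi> x)"
    unfolding Tk
  proof (rule integral_dominated_convergence[where w="\<lambda>x. norm (\<mu> {x} * fourier \<psi> x)"])
    show "integrable (count_space UNIV) (\<lambda>x. norm (\<mu> {x} * fourier \<psi> x))" using int by simp
    have "(\<lambda>k. \<mu> {x} * (cutoff k x * fourier \<psi> x)) \<longlonglongrightarrow> \<mu> {x} * (1 * fourier \<psi> x)" for x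
      by (intro tendsto_intros cutoff_tendsto_1)
    then show "AE x in count_space UNIV. (\<lambda>k. \<mu> {x} * (cutoff k x * fourier \<psi> x)) \<longlonglongrightarrow> \<mu> {x} * fourier \<psi> x"
      by simp
    fix k
    have "norm (\<mu> {x} * (cutoff k x * fourier \<psi> x)) \<le> norm (\<mu> {x} * fourier \<psi> x)" for x
      using mult_right_mono[OF norm_cutoff_le[of k x], of "norm (\<mu> {x} * fourier \<psi> x)"]
      by (simp add: norm_mult mult_ac)
    then show "AE x in count_space UNIV. norm (\<mu> {x} * (cutoff k x * fourier \<psi> x)) \<le> norm (\<mu> {x} * fourier \<psi> x)"
      by simp
  qed auto
  ultimately have "T (fourier \<psi>) = (LINT x|count_space UNIV. \<mu> {x} * fourier \<psi> x)"
    by (rule LIMSEQ_unique)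
  then show "radon_integral \<sigma> \<psi> = (LINT x|count_space UNIV. \<mu> {x} * fourier \<psi> x)"
    using T(3)[OF \<psi>] by (simp add: fourier_distr_def)
qed

section \<open>Recurrence and uniqueness for almost periodic series\<close>

definition ap_series :: "('a::euclidean_space \<Rightarrow> complex) \<Rightarrow> 'a \<Rightarrow> complex" where
  "ap_series c t = (LINT x|count_space UNIV. c x * chr (t \<bullet> x))"

lemma integrable_count_space_mult_bounded:
  fixes c u :: "'a \<Rightarrow> complex"
  assumes "integrable (count_space UNIV) c" "\<And>x. norm (u x) \<le> 1"
  shows "integrable (count_space UNIV) (\<lambda>x. c x * u x)"
proof (rule Bochner_Integration.integrable_bound[OF assms(1)])
  have "norm (c x * u x) \<le> norm (c x)" for x
    using mult_left_mono[OF assms(2)[of x], of "norm (c x)"] by (simp add: norm_mult)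
  then show "AE x in count_space UNIV. norm (c x * u x) \<le> norm (c x)" by simp
qed simp

text \<open>Convergence is asked only on a set S outside which c vanishes; when S is countable, it
  can be arranged by passing to a subsequence.\<close>

lemma count_space_dominated_convergence:
  fixes c :: "'a \<Rightarrow> complex"
  assumes c: "integrable (count_space UNIV) c" "\<And>x. x \<notin> S \<Longrightarrow> c x = 0"
    and u: "\<And>k x. norm (u k x) \<le> 1" "\<And>x. x \<in> S \<Longrightarrow> (\<lambda>k. u k x) \<longlonglongrightarrow> v x"
  shows "(\<lambda>k. LINT x|count_space UNIV. c x * u k x) \<longlonglongrightarrow> (LINT x|count_space UNIV. c x * v x)"
proof (rule integral_dominated_convergence[where w="\<lambda>x. norm (c x)"])
  have "(\<lambda>k. c x * u k x) \<longlonglongrightarrow> c x * v x" for x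
    using u(2) c(2) by (cases "x \<in> S") (auto intro: tendsto_intros)
  then show "AE x in count_space UNIV. (\<lambda>k. c x * u k x) \<longlonglongrightarrow> c x * v x" by simp
  fix k
  have "norm (c x * u k x) \<le> norm (c x)" for x
    using mult_left_mono[OF u(1), of "norm (c x)"] by (simp add: norm_mult)
  then show "AE x in count_space UNIV. norm (c x * u k x) \<le> norm (c x)" by simp
qed (use c in auto)

text \<open>Diagonal selection on a countable set of frequencies. The limit \<xi> need not come from
  a point of the space, but it has modulus 1, so its conjugate inverts it.\<close>

lemma characters_convergent_subsequence:
  fixes s :: "nat \<Rightarrow> 'a::euclidean_space"
  assumes "countable S"
  obtains r \<xi> where "strict_mono r" "\<And>x. x \<in> S \<Longrightarrow> (\<lambda>k. chr (s (r k) \<bullet> x)) \<longlonglongrightarrow> \<xi> x"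
    "\<And>x. x \<in> S \<Longrightarrow> \<xi> x * cnj (\<xi> x) = 1"
proof -
  obtain r where r: "strict_mono r" "\<And>x. x \<in> S \<Longrightarrow> \<exists>l. (\<lambda>k. chr (s (r k) \<bullet> x)) \<longlonglongrightarrow> l"
    using function_convergent_subsequence[OF assms, of "\<lambda>k x. chr (s k \<bullet> x)" 1] by auto
  then obtain \<xi> where \<xi>: "\<And>x. x \<in> S \<Longrightarrow> (\<lambda>k. chr (s (r k) \<bullet> x)) \<longlonglongrightarrow> \<xi> x" by metis
  have "\<xi> x * cnj (\<xi> x) = 1" if "x \<in> S" for x
  proof -
    have "(\<lambda>k. norm (chr (s (r k) \<bullet> x))) \<longlonglongrightarrow> norm (\<xi> x)" using \<xi>[OF that] by (rule tendsto_norm)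
    then have "norm (\<xi> x) = 1" by (simp add: LIMSEQ_const_iff)
    then show ?thesis by (simp add: complex_norm_square[symmetric])
  qed
  with r(1) \<xi> show ?thesis using that by blast
qed

text \<open>If all characters converge along a sequence, then at differences of two far terms they
  tend to \<open>\<xi> x * cnj (\<xi> x) = 1\<close>. The terms are integer multiples of a unit
  vector, and the indices 2k and k of a strictly increasing selection make the difference at least
  k.\<close>

lemma simultaneous_recurrence:
  fixes S :: "'a::euclidean_space set"
  assumes "countable S"
  obtains \<tau> :: "nat \<Rightarrow> 'a" where "filterlim (\<lambda>k. norm (\<tau> k)) at_top sequentially"
    "\<And>x. x \<in> S \<Longrightarrow> (\<lambda>k. chr (\<tau> k \<bullet> x)) \<longlonglongrightarrow> 1"
proof -
  obtain e :: 'a where e: "norm e = 1" using vector_choose_size[of 1] by auto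
  define s where "s k = real k *\<^sub>R e" for k
  obtain r \<xi> where r: "strict_mono r" and \<xi>: "\<And>x. x \<in> S \<Longrightarrow> (\<lambda>k. chr (s (r k) \<bullet> x)) \<longlonglongrightarrow> \<xi> x"
    "\<And>x. x \<in> S \<Longrightarrow> \<xi> x * cnj (\<xi> x) = 1"
    using characters_convergent_subsequence[OF assms, of s] by blast
  define \<tau> where "\<tau> k = s (r (2 * k)) - s (r k)" for k
  show ?thesis
  proof (rule that[of \<tau>])
    have "real k \<le> norm (\<tau> k)" for k
    proof -
      have "r k + m \<le> r (k + m)" for m
      proof (induction m)
        case (Suc m)
        then show ?case using strict_monoD[OF r, of "k + m" "k + Suc m"] by simp
      qed simp
      from this[of k] have "real (r k) + real k \<le> real (r (2 * k))"
        by (metis mult_2 of_nat_add of_nat_le_iff)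
      moreover have "\<tau> k = (real (r (2 * k)) - real (r k)) *\<^sub>R e"
        by (simp add: \<tau>_def s_def scaleR_diff_left)
      ultimately show ?thesis using e by simp
    qed
    then show "filterlim (\<lambda>k. norm (\<tau> k)) at_top sequentially"
      by (intro filterlim_at_top_mono[OF filterlim_real_sequentially]) auto
    fix x assume x: "x \<in> S"
    have "strict_mono (\<lambda>k::nat. 2 * k)" by (simp add: strict_mono_def)
    from LIMSEQ_subseq_LIMSEQ[OF \<xi>(1)[OF x] this]
    have "(\<lambda>k. chr (s (r (2 * k)) \<bullet> x) * cnj (chr (s (r k) \<bullet> x))) \<longlonglongrightarrow> \<xi> x * cnj (\<xi> x)"
      by (intro tendsto_intros \<xi>(1)[OF x]) (simp add: o_def)
    moreover have "chr (s (r (2 * k)) \<bullet> x) * cnj (chr (s (r k) \<bullet> x)) = chr (\<tau> k \<bullet> x)" for k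
      by (simp add: \<tau>_def chr_minus[symmetric] chr_add[symmetric] inner_diff_left)
    ultimately show "(\<lambda>k. chr (\<tau> k \<bullet> x)) \<longlonglongrightarrow> 1" using \<xi>(2)[OF x] by simp
  qed
qed

lemma ap_series_recurrence:
  assumes c: "integrable (count_space UNIV) c" "\<And>x. x \<notin> S \<Longrightarrow> c x = 0"
    and \<tau>: "\<And>x. x \<in> S \<Longrightarrow> (\<lambda>k. chr (\<tau> k \<bullet> x)) \<longlonglongrightarrow> 1"
  shows "(\<lambda>k. ap_series c (\<tau> k)) \<longlonglongrightarrow> ap_series c 0"
  unfolding ap_series_def by (rule count_space_dominated_convergence[OF c]) (use \<tau> in auto)

text \<open>Along a subsequence the characters converge at the centres \<open>y k\<close> of the balls, and the double
  limit of \<open>ap_series c (t - y j + y k)\<close>, first in \<open>k\<close> and then in \<open>j\<close>, recovers \<open>ap_series c t\<close>.\<close>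

lemma ap_series_eq_0_if_large_balls:
  fixes c :: "'a::euclidean_space \<Rightarrow> complex"
  assumes c: "integrable (count_space UNIV) c" "countable S" "\<And>x. x \<notin> S \<Longrightarrow> c x = 0"
    and y: "\<And>k t. norm (t - y k) \<le> real k \<Longrightarrow> ap_series c t = 0"
  shows "ap_series c t = 0"
proof -
  obtain r \<xi> where r: "strict_mono r" and \<xi>: "\<And>x. x \<in> S \<Longrightarrow> (\<lambda>k. chr (y (r k) \<bullet> x)) \<longlonglongrightarrow> \<xi> x"
    "\<And>x. x \<in> S \<Longrightarrow> \<xi> x * cnj (\<xi> x) = 1"
    using characters_convergent_subsequence[OF c(2), of y] by blast
  have G: "(LINT x|count_space UNIV. c x * (chr ((t - y (r j)) \<bullet> x) * \<xi> x)) = 0" for j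
  proof -
    have "(\<lambda>k. LINT x|count_space UNIV. c x * (chr ((t - y (r j)) \<bullet> x) * chr (y (r k) \<bullet> x)))
       \<longlonglongrightarrow> (LINT x|count_space UNIV. c x * (chr ((t - y (r j)) \<bullet> x) * \<xi> x))"
      using c \<xi>(1) by (intro count_space_dominated_convergence[where S=S]) (auto simp: norm_mult intro!: tendsto_intros)
    moreover have "\<forall>\<^sub>F k in sequentially. (LINT x|count_space UNIV. c x * (chr ((t - y (r j)) \<bullet> x) * chr (y (r k) \<bullet> x))) = 0"
    proof -
      \<comment> \<open>While t and j are fixed and k grows, the radius of the ball around
        \<open>y (r k)\<close> eventually exceeds the offset \<open>t - y (r j)\<close>, since
        \<open>r k \<ge> k\<close>.\<close>
      obtain K where K: "norm (t - y (r j)) \<le> real K" using real_arch_simple by blast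
      have "(LINT x|count_space UNIV. c x * (chr ((t - y (r j)) \<bullet> x) * chr (y (r k) \<bullet> x))) = 0" if "k \<ge> K" for k
      proof -
        have "(LINT x|count_space UNIV. c x * (chr ((t - y (r j)) \<bullet> x) * chr (y (r k) \<bullet> x))) = ap_series c (t - y (r j) + y (r k))"
          by (simp add: ap_series_def chr_add[symmetric] inner_add_left inner_diff_left)
        also have "\<dots> = 0"
        proof (rule y)
          have "K \<le> r k" using that strict_mono_imp_increasing[OF r, of k] by simp
          then show "norm (t - y (r j) + y (r k) - y (r k)) \<le> real (r k)" using K by simp
        qed
        finally show ?thesis .
      qed
      then show ?thesis by (auto simp: eventually_sequentially)
    qed
    then have "(\<lambda>k. LINT x|count_space UNIV. c x * (chr ((t - y (r j)) \<bullet> x) * chr (y (r k) \<bullet> x))) \<longlonglongrightarrow> 0"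
      by (rule tendsto_eventually)
    ultimately show ?thesis by (rule LIMSEQ_unique)
  qed
  have nchi: "norm (\<xi> x) = 1" if "x \<in> S" for x
    using \<xi>(2)[OF that] by (metis complex_mod_mult_cnj norm_one power2_eq_1_iff norm_ge_zero
        abs_norm_cancel abs_square_eq_1)
  \<comment> \<open>Nothing is known about \<xi> off S. The value 0 there gives the global bound 1
    that dominated convergence asks for, and changes no integral because c vanishes off S.\<close>
  define \<xi>' where "\<xi>' x = (if x \<in> S then \<xi> x else 0)" for x
  have "(\<lambda>j. LINT x|count_space UNIV. c x * (chr ((t - y (r j)) \<bullet> x) * \<xi>' x))
      \<longlonglongrightarrow> (LINT x|count_space UNIV. c x * chr (t \<bullet> x))"
  proof (rule count_space_dominated_convergence[where S=S])
    show "norm (chr ((t - y (r j)) \<bullet> x) * \<xi>' x) \<le> 1" for j x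
      using nchi by (auto simp: norm_mult \<xi>'_def)
    fix x assume x: "x \<in> S"
    have "(\<lambda>j. chr (t \<bullet> x) * cnj (chr (y (r j) \<bullet> x)) * \<xi> x) \<longlonglongrightarrow> chr (t \<bullet> x) * cnj (\<xi> x) * \<xi> x"
      by (intro tendsto_intros \<xi>(1)[OF x])
    moreover have "chr (t \<bullet> x) * cnj (\<xi> x) * \<xi> x = chr (t \<bullet> x)"
      using \<xi>(2)[OF x] by (simp add: mult.assoc mult.commute)
    moreover have "chr (t \<bullet> x) * cnj (chr (y (r j) \<bullet> x)) * \<xi> x = chr ((t - y (r j)) \<bullet> x) * \<xi>' x" for j
      using x by (simp add: chr_minus[symmetric] chr_add[symmetric] inner_diff_left \<xi>'_def)
    ultimately show "(\<lambda>j. chr ((t - y (r j)) \<bullet> x) * \<xi>' x) \<longlonglongrightarrow> chr (t \<bullet> x)" by simp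
  qed (use c in auto)
  moreover have "(\<lambda>x. c x * (chr ((t - y (r j)) \<bullet> x) * \<xi>' x)) = (\<lambda>x. c x * (chr ((t - y (r j)) \<bullet> x) * \<xi> x))" for j
    using c(3) by (auto simp: \<xi>'_def)
  ultimately have "(\<lambda>j::nat. 0) \<longlonglongrightarrow> ap_series c t" by (simp add: G ap_series_def)
  then show ?thesis by (simp add: LIMSEQ_const_iff)
qed

text \<open>The bad u lie on the hyperplanes v . u = n, countably many and genuine since v is
  nonzero; a countable union of null sets is not the whole space. Applied to differences of
  frequencies, this separates one frequency from all others modulo 1.\<close>

lemma generic_direction:
  fixes V :: "'a::euclidean_space set"
  assumes "countable V" "0 \<notin> V"
  obtains u where "\<And>v. v \<in> V \<Longrightarrow> v \<bullet> u \<notin> \<int>"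
proof -
  let ?\<F> = "(\<lambda>(v, n). {u. v \<bullet> u = of_int n}) ` (V \<times> (UNIV :: int set))"
  have "negligible (\<Union>?\<F>)"
  proof (rule negligible_countable_Union)
    show "countable ?\<F>" using assms(1) by (intro countable_image countable_SIGMA) auto
    show "negligible A" if "A \<in> ?\<F>" for A
      using that assms(2) by (force intro: negligible_hyperplane)
  qed
  then have "\<Union>?\<F> \<noteq> UNIV" using non_negligible_UNIV by metis
  then obtain u where u: "u \<notin> \<Union>?\<F>" by blast
  have "v \<bullet> u \<notin> \<int>" if "v \<in> V" for v
    using u that by (auto elim!: Ints_cases)
  then show ?thesis using that by blast
qed

lemma chr_eq_1_imp: "chr t = 1 \<Longrightarrow> t \<in> \<int>"
proof -
  assume "chr t = 1"
  then have "cos (2 * pi * t) = 1" by (simp add: chr_def complex_eq_iff)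
  then obtain n :: int where "2 * pi * t = n * 2 * pi" using cos_one_2pi_int by auto
  then have "t = n" by simp
  then show "t \<in> \<int>" by simp
qed

lemma chr_power: "chr t ^ n = chr (real n * t)"
  by (induction n) (simp_all add: chr_add[symmetric] algebra_simps)

lemma chr_mean_tendsto:
  assumes "t \<notin> \<int>"
  shows "(\<lambda>N. (\<Sum>k<N. chr (real k * t)) / of_nat N) \<longlonglongrightarrow> 0"
proof (rule Lim_null_comparison)
  have ne: "chr t \<noteq> 1" using chr_eq_1_imp assms by blast
  have "norm ((\<Sum>k<N. chr (real k * t)) / of_nat N) \<le> 2 / norm (chr t - 1) * inverse (real N)" for N
  proof -
    have "(\<Sum>k<N. chr (real k * t)) = (chr t ^ N - 1) / (chr t - 1)"
      using geometric_sum[OF ne, of N] by (simp add: chr_power)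
    also have "norm \<dots> \<le> 2 / norm (chr t - 1)"
      using norm_triangle_ineq4[of "chr t ^ N" 1] by (simp add: norm_divide divide_right_mono norm_power)
    finally have "norm (\<Sum>k<N. chr (real k * t)) / real N \<le> 2 / norm (chr t - 1) / real N"
      by (rule divide_right_mono) simp
    then show ?thesis by (simp add: norm_mult norm_inverse divide_inverse)
  qed
  then show "\<forall>\<^sub>F N in sequentially. norm ((\<Sum>k<N. chr (real k * t)) / of_nat N) \<le> 2 / norm (chr t - 1) * inverse (real N)"
    by simp
  show "(\<lambda>N. 2 / norm (chr t - 1) * inverse (real N)) \<longlonglongrightarrow> 0"
    by (intro tendsto_mult_right_zero lim_inverse_n)
qed

text \<open>Cesaro means along the multiples of one generic vector u do the work of a mean over the
  whole space. After a twist by -z they tend to 1 at the frequency z and, as bounded geometric sums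
  divided by N, to 0 at every other one, so dominated convergence isolates the coefficient of
  z.\<close>

lemma ap_series_coefficients_unique:
  fixes c :: "'a::euclidean_space \<Rightarrow> complex"
  assumes c: "integrable (count_space UNIV) c" "countable S" "\<And>x. x \<notin> S \<Longrightarrow> c x = 0"
    and 0: "\<And>t. ap_series c t = 0"
  shows "c z = 0"
proof -
  obtain u where u: "\<And>v. v \<in> (\<lambda>x. x - z) ` (S - {z}) \<Longrightarrow> v \<bullet> u \<notin> \<int>"
  proof (rule generic_direction)
    show "countable ((\<lambda>x. x - z) ` (S - {z}))" using c(2) by simp
  qed auto
  define D where "D N x = (\<Sum>k<N. chr (real k * ((x - z) \<bullet> u))) / of_nat N" for N x
  have int: "integrable (count_space UNIV) (\<lambda>x. c x * chr (s x))" for s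
    by (rule integrable_count_space_mult_bounded[OF c(1)]) simp
  have 1: "(LINT x|count_space UNIV. c x * chr (real k * ((x - z) \<bullet> u))) = 0" for k
  proof -
    have "(LINT x|count_space UNIV. c x * chr (real k * ((x - z) \<bullet> u))) =
       (LINT x|count_space UNIV. c x * chr ((real k *\<^sub>R u) \<bullet> x) * chr (- (real k * (z \<bullet> u))))"
      by (simp add: mult.assoc chr_add[symmetric] inner_diff_left inner_commute algebra_simps)
    also have "\<dots> = ap_series c (real k *\<^sub>R u) * chr (- (real k * (z \<bullet> u)))"
      unfolding ap_series_def by (intro Bochner_Integration.integral_mult_left int)
    finally show ?thesis by (simp add: 0)
  qed
  have 2: "(LINT x|count_space UNIV. c x * D N x) = 0" for N
  proof -
    have "(\<lambda>x. c x * D N x) = (\<lambda>x. (\<Sum>k<N. c x * chr (real k * ((x - z) \<bullet> u))) / of_nat N)"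
      by (simp add: D_def sum_distrib_left)
    then show ?thesis using int by (simp add: Bochner_Integration.integral_sum 1)
  qed
  have "(\<lambda>N. LINT x|count_space UNIV. c x * D N x) \<longlonglongrightarrow> (LINT x|count_space UNIV. c x * of_bool (x = z))"
  proof (rule count_space_dominated_convergence[OF c(1,3)])
    show "norm (D N x) \<le> 1" for N x
    proof -
      have "norm (\<Sum>k<N. chr (real k * ((x - z) \<bullet> u))) \<le> (\<Sum>k<N. 1)" by (rule sum_norm_le) simp
      then show ?thesis by (auto simp add: D_def norm_divide divide_le_eq_1)
    qed
    fix x assume x: "x \<in> S"
    show "(\<lambda>N. D N x) \<longlonglongrightarrow> of_bool (x = z)"
    proof (cases "x = z")
      case True
      have "\<forall>\<^sub>F N in sequentially. D N x = 1"
        using eventually_gt_at_top[of 0] by eventually_elim (simp add: D_def True)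
      then show ?thesis using True by (simp add: tendsto_eventually)
    next
      case False
      then have "(x - z) \<bullet> u \<notin> \<int>" using u x by blast
      from chr_mean_tendsto[OF this] False show ?thesis by (simp add: D_def)
    qed
  qed
  then have "(LINT x|count_space UNIV. c x * of_bool (x = z)) = 0"
    by (simp add: 2 LIMSEQ_const_iff)
  moreover have "(LINT x|count_space UNIV. c x * of_bool (x = z)) = (\<Sum>x | x \<in> UNIV \<and> c x * of_bool (x = z) \<noteq> 0. c x * of_bool (x = z))"
    by (rule lebesgue_integral_count_space_finite_support) (auto intro: finite_subset[of _ "{z}"])
  moreover have "\<dots> = (\<Sum>x\<in>{z}. c x * of_bool (x = z))"
    by (rule sum.mono_neutral_left) auto
  ultimately show ?thesis by simp
qed

section \<open>Balls with maximally many points\<close>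

text \<open>Compactness covers one ball of radius R by finitely many unit balls; translating this
  cover makes the bound independent of the centre.\<close>

lemma card_ball_uniformly_bounded:
  fixes \<Gamma> :: "'a::euclidean_space set" and C :: nat
  assumes C: "\<And>y. finite (\<Gamma> \<inter> ball y 1) \<and> card (\<Gamma> \<inter> ball y 1) \<le> C"
  shows "\<exists>B. \<forall>y. card (\<Gamma> \<inter> ball y R) \<le> B"
proof -
  have "compact (cball (0::'a) R)" by simp
  then obtain P where P: "finite P" "cball (0::'a) R \<subseteq> (\<Union>p\<in>P. ball p 1)"
    unfolding compact_eq_totally_bounded by (metis zero_less_one)
  have "card (\<Gamma> \<inter> ball y R) \<le> card P * C" for y
  proof -
    have "\<Gamma> \<inter> ball y R \<subseteq> (\<Union>p\<in>P. \<Gamma> \<inter> ball (y + p) 1)"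
    proof
      fix x assume x: "x \<in> \<Gamma> \<inter> ball y R"
      then have "x - y \<in> cball 0 R" by (simp add: dist_norm norm_minus_commute)
      then obtain p where "p \<in> P" "x - y \<in> ball p 1" using P by blast
      then show "x \<in> (\<Union>p\<in>P. \<Gamma> \<inter> ball (y + p) 1)"
        using x by (auto simp: dist_norm algebra_simps intro!: bexI[of _ p])
    qed
    then have "card (\<Gamma> \<inter> ball y R) \<le> card (\<Union>p\<in>P. \<Gamma> \<inter> ball (y + p) 1)"
      using C P(1) by (intro card_mono finite_UN_I) auto
    also have "\<dots> \<le> (\<Sum>p\<in>P. card (\<Gamma> \<inter> ball (y + p) 1))" by (rule card_UN_le[OF P(1)])
    also have "\<dots> \<le> (\<Sum>p\<in>P. C)" using C by (intro sum_mono) auto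
    finally show ?thesis by simp
  qed
  then show ?thesis by blast
qed

lemma maximal_ball_exists:
  fixes \<Gamma> :: "'a::euclidean_space set" and C :: nat
  assumes C: "\<And>y. finite (\<Gamma> \<inter> ball y 1) \<and> card (\<Gamma> \<inter> ball y 1) \<le> C"
  obtains y where "\<And>z. card (\<Gamma> \<inter> ball z R) \<le> card (\<Gamma> \<inter> ball y R)"
proof -
  obtain B where "\<And>y. card (\<Gamma> \<inter> ball y R) \<le> B" using card_ball_uniformly_bounded[OF C] by blast
  then have "\<forall>y. card (\<Gamma> \<inter> ball y R) < Suc B" by (simp add: less_Suc_eq_le)
  then have "\<exists>y. \<forall>z. card (\<Gamma> \<inter> ball z R) \<le> card (\<Gamma> \<inter> ball y R)"
    using ex_has_greatest_nat[of "\<lambda>_. True" undefined "\<lambda>y. card (\<Gamma> \<inter> ball y R)" "Suc B"] by simp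
  then obtain y where "\<forall>z. card (\<Gamma> \<inter> ball z R) \<le> card (\<Gamma> \<inter> ball y R)" ..
  then show ?thesis by (intro that[of y]) simp
qed

text \<open>Masses along almost periods may be unbounded in general, since several points can merge in the
  limit. In a ball with the maximal number of points this cannot happen: each point of the ball
  already produces a point nearby in the translated ball, which leaves no room for a second one.\<close>

lemma masses_bounded_along_almost_periods:
  fixes \<sigma> :: "'a::euclidean_space set \<Rightarrow> complex"
  assumes \<sigma>: "complex_radon \<sigma>" "discrete_measure \<sigma>"
    and max: "\<And>z. card (msupp \<sigma> \<inter> ball z R) \<le> card (msupp \<sigma> \<inter> ball y R)"
    and conv: "\<And>\<psi>. \<psi> \<in> test_functions \<Longrightarrow>
      (\<lambda>k. radon_integral \<sigma> (\<lambda>x. \<psi> (x - \<tau> k))) \<longlonglongrightarrow> radon_integral \<sigma> \<psi>"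
  obtains K where "K > 0" "\<forall>\<^sub>F k in sequentially. \<forall>p\<in>msupp \<sigma> \<inter> ball (y + \<tau> k) R. cmod (\<sigma> {p}) \<le> K"
proof -
  define G where "G = msupp \<sigma> \<inter> ball y R"
  have finG: "finite G" unfolding G_def by (rule discrete_measure_locally_finite[OF \<sigma>(2)]) simp
  have lf: "finite (msupp \<sigma> \<inter> ball z r)" for z r by (rule discrete_measure_locally_finite[OF \<sigma>(2)]) simp
  have "\<exists>\<rho>>0. ball g \<rho> \<subseteq> ball y R \<and> (\<forall>h\<in>G. h \<noteq> g \<longrightarrow> 2 * \<rho> \<le> dist g h)" if g: "g \<in> G" for g
  proof -
    obtain a where a: "a > 0" "ball g a \<subseteq> ball y R"
      using g open_ball[of y R] unfolding G_def open_contains_ball by blast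
    obtain b where b: "b > 0" "\<forall>h\<in>G. h \<noteq> g \<longrightarrow> b \<le> dist g h"
      using finite_set_avoid[OF finG, of g] by blast
    show ?thesis
      using a b by (intro exI[of _ "min a (b / 2)"]) (auto intro: subset_ball[THEN order_trans])
  qed
  then obtain \<rho>' where \<rho>': "\<And>g. g \<in> G \<Longrightarrow> \<rho>' g > 0" "\<And>g. g \<in> G \<Longrightarrow> ball g (\<rho>' g) \<subseteq> ball y R"
    "\<And>g h. g \<in> G \<Longrightarrow> h \<in> G \<Longrightarrow> h \<noteq> g \<Longrightarrow> 2 * \<rho>' g \<le> dist g h" by metis
  \<comment> \<open>Small enough that the \<rho>-balls around the points of G are disjoint and stay
    inside the maximal ball; \<open>insert 1\<close> covers the case of an empty G.\<close>
  define \<rho> where "\<rho> = Min (insert 1 (\<rho>' ` G))"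
  have \<rho>pos: "\<rho> > 0" unfolding \<rho>_def using finG \<rho>'(1) by (subst Min_gr_iff) auto
  have \<rho>le: "\<rho> \<le> \<rho>' g" if "g \<in> G" for g unfolding \<rho>_def using finG that by (intro Min_le) auto
  have \<rho>1: "ball g \<rho> \<subseteq> ball y R" if "g \<in> G" for g
    using \<rho>'(2)[OF that] \<rho>le[OF that] subset_ball by blast
  have \<rho>2: "2 * \<rho> \<le> dist g h" if "g \<in> G" "h \<in> G" "h \<noteq> g" for g h
    using \<rho>'(3)[OF that] \<rho>le[OF that(1)] by linarith
  define \<phi> where "\<phi> r g x = complex_of_real (bump r (x - g))" for r and g x :: 'a
  have \<phi>_test: "\<phi> r g \<in> test_functions" if "r > 0" for r g
    using test_functions_affine[OF test_functions_bump[OF that], of 1 "- g"] by (simp add: \<phi>_def[abs_def])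
  have \<phi>_int: "radon_integral \<sigma> (\<lambda>x. \<phi> r g (x - t)) = (\<Sum>p\<in>msupp \<sigma> \<inter> ball (g + t) r. \<sigma> {p} * \<phi> r g (p - t))"
    if "r > 0" for r g t
  proof (rule radon_integral_discrete[OF \<sigma>])
    have "(\<lambda>x. \<phi> r g (x - t)) \<in> test_functions"
      using test_functions_affine[OF \<phi>_test[OF that, of g], of 1 "- t"] by simp
    then show "(\<lambda>x. \<phi> r g (x - t)) \<in> borel_measurable borel"
      by (intro borel_measurable_continuous_onI smooth_fun_continuous test_functions_smooth)
    show "\<phi> r g (x - t) = 0" if "x \<notin> ball (g + t) r" for x
      using that bump_eq_0[OF \<open>r > 0\<close>, of "x - t - g"]
      by (simp add: \<phi>_def dist_norm norm_minus_commute algebra_simps)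
  qed simp
  have \<phi>_0: "radon_integral \<sigma> (\<phi> r g) = \<sigma> {g} * bump r (0::'a)" if "g \<in> G" "r > 0" "r \<le> \<rho>" for r g
  proof -
    have "msupp \<sigma> \<inter> ball g r = {g}"
    proof -
      have "h = g" if h: "h \<in> msupp \<sigma>" "dist g h < r" for h
      proof (rule ccontr)
        assume "h \<noteq> g"
        have "h \<in> ball y R" using \<rho>1[OF \<open>g \<in> G\<close>] h \<open>r \<le> \<rho>\<close> by (auto simp: subset_eq)
        then have "2 * \<rho> \<le> dist g h" using \<rho>2[OF \<open>g \<in> G\<close> _ \<open>h \<noteq> g\<close>] h by (simp add: G_def)
        then show False using h \<open>r \<le> \<rho>\<close> \<rho>pos by linarith
      qed
      then show ?thesis using that by (auto simp: G_def)
    qed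
    then show ?thesis using \<phi>_int[OF \<open>r > 0\<close>, of g 0] by (simp add: \<phi>_def[abs_def])
  qed
  \<comment> \<open>The bump of radius \<rho>/2 sees the nonzero mass at g alone, so its translates
    must eventually meet the support. The halved radius makes the points found distinct and keeps
    them where the bump of radius \<rho> is bounded below.\<close>
  have near: "\<forall>\<^sub>F k in sequentially. \<exists>p\<in>msupp \<sigma>. dist (g + \<tau> k) p < \<rho> / 2" if g: "g \<in> G" for g
  proof -
    have r: "\<rho> / 2 > 0" "\<rho> / 2 \<le> \<rho>" using \<rho>pos by auto
    have "radon_integral \<sigma> (\<phi> (\<rho> / 2) g) \<noteq> 0"
      using g discrete_measure_mass_nonzero[OF \<sigma>, of g] bump_pos_iff[OF r(1), of "0::'a"] r(1)
      by (simp add: \<phi>_0[OF g r] G_def)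
    then have "\<forall>\<^sub>F k in sequentially. radon_integral \<sigma> (\<lambda>x. \<phi> (\<rho> / 2) g (x - \<tau> k)) \<noteq> 0"
      using conv[OF \<phi>_test[OF r(1)]] tendsto_imp_eventually_ne by blast
    then show ?thesis
    proof eventually_elim
      case (elim k)
      then have "msupp \<sigma> \<inter> ball (g + \<tau> k) (\<rho> / 2) \<noteq> {}"
        unfolding \<phi>_int[OF r(1)] by force
      then show ?case by auto
    qed
  qed
  have bdd: "\<forall>\<^sub>F k in sequentially. cmod (radon_integral \<sigma> (\<lambda>x. \<phi> \<rho> g (x - \<tau> k))) < cmod (\<sigma> {g} * bump \<rho> (0::'a)) + 1" if g: "g \<in> G" for g
  proof (rule order_tendstoD(2))
    show "(\<lambda>k. cmod (radon_integral \<sigma> (\<lambda>x. \<phi> \<rho> g (x - \<tau> k)))) \<longlonglongrightarrow> cmod (\<sigma> {g} * bump \<rho> (0::'a))"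
      using conv[OF \<phi>_test[OF \<rho>pos], of g] \<phi>_0[OF g \<rho>pos order_refl] by (simp add: tendsto_norm)
  qed simp
  \<comment> \<open>A vector at the limiting distance \<rho>/2 of the nearby points: by radial
    monotonicity the wide bump is at least b at all of them.\<close>
  obtain e :: 'a where e: "norm e = \<rho> / 2" using vector_choose_size[of "\<rho> / 2"] \<rho>pos by auto
  define b where "b = bump \<rho> e"
  have b: "b > 0" using e \<rho>pos by (simp add: b_def bump_pos_iff)
  define K where "K = 1 + (\<Sum>g\<in>G. (cmod (\<sigma> {g} * bump \<rho> (0::'a)) + 1) / b)"
  have K_ge: "(cmod (\<sigma> {g} * bump \<rho> (0::'a)) + 1) / b \<le> K" if "g \<in> G" for g
    using member_le_sum[OF that, of "\<lambda>g. (cmod (\<sigma> {g} * bump \<rho> (0::'a)) + 1) / b"] finG b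
    by (simp add: K_def)
  have "K > 0" unfolding K_def using b by (intro add_pos_nonneg sum_nonneg) auto
  moreover have "\<forall>\<^sub>F k in sequentially. \<forall>g\<in>G. (\<exists>p\<in>msupp \<sigma>. dist (g + \<tau> k) p < \<rho> / 2) \<and>
      cmod (radon_integral \<sigma> (\<lambda>x. \<phi> \<rho> g (x - \<tau> k))) < cmod (\<sigma> {g} * bump \<rho> (0::'a)) + 1"
    using finG near bdd by (intro eventually_ball_finite ballI eventually_conj) auto
  then have "\<forall>\<^sub>F k in sequentially. \<forall>p\<in>msupp \<sigma> \<inter> ball (y + \<tau> k) R. cmod (\<sigma> {p}) \<le> K"
  proof eventually_elim
    case (elim k)
    then obtain P where P: "\<And>g. g \<in> G \<Longrightarrow> P g \<in> msupp \<sigma>" "\<And>g. g \<in> G \<Longrightarrow> dist (g + \<tau> k) (P g) < \<rho> / 2"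
      by metis
    have inj: "inj_on P G"
    proof (rule inj_onI, rule ccontr)
      fix g h assume gh: "g \<in> G" "h \<in> G" "P g = P h" "g \<noteq> h"
      have "dist g h = dist (g + \<tau> k) (h + \<tau> k)" by (simp add: dist_norm)
      also have "\<dots> \<le> dist (g + \<tau> k) (P g) + dist (h + \<tau> k) (P h)"
        using dist_triangle2[of "g + \<tau> k" "h + \<tau> k" "P g"] gh(3) by simp
      also have "\<dots> < \<rho>" using P(2)[OF gh(1)] P(2)[OF gh(2)] by linarith
      finally show False using \<rho>2[of g h] gh \<rho>pos by auto
    qed
    have sub: "P ` G \<subseteq> msupp \<sigma> \<inter> ball (y + \<tau> k) R"
    proof
      fix q assume "q \<in> P ` G"
      then obtain g where g: "g \<in> G" "q = P g" by blast
      have "q - \<tau> k \<in> ball g \<rho>"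
        using P(2)[OF g(1)] g(2) \<rho>pos by (simp add: dist_norm algebra_simps)
      then have "q - \<tau> k \<in> ball y R" using \<rho>1[OF g(1)] by blast
      then show "q \<in> msupp \<sigma> \<inter> ball (y + \<tau> k) R"
        using P(1)[OF g(1)] g(2) by (simp add: dist_norm algebra_simps)
    qed
    \<comment> \<open>Maximality enters here: the injective image of G already has as many points as
      the translated ball may contain.\<close>
    have eq: "P ` G = msupp \<sigma> \<inter> ball (y + \<tau> k) R"
      using max[of "y + \<tau> k"] card_image[OF inj] by (intro card_seteq[OF lf sub]) (simp add: G_def)
    show ?case
    proof
      fix p assume "p \<in> msupp \<sigma> \<inter> ball (y + \<tau> k) R"
      then obtain g where g: "g \<in> G" "p = P g" using eq by blast
      \<comment> \<open>A second point in this ball would be the one attached to another h, forcing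
        g and h closer than 3\<rho>/2. Hence the integral of the translated bump is a single term,
        and its bound is a bound for the mass at p.\<close>
      have "msupp \<sigma> \<inter> ball (g + \<tau> k) \<rho> = {p}"
      proof -
        have uniq: "q = p" if q: "q \<in> msupp \<sigma>" "dist (g + \<tau> k) q < \<rho>" for q
        proof -
          have "q - \<tau> k \<in> ball g \<rho>" using q by (simp add: dist_norm algebra_simps)
          then have "q - \<tau> k \<in> ball y R" using \<rho>1[OF g(1)] by blast
          then have "q \<in> msupp \<sigma> \<inter> ball (y + \<tau> k) R" using q(1) by (simp add: dist_norm algebra_simps)
          then obtain h where h: "h \<in> G" "q = P h" using eq by blast
          have "h = g"
          proof (rule ccontr)
            assume "h \<noteq> g"
            have "dist g h = dist (g + \<tau> k) (h + \<tau> k)" by (simp add: dist_norm)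
            also have "\<dots> \<le> dist (g + \<tau> k) q + dist (h + \<tau> k) (P h)"
              using dist_triangle2[of "g + \<tau> k" "h + \<tau> k" q] h(2) by simp
            also have "\<dots> < 2 * \<rho>" using q(2) P(2)[OF h(1)] \<rho>pos by linarith
            finally show False using \<rho>2[OF g(1) h(1) \<open>h \<noteq> g\<close>] by linarith
          qed
          then show ?thesis using g h by simp
        qed
        have "p \<in> msupp \<sigma>" "dist (g + \<tau> k) p < \<rho>"
          using P(1,2)[OF g(1)] g(2) \<rho>pos by simp_all
        then have "p \<in> msupp \<sigma> \<inter> ball (g + \<tau> k) \<rho>" by simp
        moreover have "q = p" if "q \<in> msupp \<sigma> \<inter> ball (g + \<tau> k) \<rho>" for q
          using uniq that by simp
        ultimately show ?thesis by blast
      qed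
      then have int: "radon_integral \<sigma> (\<lambda>x. \<phi> \<rho> g (x - \<tau> k)) = \<sigma> {p} * bump \<rho> (p - \<tau> k - g)"
        using \<phi>_int[OF \<rho>pos, of g "\<tau> k"] by (simp add: \<phi>_def)
      have "norm (p - \<tau> k - g) \<le> norm e"
        using P(2)[OF g(1)] g(2) e by (simp add: dist_norm norm_minus_commute algebra_simps)
      then have "b \<le> bump \<rho> (p - \<tau> k - g)" unfolding b_def by (rule bump_antimono)
      then have "cmod (\<sigma> {p}) * b \<le> cmod (radon_integral \<sigma> (\<lambda>x. \<phi> \<rho> g (x - \<tau> k)))"
        using b unfolding int norm_mult by (intro mult_left_mono) auto
      also have "\<dots> \<le> cmod (\<sigma> {g} * bump \<rho> (0::'a)) + 1" using elim g(1) by (meson less_imp_le)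
      finally have "cmod (\<sigma> {p}) \<le> (cmod (\<sigma> {g} * bump \<rho> (0::'a)) + 1) / b"
        using b by (simp add: pos_le_divide_eq)
      then show "cmod (\<sigma> {p}) \<le> K" using K_ge[OF g(1)] by linarith
    qed
  qed
  ultimately show ?thesis using that by blast
qed

section \<open>Comparison of two measures through their enumerations\<close>

text \<open>J may exceed the set of indices whose points meet the translated support, the extra
  terms being 0. This freedom allows two measures with different points to be summed over one index
  set.\<close>

lemma radon_integral_translate_reindex:
  fixes \<sigma> :: "'a::euclidean_space set \<Rightarrow> complex" and \<Lambda> :: "nat \<Rightarrow> 'a"
  assumes \<sigma>: "complex_radon \<sigma>" "discrete_measure \<sigma>" and \<psi>: "\<psi> \<in> test_functions"
    and supp: "\<And>x. x \<notin> cball y r \<Longrightarrow> \<psi> x = 0" and bij: "bij_betw \<Lambda> I (msupp \<sigma>)"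
    and J: "finite J" "J \<subseteq> I" "\<And>n. n \<in> I \<Longrightarrow> \<Lambda> n \<in> cball (y + t) r \<Longrightarrow> n \<in> J"
  shows "radon_integral \<sigma> (\<lambda>x. \<psi> (x - t)) = (\<Sum>n\<in>J. \<sigma> {\<Lambda> n} * \<psi> (\<Lambda> n - t))"
proof -
  have z: "\<psi> (x - t) = 0" if "x \<notin> cball (y + t) r" for x
    using that by (intro supp) (simp add: dist_norm algebra_simps)
  have inj: "inj_on \<Lambda> J" using bij J(2) by (auto simp: bij_betw_def intro: inj_on_subset)
  have "radon_integral \<sigma> (\<lambda>x. \<psi> (x - t)) = (\<Sum>x\<in>msupp \<sigma> \<inter> cball (y + t) r. \<sigma> {x} * \<psi> (x - t))"
  proof (rule radon_integral_discrete[OF \<sigma>])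
    have "(\<lambda>x. \<psi> (x - t)) \<in> test_functions"
      using test_functions_affine[OF \<psi>, of 1 "- t"] by simp
    then show "(\<lambda>x. \<psi> (x - t)) \<in> borel_measurable borel"
      by (intro borel_measurable_continuous_onI smooth_fun_continuous test_functions_smooth)
  qed (use z in auto)
  also have "\<dots> = (\<Sum>x\<in>\<Lambda> ` J. \<sigma> {x} * \<psi> (x - t))"
  proof (rule sum.mono_neutral_left)
    have "\<Lambda> ` I = msupp \<sigma>" using bij by (simp add: bij_betw_def)
    then show "msupp \<sigma> \<inter> cball (y + t) r \<subseteq> \<Lambda> ` J" using J(3) by (force simp del: mem_cball)
    show "\<forall>x\<in>\<Lambda> ` J - msupp \<sigma> \<inter> cball (y + t) r. \<sigma> {x} * \<psi> (x - t) = 0"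
    proof
      fix x assume "x \<in> \<Lambda> ` J - msupp \<sigma> \<inter> cball (y + t) r"
      moreover have "\<Lambda> ` J \<subseteq> msupp \<sigma>" using J(2) \<open>\<Lambda> ` I = msupp \<sigma>\<close> by blast
      ultimately have "x \<notin> cball (y + t) r" by blast
      then show "\<sigma> {x} * \<psi> (x - t) = 0" by (simp add: z)
    qed
  qed (use J in simp)
  also have "\<dots> = (\<Sum>n\<in>J. \<sigma> {\<Lambda> n} * \<psi> (\<Lambda> n - t))"
    by (simp add: sum.reindex[OF inj])
  finally show ?thesis .
qed

text \<open>Terms with equal index are paired: the difference of masses meets a bounded value of
  \<psi>, and the displacement, through the Lipschitz constant, meets a mass of \<theta> that stays
  bounded in translates of the maximal ball. Recurrence carries both integrals back, so smallness
  far away becomes equality.\<close>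

lemma radon_integrals_agree_on_maximal_ball:
  fixes \<sigma> \<theta> :: "'a::euclidean_space set \<Rightarrow> complex" and \<Lambda> \<gamma> :: "nat \<Rightarrow> 'a"
  assumes \<sigma>: "complex_radon \<sigma>" "discrete_measure \<sigma>" and \<theta>: "complex_radon \<theta>" "discrete_measure \<theta>"
    and max: "\<And>z. card (msupp \<theta> \<inter> ball z R) \<le> card (msupp \<theta> \<inter> ball y R)"
    and conv: "\<And>\<psi>. \<psi> \<in> test_functions \<Longrightarrow>
      (\<lambda>k. radon_integral \<sigma> (\<lambda>x. \<psi> (x - \<tau> k))) \<longlonglongrightarrow> radon_integral \<sigma> \<psi>"
      "\<And>\<psi>. \<psi> \<in> test_functions \<Longrightarrow>
      (\<lambda>k. radon_integral \<theta> (\<lambda>x. \<psi> (x - \<tau> k))) \<longlonglongrightarrow> radon_integral \<theta> \<psi>"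
    and \<tau>: "filterlim (\<lambda>k. norm (\<tau> k)) at_top sequentially"
    and bij: "bij_betw \<Lambda> I (msupp \<sigma>)" "bij_betw \<gamma> I (msupp \<theta>)"
    and lim: "(\<lambda>n. \<Lambda> n - \<gamma> n) \<longlonglongrightarrow> 0" "(\<lambda>n. \<sigma> {\<Lambda> n} - \<theta> {\<gamma> n}) \<longlonglongrightarrow> 0"
    and \<psi>: "\<psi> \<in> test_functions" "r < R" "\<And>x. x \<notin> cball y r \<Longrightarrow> \<psi> x = 0"
  shows "radon_integral \<sigma> \<psi> = radon_integral \<theta> \<psi>"
proof -
  obtain K where K: "K > 0" "\<forall>\<^sub>F k in sequentially. \<forall>p\<in>msupp \<theta> \<inter> ball (y + \<tau> k) R. cmod (\<theta> {p}) \<le> K"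
    using masses_bounded_along_almost_periods[OF \<theta> max conv(2)] by blast
  obtain M where M: "M > 0" "\<And>x. norm (\<psi> x) \<le> M" using test_functions_bound[OF \<psi>(1)] by blast
  obtain L where L: "L > 0" "\<And>x z. norm (\<psi> x - \<psi> z) \<le> L * norm (x - z)"
    using test_functions_lipschitz[OF \<psi>(1)] by blast
  define N where "N = card (msupp \<theta> \<inter> ball y R)"
  define a where "a k = radon_integral \<sigma> (\<lambda>x. \<psi> (x - \<tau> k)) - radon_integral \<theta> (\<lambda>x. \<psi> (x - \<tau> k))" for k
  have small: "\<forall>\<^sub>F k in sequentially. norm (a k) \<le> real N * (\<eta> * M + K * (L * \<eta>))" if \<eta>: "\<eta> > 0" for \<eta>
  proof -
    \<comment> \<open>The bound R - r keeps \<open>\<gamma> n\<close> in the open ball of radius R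
      whenever \<open>\<Lambda> n\<close> lies in the closed ball of radius r.\<close>
    define \<delta> where "\<delta> = min \<eta> (R - r)"
    have \<delta>: "\<delta> > 0" using \<eta> \<psi>(2) by (simp add: \<delta>_def)
    have "\<forall>\<^sub>F n in sequentially. norm (\<Lambda> n - \<gamma> n) < \<delta> \<and> norm (\<sigma> {\<Lambda> n} - \<theta> {\<gamma> n}) < \<eta>"
      using tendstoD[OF lim(1) \<delta>] tendstoD[OF lim(2) \<eta>] by eventually_elim (simp add: dist_norm)
    then obtain n0 where n0: "\<And>n. n \<ge> n0 \<Longrightarrow> norm (\<Lambda> n - \<gamma> n) < \<delta>"
      "\<And>n. n \<ge> n0 \<Longrightarrow> norm (\<sigma> {\<Lambda> n} - \<theta> {\<gamma> n}) < \<eta>" by (auto simp: eventually_sequentially)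
    \<comment> \<open>Once \<open>norm (\<tau> k)\<close> exceeds Q, the translated ball avoids the
      points with index below n0 of both enumerations, so only indices with good estimates
      contribute.\<close>
    define Q where "Q = norm y + r + (\<Sum>n<n0. norm (\<Lambda> n) + norm (\<gamma> n))"
    have "\<forall>\<^sub>F k in sequentially. norm (\<tau> k) > Q" using \<tau> by (simp add: filterlim_at_top_dense)
    with K(2) show ?thesis
    proof eventually_elim
      case (elim k)
      let ?C = "cball (y + \<tau> k) r"
      define J where "J = {n \<in> I. \<Lambda> n \<in> ?C \<or> \<gamma> n \<in> ?C}"
      have far: "z \<notin> ?C" if "norm z \<le> (\<Sum>n<n0. norm (\<Lambda> n) + norm (\<gamma> n))" for z
      proof
        assume "z \<in> ?C"
        then have "norm (y + \<tau> k - z) \<le> r" by (simp add: dist_norm)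
        moreover have "norm (\<tau> k) \<le> norm (y + \<tau> k - z) + norm (z - y)"
          using norm_triangle_ineq[of "y + \<tau> k - z" "z - y"] by simp
        moreover have "norm (z - y) \<le> norm z + norm y" by (rule norm_triangle_ineq4)
        ultimately show False using elim(2) that unfolding Q_def by linarith
      qed
      have Jn0: "n \<ge> n0" if "n \<in> J" for n
      proof (rule ccontr)
        assume "\<not> n \<ge> n0"
        then have "norm (\<Lambda> n) + norm (\<gamma> n) \<le> (\<Sum>n<n0. norm (\<Lambda> n) + norm (\<gamma> n))"
          by (intro member_le_sum) auto
        then have "norm (\<Lambda> n) \<le> (\<Sum>n<n0. norm (\<Lambda> n) + norm (\<gamma> n))"
          "norm (\<gamma> n) \<le> (\<Sum>n<n0. norm (\<Lambda> n) + norm (\<gamma> n))"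
          using norm_ge_zero[of "\<Lambda> n"] norm_ge_zero[of "\<gamma> n"] by linarith+
        then show False using far that by (auto simp: J_def)
      qed
      have \<gamma>J: "\<gamma> n \<in> msupp \<theta> \<inter> ball (y + \<tau> k) R" if n: "n \<in> J" for n
      proof -
        have close: "norm (\<Lambda> n - \<gamma> n) < R - r" using n0(1)[OF Jn0[OF n]] by (simp add: \<delta>_def)
        have "dist (y + \<tau> k) (\<gamma> n) < R"
        proof (cases "\<gamma> n \<in> ?C")
          case False
          then have "dist (y + \<tau> k) (\<Lambda> n) \<le> r" using n by (simp add: J_def)
          then show ?thesis using close dist_triangle[of "y + \<tau> k" "\<gamma> n" "\<Lambda> n"] by (simp add: dist_norm)
        qed (use \<psi>(2) in auto)
        moreover have "\<gamma> n \<in> msupp \<theta>" using n bij(2) by (auto simp: J_def bij_betw_def)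
        ultimately show ?thesis by simp
      qed
      have injJ: "inj_on \<gamma> J" using bij(2) by (auto simp: J_def bij_betw_def intro: inj_on_subset)
      have lf: "finite (msupp \<theta> \<inter> ball (y + \<tau> k) R)"
        by (rule discrete_measure_locally_finite[OF \<theta>(2)]) simp
      have finJ: "finite J"
        by (rule inj_on_finite[OF injJ _ lf]) (use \<gamma>J in blast)
      \<comment> \<open>The number of terms must be bounded independently of k: \<gamma> embeds J
        into a ball of radius R, and the maximal count applies to every centre.\<close>
      have cardJ: "card J \<le> N"
      proof -
        have "card J \<le> card (msupp \<theta> \<inter> ball (y + \<tau> k) R)"
          by (rule card_inj_on_le[OF injJ _ lf]) (use \<gamma>J in blast)
        also have "\<dots> \<le> N" unfolding N_def by (rule max)
        finally show ?thesis .
      qed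
      have "radon_integral \<sigma> (\<lambda>x. \<psi> (x - \<tau> k)) = (\<Sum>n\<in>J. \<sigma> {\<Lambda> n} * \<psi> (\<Lambda> n - \<tau> k))"
        by (rule radon_integral_translate_reindex[OF \<sigma> \<psi>(1,3) bij(1) finJ]) (auto simp: J_def)
      moreover have "radon_integral \<theta> (\<lambda>x. \<psi> (x - \<tau> k)) = (\<Sum>n\<in>J. \<theta> {\<gamma> n} * \<psi> (\<gamma> n - \<tau> k))"
        by (rule radon_integral_translate_reindex[OF \<theta> \<psi>(1,3) bij(2) finJ]) (auto simp: J_def)
      ultimately have "a k = (\<Sum>n\<in>J. \<sigma> {\<Lambda> n} * \<psi> (\<Lambda> n - \<tau> k)) - (\<Sum>n\<in>J. \<theta> {\<gamma> n} * \<psi> (\<gamma> n - \<tau> k))"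
        by (simp only: a_def)
      also have "\<dots> = (\<Sum>n\<in>J. (\<sigma> {\<Lambda> n} - \<theta> {\<gamma> n}) * \<psi> (\<Lambda> n - \<tau> k) +
          \<theta> {\<gamma> n} * (\<psi> (\<Lambda> n - \<tau> k) - \<psi> (\<gamma> n - \<tau> k)))"
        by (simp add: sum_subtractf[symmetric] algebra_simps)
      also have "norm \<dots> \<le> (\<Sum>n\<in>J. \<eta> * M + K * (L * \<eta>))"
      proof (rule sum_norm_le)
        fix n assume n: "n \<in> J"
        have "norm ((\<sigma> {\<Lambda> n} - \<theta> {\<gamma> n}) * \<psi> (\<Lambda> n - \<tau> k)) \<le> \<eta> * M"
          unfolding norm_mult using n0(2)[OF Jn0[OF n]] \<eta> by (intro mult_mono M) auto
        moreover have "norm (\<theta> {\<gamma> n} * (\<psi> (\<Lambda> n - \<tau> k) - \<psi> (\<gamma> n - \<tau> k))) \<le> K * (L * \<eta>)"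
          unfolding norm_mult
        proof (intro mult_mono)
          show "cmod (\<theta> {\<gamma> n}) \<le> K" using elim(1) \<gamma>J[OF n] by blast
          have "norm (\<psi> (\<Lambda> n - \<tau> k) - \<psi> (\<gamma> n - \<tau> k)) \<le> L * norm (\<Lambda> n - \<gamma> n)"
            using L(2)[of "\<Lambda> n - \<tau> k" "\<gamma> n - \<tau> k"] by simp
          also have "\<dots> \<le> L * \<eta>"
            using n0(1)[OF Jn0[OF n]] L(1) by (intro mult_left_mono) (auto simp: \<delta>_def)
          finally show "norm (\<psi> (\<Lambda> n - \<tau> k) - \<psi> (\<gamma> n - \<tau> k)) \<le> L * \<eta>" .
        qed (use K in auto)
        ultimately show "norm ((\<sigma> {\<Lambda> n} - \<theta> {\<gamma> n}) * \<psi> (\<Lambda> n - \<tau> k) +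
          \<theta> {\<gamma> n} * (\<psi> (\<Lambda> n - \<tau> k) - \<psi> (\<gamma> n - \<tau> k))) \<le> \<eta> * M + K * (L * \<eta>)"
          by (rule norm_triangle_mono)
      qed
      also have "\<dots> = real (card J) * (\<eta> * M + K * (L * \<eta>))" by simp
      also have "\<dots> \<le> real N * (\<eta> * M + K * (L * \<eta>))"
        using cardJ \<eta> M K L by (intro mult_right_mono) auto
      finally show ?case .
    qed
  qed
  have "a \<longlonglongrightarrow> 0"
  proof (rule tendstoI)
    fix e :: real assume e: "e > 0"
    \<comment> \<open>The added 1 keeps B positive even if N = 0 and makes the final bound (B - 1) e
      / B strictly less than e.\<close>
    define B where "B = real N * (M + K * L) + 1"
    have B: "B > 0" unfolding B_def using M K L by (intro add_nonneg_pos) auto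
    have eq: "real N * (e / B * M + K * (L * (e / B))) = (B - 1) * (e / B)"
      by (simp add: B_def algebra_simps add_divide_distrib)
    have "(B - 1) * (e / B) < e" using B e by (simp add: field_simps)
    with small[of "e / B"] e B show "\<forall>\<^sub>F k in sequentially. dist (a k) 0 < e"
      unfolding eq by (auto elim!: eventually_mono)
  qed
  moreover have "a \<longlonglongrightarrow> radon_integral \<sigma> \<psi> - radon_integral \<theta> \<psi>"
    unfolding a_def by (intro tendsto_diff conv \<psi>(1))
  ultimately show ?thesis using LIMSEQ_unique by fastforce
qed

section \<open>Vanishing of the difference and equality of the masses\<close>

lemma locally_finite_countable:
  fixes S :: "'a::euclidean_space set"
  assumes "\<And>B. bounded B \<Longrightarrow> finite (S \<inter> B)"
  shows "countable S"
proof -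
  have "S \<subseteq> (\<Union>n. S \<inter> cball 0 (real n))"
  proof
    fix x assume "x \<in> S"
    then show "x \<in> (\<Union>n. S \<inter> cball 0 (real n))" using real_arch_simple[of "norm x"] by auto
  qed
  moreover have "countable (\<Union>n. S \<inter> cball 0 (real n))"
    using assms by (intro countable_UN) (auto intro: countable_finite)
  ultimately show ?thesis by (rule countable_subset)
qed

lemma fourier_measure_translate:
  fixes \<mu> \<sigma> :: "'a::euclidean_space set \<Rightarrow> complex"
  assumes "complex_radon \<mu>" "discrete_measure \<mu>" "temperate_variation \<mu>" "is_fourier_measure \<mu> \<sigma>" "\<psi> \<in> test_functions"
  shows "radon_integral \<sigma> (\<lambda>x. \<psi> (x - t)) = ap_series (\<lambda>x. \<mu> {x} * fourier \<psi> x) t"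
proof -
  have "(\<lambda>x. \<psi> (x - t)) \<in> test_functions"
    using test_functions_affine[OF assms(5), of 1 "- t"] by simp
  from fourier_measure_sum(2)[OF assms(1-4) this] show ?thesis
    by (simp add: ap_series_def fourier_translate[OF assms(5)] mult_ac)
qed

theorem theorem6:
  fixes \<mu> \<nu> :: "'a::euclidean_space set \<Rightarrow> complex"
    and \<Lambda> \<gamma> :: "nat \<Rightarrow> 'a"
  assumes "fourier_quasicrystal \<mu>" and "fourier_quasicrystal \<nu>"
    and "\<exists>C::nat. \<forall>y. finite (spectrum \<mu> \<inter> ball y 1) \<and> card (spectrum \<mu> \<inter> ball y 1) \<le> C"
    and "\<exists>C::nat. \<forall>y. finite (spectrum \<nu> \<inter> ball y 1) \<and> card (spectrum \<nu> \<inter> ball y 1) \<le> C"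
    and "bij_betw \<Lambda> {1..} (spectrum \<mu>)"
    and "bij_betw \<gamma> {1..} (spectrum \<nu>)"
    and "(\<lambda>n. \<Lambda> n - \<gamma> n) \<longlonglongrightarrow> 0"
    and "(\<lambda>n. fourier_measure \<mu> {\<Lambda> n} - fourier_measure \<nu> {\<gamma> n}) \<longlonglongrightarrow> 0"
  shows "\<mu> = \<nu>"
proof -
  define \<sigma> where "\<sigma> = fourier_measure \<mu>"
  define \<theta> where "\<theta> = fourier_measure \<nu>"
  have \<mu>: "complex_radon \<mu>" "discrete_measure \<mu>" "temperate_variation \<mu>"
    and \<nu>: "complex_radon \<nu>" "discrete_measure \<nu>" "temperate_variation \<nu>"
    and \<sigma>2: "discrete_measure \<sigma>" and \<theta>2: "discrete_measure \<theta>"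
    using assms(1,2) by (simp_all add: fourier_quasicrystal_def \<sigma>_def \<theta>_def)
  \<comment> \<open>The definition of a quasicrystal asserts that a transform exists, so the chosen
    one has the defining property.\<close>
  have F\<mu>: "is_fourier_measure \<mu> \<sigma>" and F\<nu>: "is_fourier_measure \<nu> \<theta>"
    using assms(1,2) someI_ex[of "is_fourier_measure \<mu>"] someI_ex[of "is_fourier_measure \<nu>"]
    by (auto simp: fourier_quasicrystal_def \<sigma>_def \<theta>_def fourier_measure_def)
  have \<sigma>: "complex_radon \<sigma>" "discrete_measure \<sigma>" and \<theta>: "complex_radon \<theta>" "discrete_measure \<theta>"
    using F\<mu> F\<nu> \<sigma>2 \<theta>2 by (simp_all add: is_fourier_measure_def)
  \<comment> \<open>One countable set of frequencies for both measures, so that the same almost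
    periods serve both transforms.\<close>
  define S where "S = msupp \<mu> \<union> msupp \<nu>"
  have S: "countable S"
    unfolding S_def by (intro countable_Un locally_finite_countable
        discrete_measure_locally_finite[OF \<mu>(2)] discrete_measure_locally_finite[OF \<nu>(2)])
  have off: "\<mu> {x} = 0" "\<nu> {x} = 0" if "x \<notin> S" for x
    using that complex_radon_point_outside[OF \<mu>(1,2)] complex_radon_point_outside[OF \<nu>(1,2)]
    by (auto simp: S_def)
  obtain \<tau> :: "nat \<Rightarrow> 'a" where \<tau>: "filterlim (\<lambda>k. norm (\<tau> k)) at_top sequentially"
    "\<And>x. x \<in> S \<Longrightarrow> (\<lambda>k. chr (\<tau> k \<bullet> x)) \<longlonglongrightarrow> 1"
    using simultaneous_recurrence[OF S] by blast
  have conv: "(\<lambda>k. radon_integral \<sigma> (\<lambda>x. \<psi> (x - \<tau> k))) \<longlonglongrightarrow> radon_integral \<sigma> \<psi>"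
    "(\<lambda>k. radon_integral \<theta> (\<lambda>x. \<psi> (x - \<tau> k))) \<longlonglongrightarrow> radon_integral \<theta> \<psi>"
    if \<psi>: "\<psi> \<in> test_functions" for \<psi>
    using fourier_measure_translate[OF \<mu> F\<mu> \<psi>] fourier_measure_translate[OF \<nu> F\<nu> \<psi>]
      fourier_measure_translate[OF \<mu> F\<mu> \<psi>, of 0] fourier_measure_translate[OF \<nu> F\<nu> \<psi>, of 0]
      ap_series_recurrence[OF fourier_measure_sum(1)[OF \<mu> F\<mu> \<psi>], of S \<tau>]
      ap_series_recurrence[OF fourier_measure_sum(1)[OF \<nu> F\<nu> \<psi>], of S \<tau>] off \<tau>(2)
    by simp_all
  obtain C :: nat where C: "\<And>y. finite (msupp \<theta> \<inter> ball y 1) \<and> card (msupp \<theta> \<inter> ball y 1) \<le> C"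
    using assms(4) by (auto simp: spectrum_def \<theta>_def)
  have "\<exists>y. \<forall>z. card (msupp \<theta> \<inter> ball z R) \<le> card (msupp \<theta> \<inter> ball y R)" for R
    using maximal_ball_exists[OF C] by metis
  \<comment> \<open>One maximal ball for each radius. Nothing is known about how the centres move
    with R, so vanishing has to be propagated from large balls in arbitrary position.\<close>
  then obtain Y where Y: "\<And>R z. card (msupp \<theta> \<inter> ball z R) \<le> card (msupp \<theta> \<inter> ball (Y R) R)" by metis
  have agree: "radon_integral \<sigma> \<psi> = radon_integral \<theta> \<psi>"
    if "\<psi> \<in> test_functions" "r < R" "\<And>x. x \<notin> cball (Y R) r \<Longrightarrow> \<psi> x = 0" for \<psi> r R
    by (rule radon_integrals_agree_on_maximal_ball[OF \<sigma> \<theta> Y conv \<tau>(1)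
          assms(5)[unfolded spectrum_def, folded \<sigma>_def] assms(6)[unfolded spectrum_def, folded \<theta>_def]
          assms(7) assms(8)[folded \<sigma>_def \<theta>_def] that])
  have "\<mu> {x} = \<nu> {x}" for x
  proof -
    \<comment> \<open>The bump is adapted to x: \<open>\<rho> * norm x\<close> is at most 1/(4 pi),
      so its transform does not vanish at x. The summand 1 avoids division by 0 at the origin, and
      \<rho> \<le> 1 fixes the margin used below.\<close>
    define \<rho> where "\<rho> = min 1 (1 / (4 * pi * (norm x + 1)))"
    define \<psi> where "\<psi> = (\<lambda>z::'a. complex_of_real (bump \<rho> z))"
    have \<rho>: "\<rho> > 0" "\<rho> \<le> 1" "\<rho> * norm x \<le> 1 / (4 * pi)"
    proof -
      show "\<rho> > 0" "\<rho> \<le> 1" by (auto simp: \<rho>_def intro!: divide_pos_pos mult_pos_pos add_nonneg_pos)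
      have "\<rho> * norm x \<le> 1 / (4 * pi * (norm x + 1)) * norm x"
        by (intro mult_right_mono) (auto simp: \<rho>_def)
      also have "\<dots> = 1 / (4 * pi) * (norm x / (norm x + 1))" by simp
      also have "\<dots> \<le> 1 / (4 * pi) * 1"
        by (intro mult_left_mono) (auto simp: divide_le_eq_1 add_nonneg_pos)
      finally show "\<rho> * norm x \<le> 1 / (4 * pi)" by simp
    qed
    have \<psi>: "\<psi> \<in> test_functions" unfolding \<psi>_def by (rule test_functions_bump[OF \<rho>(1)])
    define c where "c z = (\<mu> {z} - \<nu> {z}) * fourier \<psi> z" for z
    note ints = fourier_measure_sum(1)[OF \<mu> F\<mu> \<psi>] fourier_measure_sum(1)[OF \<nu> F\<nu> \<psi>]
    have c: "integrable (count_space UNIV) c"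
      using Bochner_Integration.integrable_diff[OF ints] by (simp add: c_def[abs_def] left_diff_distrib)
    have c0: "c z = 0" if "z \<notin> S" for z using off[OF that] by (simp add: c_def)
    have diff: "ap_series c t = radon_integral \<sigma> (\<lambda>z. \<psi> (z - t)) - radon_integral \<theta> (\<lambda>z. \<psi> (z - t))" for t
    proof -
      have "ap_series c t = ap_series (\<lambda>z. \<mu> {z} * fourier \<psi> z) t - ap_series (\<lambda>z. \<nu> {z} * fourier \<psi> z) t"
        unfolding ap_series_def c_def left_diff_distrib
        by (intro Bochner_Integration.integral_diff integrable_count_space_mult_bounded ints) simp_all
      then show ?thesis
        by (simp add: fourier_measure_translate[OF \<mu> F\<mu> \<psi>] fourier_measure_translate[OF \<nu> F\<nu> \<psi>])
    qed
    \<comment> \<open>The point t is within k of the centre and the translated bump reaches at most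
      1 further, hence r = k + 1; another unit gives the strictly larger radius R = k + 2.\<close>
    have "ap_series c t = 0" if t: "norm (t - Y (real k + 2)) \<le> real k" for k t
    proof -
      have "(\<lambda>z. \<psi> (z - t)) \<in> test_functions"
        using test_functions_affine[OF \<psi>, of 1 "- t"] by simp
      moreover have "\<psi> (z - t) = 0" if "z \<notin> cball (Y (real k + 2)) (real k + 1)" for z
      proof -
        have "norm (z - Y (real k + 2)) \<le> norm (z - t) + norm (t - Y (real k + 2))"
          using norm_triangle_ineq[of "z - t" "t - Y (real k + 2)"] by simp
        then have "norm (z - t) \<ge> \<rho>" using that t \<rho>(2) by (simp add: dist_norm norm_minus_commute)
        then show ?thesis unfolding \<psi>_def using bump_eq_0[OF \<rho>(1)] by simp
      qed
      ultimately have "radon_integral \<sigma> (\<lambda>z. \<psi> (z - t)) = radon_integral \<theta> (\<lambda>z. \<psi> (z - t))"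
        by (intro agree[where r="real k + 1" and R="real k + 2"]) auto
      then show ?thesis by (simp add: diff)
    qed
    then have "ap_series c t = 0" for t
      using ap_series_eq_0_if_large_balls[OF c S c0, of "\<lambda>k. Y (real k + 2)"] by blast
    then have "c x = 0" using ap_series_coefficients_unique[OF c S c0] by blast
    moreover have "fourier \<psi> x \<noteq> 0"
      unfolding \<psi>_def by (rule fourier_bump_nonzero[OF \<rho>(1,3)])
    ultimately show ?thesis by (simp add: c_def)
  qed
  note masses = this
  show "\<mu> = \<nu>"
  proof
    fix B
    show "\<mu> B = \<nu> B"
    proof (cases "B \<in> bounded_borel")
      case True
      have fin: "finite (S \<inter> B)"
        using discrete_measure_locally_finite[OF \<mu>(2), of B] discrete_measure_locally_finite[OF \<nu>(2), of B] True
        by (simp add: S_def Int_Un_distrib2 bounded_borel_iff)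
      have "\<mu> B = (\<Sum>x\<in>S \<inter> B. \<mu> {x})"
        unfolding discrete_measure_eq_sum[OF \<mu>(1,2) True]
        using complex_radon_point_outside[OF \<mu>(1,2)] by (intro sum.mono_neutral_left fin) (auto simp: S_def)
      also have "\<dots> = (\<Sum>x\<in>S \<inter> B. \<nu> {x})" by (simp add: masses)
      also have "\<dots> = \<nu> B"
        unfolding discrete_measure_eq_sum[OF \<nu>(1,2) True]
        using complex_radon_point_outside[OF \<nu>(1,2)] by (intro sum.mono_neutral_right fin) (auto simp: S_def)
      finally show ?thesis .
    next
      \<comment> \<open>Here both values are 0 by the convention for sets that are not bounded Borel
        sets.\<close>
      case False
      then show ?thesis using \<mu>(1) \<nu>(1) by (simp add: complex_radon_def)
    qed
  qed
qed

end
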